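(* Let $s\in(0,1)$, $N>2s$, $2^*=\frac{2N}{N-2s}$, let $p\ge 2^*-1$ and $q>(p-1)\frac{N}{2s}-1$ (in particular $q>p$), and let $\Omega\subset\mathbb{R}^N$ be either $\mathbb{R}^N$ itself or a bounded domain with smooth boundary. If $u$ is any weak solution of $$(-\Delta)^s u=u^p-u^q\ \text{ in }\mathbb{R}^N,\quad u\in\dot H^s(\mathbb{R}^N)\cap L^{q+1}(\mathbb{R}^N),\quad u>0\ \text{ in }\mathbb{R}^N$$ (when $\Omega=\mathbb{R}^N$), or any weak solution of $$(-\Delta)^s u=u^p-u^q\ \text{ in }\Omega,\quad u=0\ \text{ in }\mathbb{R}^N\setminus\Omega,\quad u>0\ \text{ in }\Omega,\quad u\in X_0\cap L^{q+1}(\Omega)$$ (when $\Omega$ is bounded), then $u\in L^\infty(\mathbb{R}^N)$. Moreover, if $\Omega=\mathbb{R}^N$, then there exist positive constants $C_1,C_2$ and some $R_0>0$ such that $$C_1|x|^{-(N-2s)}\le u(x)\le C_2|x|^{-(N-2s)}\quad\text{for } |x|>R_0.$$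
   Context: $c_{N,s}=\frac{2^{2s}s\,\Gamma(\frac N2+s)}{\pi^{N/2}\Gamma(1-s)}$. Set $\|u\|^2_{\dot H^s(\mathbb{R}^N)}=\frac{c_{N,s}}{2}\int_{\mathbb{R}^N}\int_{\mathbb{R}^N}\frac{|u(x)-u(y)|^2}{|x-y|^{N+2s}}\,dx\,dy$; $\dot H^s(\mathbb{R}^N)$ is the completion of $C_0^\infty(\mathbb{R}^N)$ with respect to $\|u\|_{\dot H^s(\mathbb{R}^N)}+|u|_{L^{2^*}(\mathbb{R}^N)}$. For bounded $\Omega$, $X_0=\{v\in H^s(\mathbb{R}^N): v=0 \text{ in }\mathbb{R}^N\setminus\Omega\}$, where $H^s(\mathbb{R}^N)$ is the usual fractional Sobolev space. A weak solution of the problem in $\mathbb{R}^N$ is a function $u\in\dot H^s(\mathbb{R}^N)\cap L^{q+1}(\mathbb{R}^N)$ with $u>0$ in $\mathbb{R}^N$ such that for every $\varphi\in\dot H^s(\mathbb{R}^N)$ $$\frac{c_{N,s}}{2}\int_{\mathbb{R}^N}\int_{\mathbb{R}^N}\frac{(u(x)-u(y))(\varphi(x)-\varphi(y))}{|x-y|^{N+2s}}\,dx\,dy=\int_{\mathbb{R}^N}u^p\varphi\,dx-\int_{\mathbb{R}^N}u^q\varphi\,dx .$$ A weak solution of the problem in a bounded $\Omega$ is a function $u\in X_0\cap L^{q+1}(\Omega)$ with $u>0$ in $\Omega$ such that the same identity holds for every $\varphi\in X_0$. *)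

theory Defs
  imports "HOL-Analysis.Analysis"
begin

text \<open>Elements of Lebesgue and Sobolev spaces are represented by Lebesgue-measurable functions,
  without passing to the quotient by a.e. equality; pointwise relations between such functions
  (\<open>u > 0\<close>, \<open>u = 0\<close> outside a set, bounds) are therefore meant almost everywhere.
  The dimension is \<open>N = CARD('n)\<close>.\<close>

subsection \<open>Constants\<close>

definition crit_exp :: "nat \<Rightarrow> real \<Rightarrow> real" where
  "crit_exp N s = 2 * real N / (real N - 2 * s)"

definition frac_const :: "nat \<Rightarrow> real \<Rightarrow> real" where
  "frac_const N s =
     2 powr (2 * s) * s * Gamma (real N / 2 + s) / (pi powr (real N / 2) * Gamma (1 - s))"

subsection \<open>Smooth functions and smooth bounded domains\<close>

primrec C_k :: "nat \<Rightarrow> ('a::euclidean_space \<Rightarrow> real) \<Rightarrow> bool" where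
  "C_k 0 f \<longleftrightarrow> continuous_on UNIV f"
| "C_k (Suc k) f \<longleftrightarrow>
     (\<forall>x. f differentiable (at x)) \<and>
     (\<forall>b\<in>Basis. C_k k (\<lambda>x. frechet_derivative f (at x) b))"

definition smooth :: "('a::euclidean_space \<Rightarrow> real) \<Rightarrow> bool" where
  "smooth f \<longleftrightarrow> (\<forall>k. C_k k f)"

definition test_functions :: "('a::euclidean_space \<Rightarrow> real) set" where
  "test_functions = {f. smooth f \<and> compact (closure {x. f x \<noteq> 0})}"

text \<open>Near each boundary point the domain is the region above a smooth graph, in the direction
  of some unit vector \<open>e\<close>. The function \<open>\<gamma>\<close> is only evaluated on the hyperplane orthogonal to
  \<open>e\<close>, which plays the role of \<open>\<real>\<^sup>N\<^sup>-\<^sup>1\<close>.\<close>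

definition smooth_boundary :: "'a::euclidean_space set \<Rightarrow> bool" where
  "smooth_boundary \<Omega> \<longleftrightarrow>
     (\<forall>x0\<in>frontier \<Omega>. \<exists>r>0. \<exists>e \<gamma>. norm e = 1 \<and> smooth \<gamma> \<and>
        \<Omega> \<inter> ball x0 r = {x \<in> ball x0 r. \<gamma> (x - (x \<bullet> e) *\<^sub>R e) < x \<bullet> e})"

definition smooth_bounded_domain :: "'a::euclidean_space set \<Rightarrow> bool" where
  "smooth_bounded_domain \<Omega> \<longleftrightarrow>
     \<Omega> \<noteq> {} \<and> open \<Omega> \<and> connected \<Omega> \<and> bounded \<Omega> \<and> smooth_boundary \<Omega>"

subsection \<open>Lebesgue spaces\<close>

definition Lp :: "real \<Rightarrow> 'a::euclidean_space set \<Rightarrow> ('a \<Rightarrow> real) set" where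
  "Lp r A = {u. u \<in> borel_measurable (lebesgue_on A) \<and>
                integrable (lebesgue_on A) (\<lambda>x. \<bar>u x\<bar> powr r)}"

definition Linf :: "('a::euclidean_space \<Rightarrow> real) set" where
  "Linf = {u. u \<in> borel_measurable lebesgue \<and> (\<exists>C. AE x in lebesgue. \<bar>u x\<bar> \<le> C)}"

text \<open>Norms take values in \<open>[0,\<infinity>]\<close>, so that a function outside the space has norm \<open>\<infinity>\<close> (rather
  than 0); \<open>enn_powr\<close> is the power with positive exponent there.\<close>

definition enn_powr :: "ennreal \<Rightarrow> real \<Rightarrow> ennreal" where
  "enn_powr x a = (if x = \<infinity> then \<infinity> else ennreal (enn2real x powr a))"

definition Lp_norm :: "real \<Rightarrow> ('a::euclidean_space \<Rightarrow> real) \<Rightarrow> ennreal" where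
  "Lp_norm r u = enn_powr (\<integral>\<^sup>+x. ennreal (\<bar>u x\<bar> powr r) \<partial>lebesgue) (1 / r)"

subsection \<open>Fractional Sobolev spaces\<close>

definition Hdot_norm :: "real \<Rightarrow> (real ^ 'n \<Rightarrow> real) \<Rightarrow> ennreal" where
  "Hdot_norm s u =
     enn_powr (ennreal (frac_const CARD('n) s / 2) *
       (\<integral>\<^sup>+y. \<integral>\<^sup>+x. ennreal (\<bar>u x - u y\<bar>\<^sup>2 / norm (x - y) powr (real CARD('n) + 2 * s))
          \<partial>lebesgue \<partial>lebesgue)) (1 / 2)"

definition Hdot_form :: "real \<Rightarrow> (real ^ 'n \<Rightarrow> real) \<Rightarrow> (real ^ 'n \<Rightarrow> real) \<Rightarrow> real" where
  "Hdot_form s u \<phi> =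
     frac_const CARD('n) s / 2 *
       (\<integral>y. (\<integral>x. (u x - u y) * (\<phi> x - \<phi> y) / norm (x - y) powr (real CARD('n) + 2 * s)
          \<partial>lebesgue) \<partial>lebesgue)"

text \<open>The completion of the test functions with respect to the sum of the two norms. Since
  \<open>L\<^sup>2\<^sup>*\<close> is complete and the double integral is lower semicontinuous under a.e. convergence, this
  completion is realised inside \<open>L\<^sup>2\<^sup>*\<close> as the closure of the test functions.\<close>

definition Hdot :: "real \<Rightarrow> (real ^ 'n \<Rightarrow> real) set" where
  "Hdot s = {u. u \<in> borel_measurable lebesgue \<and>
     (\<exists>f. (\<forall>k::nat. f k \<in> test_functions) \<and>
        (\<lambda>k. Hdot_norm s (\<lambda>x. f k x - u x) + Lp_norm (crit_exp CARD('n) s) (\<lambda>x. f k x - u x))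
          \<longlonglongrightarrow> 0)}"

definition Hs :: "real \<Rightarrow> (real ^ 'n \<Rightarrow> real) set" where
  "Hs s = {u. u \<in> Lp 2 UNIV \<and> Hdot_norm s u < \<infinity>}"

definition X0 :: "real \<Rightarrow> (real ^ 'n) set \<Rightarrow> (real ^ 'n \<Rightarrow> real) set" where
  "X0 s \<Omega> = {v \<in> Hs s. AE x in lebesgue. x \<notin> \<Omega> \<longrightarrow> v x = 0}"

subsection \<open>Weak solutions\<close>

text \<open>The weak identity includes the existence of the two integrals on the right-hand side, as a
  divergent Bochner integral would have value 0. The integrand of \<open>Hdot_form\<close> is always
  integrable for functions with finite \<open>Hdot_norm\<close>.\<close>

definition weak_identity ::
    "real \<Rightarrow> real \<Rightarrow> real \<Rightarrow> (real ^ 'n \<Rightarrow> real) \<Rightarrow> (real ^ 'n \<Rightarrow> real) \<Rightarrow> bool" where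
  "weak_identity s p q u \<phi> \<longleftrightarrow>
     integrable lebesgue (\<lambda>x. u x powr p * \<phi> x) \<and>
     integrable lebesgue (\<lambda>x. u x powr q * \<phi> x) \<and>
     Hdot_form s u \<phi> =
       (\<integral>x. u x powr p * \<phi> x \<partial>lebesgue) - (\<integral>x. u x powr q * \<phi> x \<partial>lebesgue)"

definition weak_solution_space :: "real \<Rightarrow> real \<Rightarrow> real \<Rightarrow> (real ^ 'n \<Rightarrow> real) \<Rightarrow> bool" where
  "weak_solution_space s p q u \<longleftrightarrow>
     u \<in> Hdot s \<inter> Lp (q + 1) UNIV \<and>
     (AE x in lebesgue. u x > 0) \<and>
     (\<forall>\<phi>\<in>Hdot s. weak_identity s p q u \<phi>)"

definition weak_solution_domain ::
    "real \<Rightarrow> real \<Rightarrow> real \<Rightarrow> (real ^ 'n) set \<Rightarrow> (real ^ 'n \<Rightarrow> real) \<Rightarrow> bool" where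
  "weak_solution_domain s p q \<Omega> u \<longleftrightarrow>
     u \<in> X0 s \<Omega> \<inter> Lp (q + 1) \<Omega> \<and>
     (AE x in lebesgue. x \<in> \<Omega> \<longrightarrow> u x > 0) \<and>
     (\<forall>\<phi>\<in>X0 s \<Omega>. weak_identity s p q u \<phi>)"

end

theory Submission
  imports Defs "HOL-Real_Asymp.Real_Asymp"
begin

text \<open>The cutoff \<open>k(t) = t exp(-1/(t-1))\<close> for \<open>t > 1\<close>, \<open>k(t) = 0\<close> for \<open>t \<le> 1\<close>, is smooth, monotone and
  Lipschitz. Testing with \<open>k(u)\<close> gives \<open>0 \<le> E(u, k(u)) = \<integral> (u\<^sup>p - u\<^sup>q) k(u) \<le> 0\<close>, so \<open>u \<le> 1\<close> almost everywhere.

  In the whole space the rescaled bubbles \<open>(1 + |x|\<^sup>2)\<^sup>-\<^sup>(\<^sup>N\<^sup>-\<^sup>2\<^sup>s\<^sup>)\<^sup>/\<^sup>2\<close> are admissible test functions. Their fractional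
  Laplacian is an explicit nonnegative integrable function, as one sees by folding the exterior of
  the sphere through \<open>x\<close> into its interior by an inversion. Letting the scale tend to zero turns the weak
  equation into \<open>K u = |x|\<^sup>-\<^sup>(\<^sup>N\<^sup>-\<^sup>2\<^sup>s\<^sup>) * (u\<^sup>p - u\<^sup>q)\<close> almost everywhere, with a constant \<open>K > 0\<close>.

  Since \<open>0 < u \<le> 1\<close> and \<open>p < q\<close>, the right hand side is nonnegative, which gives the lower bound. For the upper bound
  only \<open>u \<le> C |x|\<^sup>-\<^sup>(\<^sup>N\<^sup>-\<^sup>2\<^sup>s\<^sup>) * u\<^sup>r\<close> with the critical power \<open>r = 2\<^sup>* - 1\<close> is used: a scaling argument shows that \<open>u\<close> is
  \<open>o(|x|\<^sup>-\<^sup>(\<^sup>N\<^sup>-\<^sup>2\<^sup>s\<^sup>)\<^sup>/\<^sup>2)\<close>; then a contraction with the weight \<open>|x|\<^sup>-\<^sup>\<alpha> + m |x|\<^sup>-\<^sup>(\<^sup>N\<^sup>-\<^sup>2\<^sup>s\<^sup>)\<^sup>/\<^sup>2\<close>, \<open>m \<rightarrow> 0\<close>, reaches every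
  rate \<open>\<alpha> < N - 2s\<close>, and one more application of the bound reaches \<open>N - 2s\<close> itself.\<close>

subsection \<open>Smooth functions\<close>

text \<open>The admissible test functions are limits of smooth compactly supported functions, and no
  mollification is used. This dictates the constructions: truncations are compositions with the
  smooth \<open>cutoff\<close>, which sends test functions to test functions, and the Riesz kernel
  |x|^-(N-2s), whose energy is infinite, is reached as the increasing limit of multiples of rescaled
  bubbles, (c^2 + |x|^2)^(-(N-2s)/2). The integral of the fractional Laplacian of the bubble is
  never computed: K is \<open>frac_const\<close> times this integral, and its positivity is deduced
  afterwards, because K = 0 would contradict the lower bound for the potential. Principal values are
  avoided by truncating in the ratio |y|/|x|; before the limit all identities are additive
  identities between nonnegative integrals. For the decay the critical power is the natural one: u
  <= 1 allows the exponent p to be lowered to it, and with the finite critical Lebesgue norm of u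
  the resulting inequality is scale invariant, so that a tail of small mass is small in the same
  sense at every scale.\<close>

lemma C_k_continuous: "C_k k f \<Longrightarrow> continuous_on UNIV f"
  by (cases k) (auto simp: continuous_on_eq_continuous_at differentiable_imp_continuous_within)

lemma C_k_SucD: "C_k (Suc k) f \<Longrightarrow> C_k k f"
proof (induction k arbitrary: f)
  case 0
  then show ?case using C_k_continuous C_k.simps(1) by blast
next
  case (Suc k)
  then show ?case by (subst C_k.simps) (subst (asm) C_k.simps, blast)
qed

lemma C_k_const: "C_k k (\<lambda>x. c)"
  by (induction k arbitrary: c) (auto simp: frechet_derivative_const)

text \<open>\<open>C_k\<close> is phrased with the chosen derivative
  \<open>frechet_derivative\<close>; uniqueness of derivatives allows any explicit formula in its
  place, which the inductions below need.\<close>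

lemma C_k_SucI:
  assumes "\<And>x. (f has_derivative f' x) (at x)" "\<And>b. b \<in> Basis \<Longrightarrow> C_k k (\<lambda>x. f' x b)"
  shows "C_k (Suc k) f"
proof -
  have "frechet_derivative f (at x) = f' x" for x
    using assms(1) frechet_derivative_at by metis
  then show ?thesis using assms by (auto simp: differentiable_def)
qed

lemma C_k_SucE:
  assumes "C_k (Suc k) f"
  obtains f' where "\<And>x. (f has_derivative f' x) (at x)" "\<And>b. b \<in> Basis \<Longrightarrow> C_k k (\<lambda>x. f' x b)"
  using assms that[of "\<lambda>x. frechet_derivative f (at x)"] by (auto simp: frechet_derivative_works)

lemma C_k_add:
  assumes "C_k k f" "C_k k g"
  shows "C_k k (\<lambda>x. f x + g x)"
  using assms
proof (induction k arbitrary: f g)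
  case 0
  then show ?case by (auto intro: continuous_on_add)
next
  case (Suc k)
  obtain f' where f': "\<And>x. (f has_derivative f' x) (at x)" "\<And>b. b \<in> Basis \<Longrightarrow> C_k k (\<lambda>x. f' x b)"
    using C_k_SucE[OF Suc.prems(1)] by blast
  obtain g' where g': "\<And>x. (g has_derivative g' x) (at x)" "\<And>b. b \<in> Basis \<Longrightarrow> C_k k (\<lambda>x. g' x b)"
    using C_k_SucE[OF Suc.prems(2)] by blast
  show ?case
    by (rule C_k_SucI[where f'="\<lambda>x h. f' x h + g' x h"])
       (auto intro!: has_derivative_add f' g' Suc.IH)
qed

lemma C_k_mult:
  assumes "C_k k f" "C_k k g"
  shows "C_k k (\<lambda>x. f x * g x)"
  using assms
proof (induction k arbitrary: f g)
  case 0
  then show ?case by (auto intro: continuous_on_mult)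
next
  case (Suc k)
  obtain f' where f': "\<And>x. (f has_derivative f' x) (at x)" "\<And>b. b \<in> Basis \<Longrightarrow> C_k k (\<lambda>x. f' x b)"
    using C_k_SucE[OF Suc.prems(1)] by blast
  obtain g' where g': "\<And>x. (g has_derivative g' x) (at x)" "\<And>b. b \<in> Basis \<Longrightarrow> C_k k (\<lambda>x. g' x b)"
    using C_k_SucE[OF Suc.prems(2)] by blast
  have *: "C_k k f" "C_k k g" using Suc.prems by (auto dest: C_k_SucD simp del: C_k.simps)
  show ?case
    by (rule C_k_SucI[where f'="\<lambda>x h. f x * g' x h + f' x h * g x"])
       (auto intro!: has_derivative_mult C_k_add f' g' Suc.IH *)
qed

text \<open>\<open>G\<close> lists the outer function together with all its derivatives, so that the
  induction on \<open>k\<close> can run over all \<open>j\<close> at once. Differentiability of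
  \<open>G j\<close> is asked only at values of \<open>f\<close>; this admits real powers composed
  with positive functions.\<close>

lemma C_k_compose:
  fixes G :: "nat \<Rightarrow> real \<Rightarrow> real"
  assumes G: "\<And>j x. (G j has_real_derivative G (Suc j) (f x)) (at (f x))"
    and f: "C_k k f"
  shows "C_k k (\<lambda>x. G j (f x))"
  using f G
proof (induction k arbitrary: j)
  case 0
  have "continuous_on UNIV (\<lambda>x. G j (f x))"
    unfolding continuous_on_eq_continuous_at[OF open_UNIV]
  proof
    fix x
    have "isCont f x" using 0(1) by (auto simp: continuous_on_eq_continuous_at)
    moreover have "isCont (G j) (f x)" using 0(2) DERIV_isCont by blast
    ultimately show "isCont (\<lambda>x. G j (f x)) x" by (rule isCont_o2)
  qed
  then show ?case by simp
next
  case (Suc k)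
  obtain f' where f': "\<And>x. (f has_derivative f' x) (at x)" "\<And>b. b \<in> Basis \<Longrightarrow> C_k k (\<lambda>x. f' x b)"
    using C_k_SucE[OF Suc.prems(1)] by blast
  have *: "C_k k f" using Suc.prems by (auto dest: C_k_SucD simp del: C_k.simps)
  show ?case
  proof (rule C_k_SucI[where f'="\<lambda>x h. G (Suc j) (f x) * f' x h"])
    show "((\<lambda>x. G j (f x)) has_derivative (\<lambda>h. G (Suc j) (f x) * f' x h)) (at x)" for x
      using has_derivative_compose[OF f'(1) Suc.prems(2)[unfolded has_field_derivative_def]] .
    show "C_k k (\<lambda>x. G (Suc j) (f x) * f' x b)" if "b \<in> Basis" for b
      by (intro C_k_mult Suc.IH * Suc.prems f' that)
  qed
qed

lemma smooth_mult: "smooth f \<Longrightarrow> smooth g \<Longrightarrow> smooth (\<lambda>x. f x * g x)"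
  by (simp add: smooth_def C_k_mult)

lemma smooth_add: "smooth f \<Longrightarrow> smooth g \<Longrightarrow> smooth (\<lambda>x. f x + g x)"
  by (simp add: smooth_def C_k_add)

lemma smooth_const: "smooth (\<lambda>x. c)"
  by (simp add: smooth_def C_k_const)

lemma smooth_compose:
  fixes G :: "nat \<Rightarrow> real \<Rightarrow> real"
  assumes "\<And>j x. (G j has_real_derivative G (Suc j) (f x)) (at (f x))" "smooth f"
  shows "smooth (\<lambda>x. G j (f x))"
  using assms unfolding smooth_def by (blast intro: C_k_compose)

lemma smooth_inner: "smooth (\<lambda>x. x \<bullet> a)"
proof -
  have "C_k k (\<lambda>x. x \<bullet> a)" for k
  proof (cases k)
    case (Suc k)
    show ?thesis unfolding Suc
      by (rule C_k_SucI[where f'="\<lambda>x h. h \<bullet> a"]) (auto intro!: derivative_eq_intros C_k_const)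
  qed (auto intro!: continuous_intros)
  then show ?thesis by (simp add: smooth_def)
qed

lemma smooth_sum: "(\<And>i. i \<in> I \<Longrightarrow> smooth (f i)) \<Longrightarrow> smooth (\<lambda>x. \<Sum>i\<in>I. f i x)"
  by (induction I rule: infinite_finite_induct) (auto intro: smooth_add smooth_const)

lemma smooth_norm_square: "smooth (\<lambda>x::'a::euclidean_space. (norm (x - a))\<^sup>2)"
proof -
  have "(norm (x - a))\<^sup>2 = (\<Sum>b\<in>Basis. (x \<bullet> b + - (a \<bullet> b)) * (x \<bullet> b + - (a \<bullet> b)))" for x :: 'a
    unfolding power2_norm_eq_inner by (subst euclidean_inner) (simp add: inner_diff_left)
  then show ?thesis
    by (simp del: add_uminus_conv_diff) (intro smooth_sum smooth_mult smooth_add smooth_inner smooth_const)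
qed

lemma smooth_continuous_on: "smooth f \<Longrightarrow> continuous_on UNIV f"
  using C_k_continuous smooth_def by blast

subsection \<open>The cutoff profile\<close>

text \<open>With z = 1/(t-1), the class P(z) exp(-z) is closed under differentiation: d/dt maps P to
  z^2 (P - P'). It contains all derivatives of exp(-1/(t-1)), extended by 0 to t <= 1.\<close>

definition flat :: "real poly \<Rightarrow> real \<Rightarrow> real" where
  "flat P t = (if t > 1 then poly P (1 / (t - 1)) * exp (- (1 / (t - 1))) else 0)"

lemma tendsto_poly_mult_exp_0: "((\<lambda>z::real. poly P z * exp (- z)) \<longlongrightarrow> 0) at_top"
proof -
  have "((\<lambda>z::real. \<Sum>i\<le>degree P. coeff P i * (z ^ i / exp z)) \<longlongrightarrow> (\<Sum>i\<le>degree P. coeff P i * 0)) at_top"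
    by (intro tendsto_intros tendsto_power_div_exp_0)
  moreover have "(\<lambda>z::real. \<Sum>i\<le>degree P. coeff P i * (z ^ i / exp z)) = (\<lambda>z. poly P z * exp (- z))"
    by (auto simp: poly_altdef exp_minus sum_distrib_left divide_inverse mult_ac)
  ultimately show ?thesis by simp
qed

lemma flat_derivative:
  "(flat P has_real_derivative flat ([:0, 0, 1:] * (P - pderiv P)) t) (at t)"
proof -
  consider "t < 1" | "t = 1" | "t > 1" by linarith
  then show ?thesis
  proof cases
    case 1
    have "((\<lambda>t::real. 0) has_real_derivative 0) (at t)" by simp
    then have "(flat P has_real_derivative 0) (at t)"
      by (rule has_field_derivative_transform_within_open[of _ _ _ "{..<1}"]) (use 1 in \<open>auto simp: flat_def\<close>)
    with 1 show ?thesis by (simp add: flat_def)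
  next
    case 2
    have lim: "filterlim (\<lambda>t::real. 1 / (t - 1)) at_top (at_right 1)"
    proof -
      have "filterlim (\<lambda>t::real. t - 1) (at_right 0) (at_right 1)"
        unfolding filterlim_at by (auto simp: eventually_at_filter intro!: tendsto_eq_intros)
      then show ?thesis
        using filterlim_compose[OF filterlim_inverse_at_top_right] by (simp add: field_simps)
    qed
    \<comment> \<open>At t = 1 the difference quotient from the right is z P(z) exp(-z) with z =
      1/(t-1) tending to infinity, hence the extra factor z.\<close>
    have "((\<lambda>z. poly ([:0, 1:] * P) z * exp (- z)) \<longlongrightarrow> 0) at_top" by (rule tendsto_poly_mult_exp_0)
    from filterlim_compose[OF this lim]
    have "((\<lambda>t. (flat P t - flat P 1) / (t - 1)) \<longlongrightarrow> 0) (at_right 1)"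
      by (rule Lim_transform_eventually)
         (auto simp: eventually_at_filter flat_def field_simps)
    moreover have "((\<lambda>t. (flat P t - flat P 1) / (t - 1)) \<longlongrightarrow> 0) (at_left 1)"
      by (rule Lim_transform_eventually[of "\<lambda>_. 0"]) (auto simp: eventually_at_filter flat_def)
    ultimately have "((\<lambda>t. (flat P t - flat P 1) / (t - 1)) \<longlongrightarrow> 0) (at 1)"
      by (rule filterlim_split_at[rotated])
    with 2 show ?thesis by (simp add: has_field_derivative_iff flat_def)
  next
    case 3
    define z where "z = 1 / (t - 1)"
    have dz: "((\<lambda>t. 1 / (t - 1)) has_real_derivative - z\<^sup>2) (at t)"
      using 3 by (auto intro!: derivative_eq_intros simp: z_def power2_eq_square)
    have "((\<lambda>t. poly P (1 / (t - 1)) * exp (- (1 / (t - 1)))) has_real_derivative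
        poly (pderiv P) z * - z\<^sup>2 * exp (- z) + exp (- z) * z\<^sup>2 * poly P z) (at t)"
      unfolding z_def[symmetric]
      by (rule derivative_eq_intros DERIV_chain2[OF poly_DERIV, where g="\<lambda>t. 1 / (t - 1)"] dz[unfolded z_def] refl | simp add: z_def)+
    also have "poly (pderiv P) z * - z\<^sup>2 * exp (- z) + exp (- z) * z\<^sup>2 * poly P z =
        flat ([:0, 0, 1:] * (P - pderiv P)) t"
      using 3 by (simp add: flat_def z_def[symmetric] algebra_simps power2_eq_square)
    finally have "((\<lambda>t. poly P (1 / (t - 1)) * exp (- (1 / (t - 1)))) has_real_derivative
        flat ([:0, 0, 1:] * (P - pderiv P)) t) (at t)" .
    then show ?thesis
      by (rule has_field_derivative_transform_within_open[of _ _ _ "{1<..}"]) (use 3 in \<open>auto simp: flat_def\<close>)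
  qed
qed

text \<open>The exponential makes the truncation at 1 smooth, the factor t makes it grow linearly:
  cutoff(n t)/n tends to t for t > 0. The same profile therefore serves to test where u > 1 and,
  rescaled, to approximate the identity map.\<close>

definition cutoff :: "real \<Rightarrow> real" where
  "cutoff t = (if t > 1 then t * exp (- (1 / (t - 1))) else 0)"

lemma smooth_flat: "smooth f \<Longrightarrow> smooth (\<lambda>x. flat 1 (f x))"
  using smooth_compose[of "\<lambda>j. flat (((\<lambda>P. [:0, 0, 1:] * (P - pderiv P)) ^^ j) 1)" f 0] flat_derivative
  by simp

lemma cutoff_eq: "cutoff t = t * flat 1 t"
  by (simp add: cutoff_def flat_def)

lemma smooth_cutoff: "smooth f \<Longrightarrow> smooth (\<lambda>x. cutoff (f x))"
  unfolding cutoff_eq by (intro smooth_mult smooth_flat)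

lemma cutoff_derivative:
  obtains d where "(cutoff has_real_derivative d) (at t)" "0 \<le> d" "d \<le> 2"
proof
  let ?d = "flat 1 t + t * flat [:0, 0, 1:] t"
  have "cutoff = (\<lambda>t. t * flat 1 t)" by (auto simp: cutoff_eq)
  then show "(cutoff has_real_derivative ?d) (at t)"
    using DERIV_mult[OF DERIV_ident flat_derivative[of 1 t, simplified]] by (simp add: mult.commute add.commute)
  show "0 \<le> ?d" by (auto simp: flat_def)
  show "?d \<le> 2"
  proof (cases "t > 1")
    case True
    define z where "z = 1 / (t - 1)"
    have z: "z > 0" "t = 1 + 1 / z" using True by (auto simp: z_def)
    have "?d = exp (- z) * (1 + z + z\<^sup>2)"
    proof -
      have "t * z = z + 1" using z by (simp add: field_simps)
      then have "t * z\<^sup>2 = z + z\<^sup>2" by (metis mult.assoc power2_eq_square distrib_right mult_1 add.commute)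
      then have "exp (- z) + (t * z\<^sup>2) * exp (- z) = exp (- z) * (1 + z + z\<^sup>2)" by (simp add: algebra_simps)
      then show ?thesis
        using True unfolding flat_def z_def[symmetric] by (simp add: power2_eq_square mult_ac)
    qed
    \<comment> \<open>The Lipschitz constant 2: 1 + z + z^2 <= 2 (1 + z + z^2/2) <= 2 exp z.\<close>
    also have "\<dots> \<le> exp (- z) * (2 * exp z)"
      using exp_lower_Taylor_quadratic[of z] z by (intro mult_left_mono) auto
    also have "\<dots> = 2" by (simp add: exp_minus)
    finally show ?thesis .
  qed (auto simp: flat_def)
qed

lemma cutoff_mono_lipschitz:
  assumes "a \<le> b"
  shows "0 \<le> cutoff b - cutoff a \<and> cutoff b - cutoff a \<le> 2 * (b - a)"
proof (cases "a = b")
  case False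
  obtain d where d: "\<And>t. (cutoff has_real_derivative d t) (at t)" "\<And>t. 0 \<le> d t" "\<And>t. d t \<le> 2"
    using cutoff_derivative choice[of "\<lambda>t d. (cutoff has_real_derivative d) (at t) \<and> 0 \<le> d \<and> d \<le> 2"]
    by metis
  obtain z where "cutoff b - cutoff a = (b - a) * d z"
    using MVT2[of a b cutoff d] d(1) assms False by force
  moreover have "(b - a) * d z \<le> (b - a) * 2" using d(3)[of z] assms by (intro mult_left_mono) auto
  ultimately show ?thesis using d(2)[of z] assms by simp
qed auto

lemma cutoff_mono: "a \<le> b \<Longrightarrow> cutoff a \<le> cutoff b"
  using cutoff_mono_lipschitz by fastforce

lemma cutoff_lipschitz: "\<bar>cutoff a - cutoff b\<bar> \<le> 2 * \<bar>a - b\<bar>"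
  using cutoff_mono_lipschitz[of a b] cutoff_mono_lipschitz[of b a] by (cases "a \<le> b") auto

lemma cutoff_nonneg: "0 \<le> cutoff t" by (simp add: cutoff_def)
lemma cutoff_pos_iff: "0 < cutoff t \<longleftrightarrow> t > 1" by (simp add: cutoff_def)
lemma cutoff_zero: "t \<le> 1 \<Longrightarrow> cutoff t = 0" by (simp add: cutoff_def)
lemma cutoff_le: "0 \<le> t \<Longrightarrow> cutoff t \<le> t"
  by (auto simp: cutoff_def mult_left_le)

lemma cutoff_rescaled_tendsto:
  assumes "0 < t"
  shows "(\<lambda>k. cutoff (real (Suc k) * t) / real (Suc k)) \<longlonglongrightarrow> t"
proof -
  have lim: "filterlim (\<lambda>k. real (Suc k) * t) at_top sequentially"
    using assms by (intro filterlim_at_top_mult_tendsto_pos[OF tendsto_const]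
        filterlim_compose[OF filterlim_real_sequentially filterlim_Suc])
       
  have "filterlim (\<lambda>k. real (Suc k) * t - 1) at_infinity sequentially"
    using filterlim_at_top_imp_at_infinity[OF filterlim_tendsto_add_at_top[OF tendsto_const[of "-1"] lim]]
    by simp
  then have "(\<lambda>k. t * exp (- (1 / (real (Suc k) * t - 1)))) \<longlonglongrightarrow> t * exp (- 0)"
    by (intro tendsto_intros tendsto_divide_0[OF tendsto_const])
  then have "(\<lambda>k. t * exp (- (1 / (real (Suc k) * t - 1)))) \<longlonglongrightarrow> t" by simp
  then show ?thesis
  proof (rule Lim_transform_eventually)
    have "eventually (\<lambda>k. real (Suc k) * t > 1) sequentially"
      using lim by (simp add: filterlim_at_top_dense)
    then show "eventually (\<lambda>k. t * exp (- (1 / (real (Suc k) * t - 1))) = cutoff (real (Suc k) * t) / real (Suc k)) sequentially"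
      by eventually_elim (simp add: cutoff_def)
  qed
qed

subsection \<open>Polar coordinates and inversion\<close>

lemma nn_integral_lborel_affine:
  fixes f :: "'a::euclidean_space \<Rightarrow> ennreal"
  assumes [measurable]: "f \<in> borel_measurable borel" and c: "c \<noteq> 0"
  shows "(\<integral>\<^sup>+x. f x \<partial>lborel) = ennreal (\<bar>c\<bar> ^ DIM('a)) * (\<integral>\<^sup>+x. f (t + c *\<^sub>R x) \<partial>lborel)"
  by (subst lborel_affine[OF c, of t])
     (simp add: nn_integral_density nn_integral_distr nn_integral_cmult)

lemma nn_integral_lborel_translation:
  fixes f :: "'a::euclidean_space \<Rightarrow> ennreal"
  assumes [measurable]: "f \<in> borel_measurable borel"
  shows "(\<integral>\<^sup>+x. f (t + x) \<partial>lborel) = (\<integral>\<^sup>+x. f x \<partial>lborel)"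
  using nn_integral_lborel_affine[of f 1 t] by simp

lemma nn_integral_lborel_diff:
  fixes f :: "'a::euclidean_space \<Rightarrow> ennreal"
  assumes [measurable]: "f \<in> borel_measurable borel"
  shows "(\<integral>\<^sup>+x. f (t - x) \<partial>lborel) = (\<integral>\<^sup>+x. f x \<partial>lborel)"
  using nn_integral_lborel_affine[of f "-1" t] by simp

lemma ln_norm_scaleR_exp: "x \<noteq> 0 \<Longrightarrow> ln (norm (exp t *\<^sub>R x)) = t + ln (norm x)"
  by (simp add: ln_mult)

lemma nn_integral_real_shift:
  fixes f :: "real \<Rightarrow> ennreal"
  assumes [measurable]: "f \<in> borel_measurable borel"
  shows "(\<integral>\<^sup>+x. f (t + x) \<partial>lborel) = (\<integral>\<^sup>+x. f x \<partial>lborel)"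
  using nn_integral_real_affine[of f 1 t] by simp

lemma nn_integral_real_reflect:
  fixes f :: "real \<Rightarrow> ennreal"
  assumes [measurable]: "f \<in> borel_measurable borel"
  shows "(\<integral>\<^sup>+x. f (- x) \<partial>lborel) = (\<integral>\<^sup>+x. f x \<partial>lborel)"
  using nn_integral_real_affine[of f "-1" 0] by simp

text \<open>In logarithmic radius the measure dy/|y|^N is the product of Lebesgue measure on the
  line with a measure on directions; dilations are translations of the line.\<close>

lemma nn_integral_dilation:
  fixes G :: "'a::euclidean_space \<Rightarrow> ennreal"
  assumes [measurable]: "G \<in> borel_measurable borel"
  shows "(\<integral>\<^sup>+y. G (exp t *\<^sub>R y) / ennreal (norm y ^ DIM('a)) \<partial>lborel) =
         (\<integral>\<^sup>+y. G y / ennreal (norm y ^ DIM('a)) \<partial>lborel)"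
proof -
  have "(\<integral>\<^sup>+y. G y / ennreal (norm y ^ DIM('a)) \<partial>lborel) =
     ennreal (\<bar>exp t\<bar> ^ DIM('a)) * (\<integral>\<^sup>+y. G (0 + exp t *\<^sub>R y) / ennreal (norm (0 + exp t *\<^sub>R y) ^ DIM('a)) \<partial>lborel)"
    by (rule nn_integral_lborel_affine) auto
  also have "\<dots> = (\<integral>\<^sup>+y. ennreal (exp t ^ DIM('a)) * (G (exp t *\<^sub>R y) / ennreal (exp t ^ DIM('a) * norm y ^ DIM('a))) \<partial>lborel)"
    by (subst nn_integral_cmult[symmetric]) (auto simp: power_mult_distrib)
  also have "\<dots> = (\<integral>\<^sup>+y. G (exp t *\<^sub>R y) / ennreal (norm y ^ DIM('a)) \<partial>lborel)"
  proof (rule nn_integral_cong_AE)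
    show "AE y in lborel. ennreal (exp t ^ DIM('a)) * (G (exp t *\<^sub>R y) / ennreal (exp t ^ DIM('a) * norm y ^ DIM('a))) =
       G (exp t *\<^sub>R y) / ennreal (norm y ^ DIM('a))"
      using AE_lborel_singleton[of "0::'a"]
    proof eventually_elim
      case (elim y)
      then have "ennreal (exp t ^ DIM('a)) * (g / ennreal (exp t ^ DIM('a) * norm y ^ DIM('a))) = g / ennreal (norm y ^ DIM('a))" for g
        by (cases g) (auto simp: divide_ennreal ennreal_mult'[symmetric] ennreal_top_divide ennreal_mult_top)
      then show ?case .
    qed
  qed
  finally show ?thesis by simp
qed

text \<open>A form of polar coordinates that avoids the surface measure of the sphere: the directions are
  parametrised by the annulus \<open>1 < |y| < e\<close>.\<close>

lemma nn_integral_polar: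
  fixes G :: "'a::euclidean_space \<Rightarrow> ennreal"
  assumes [measurable]: "G \<in> borel_measurable borel"
  shows "(\<integral>\<^sup>+y. G y / ennreal (norm y ^ DIM('a)) \<partial>lborel) =
    (\<integral>\<^sup>+y. indicator {0<..<1} (ln (norm y)) * (\<integral>\<^sup>+t. G (exp t *\<^sub>R y) \<partial>lborel) / ennreal (norm y ^ DIM('a)) \<partial>lborel)"
proof -
  let ?I = "\<lambda>t::real. indicator {0<..<1} t :: ennreal"
  \<comment> \<open>For every y the t with 0 < ln |y| + t < 1 form an interval of length 1.
    Inserting this weight and dilating by exp(-t) moves every point into the annulus.\<close>
  have I: "(\<integral>\<^sup>+t. ?I (c + t) \<partial>lborel) = 1" for c
    by (subst nn_integral_real_shift) auto
  have "(\<integral>\<^sup>+y. G y / ennreal (norm y ^ DIM('a)) \<partial>lborel) =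
    (\<integral>\<^sup>+y. (\<integral>\<^sup>+t. ?I (ln (norm y) + t) * (G y / ennreal (norm y ^ DIM('a))) \<partial>lborel) \<partial>lborel)"
    by (subst nn_integral_multc) (auto simp: I)
  also have "\<dots> = (\<integral>\<^sup>+t. (\<integral>\<^sup>+y. ?I (ln (norm y) + t) * G y / ennreal (norm y ^ DIM('a)) \<partial>lborel) \<partial>lborel)"
    by (subst lborel_pair.Fubini') (auto simp: ennreal_times_divide)
  also have "\<dots> = (\<integral>\<^sup>+t. (\<integral>\<^sup>+y. ?I (ln (norm (exp (-t) *\<^sub>R y)) + t) * G (exp (-t) *\<^sub>R y) / ennreal (norm y ^ DIM('a)) \<partial>lborel) \<partial>lborel)"
    by (rule nn_integral_cong, rule nn_integral_dilation[symmetric, of "\<lambda>y. ?I (ln (norm y) + t) * G y" "- t" for t]) simp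
  also have "\<dots> = (\<integral>\<^sup>+t. (\<integral>\<^sup>+y. ?I (ln (norm y)) * G (exp (-t) *\<^sub>R y) / ennreal (norm y ^ DIM('a)) \<partial>lborel) \<partial>lborel)"
  proof (rule nn_integral_cong, rule nn_integral_cong_AE)
    show "AE y in lborel. ?I (ln (norm (exp (-t) *\<^sub>R y)) + t) * G (exp (-t) *\<^sub>R y) / ennreal (norm y ^ DIM('a)) =
       ?I (ln (norm y)) * G (exp (-t) *\<^sub>R y) / ennreal (norm y ^ DIM('a))" for t
      using AE_lborel_singleton[of "0::'a"]
      by eventually_elim (subst ln_norm_scaleR_exp, auto)
  qed
  also have "\<dots> = (\<integral>\<^sup>+t. (\<integral>\<^sup>+y. ?I (ln (norm y)) * G (exp t *\<^sub>R y) / ennreal (norm y ^ DIM('a)) \<partial>lborel) \<partial>lborel)"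
    using nn_integral_real_reflect[of "\<lambda>t. (\<integral>\<^sup>+y. ?I (ln (norm y)) * G (exp t *\<^sub>R y) / ennreal (norm y ^ DIM('a)) \<partial>lborel)"]
    by simp
  also have "\<dots> = (\<integral>\<^sup>+y. (\<integral>\<^sup>+t. ?I (ln (norm y)) / ennreal (norm y ^ DIM('a)) * G (exp t *\<^sub>R y) \<partial>lborel) \<partial>lborel)"
    by (subst lborel_pair.Fubini') (auto simp: ennreal_times_divide mult_ac ennreal_divide_times)
  also have "\<dots> = (\<integral>\<^sup>+y. ?I (ln (norm y)) * (\<integral>\<^sup>+t. G (exp t *\<^sub>R y) \<partial>lborel) / ennreal (norm y ^ DIM('a)) \<partial>lborel)"
    by (subst nn_integral_cmult) (auto simp: ennreal_times_divide mult_ac ennreal_divide_times)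
  finally show ?thesis .
qed

text \<open>On the ray through y the inversion acts on the logarithmic radius as a reflection
  followed by a translation, and both preserve Lebesgue measure of the line.\<close>

lemma nn_integral_inversion_invariant:
  fixes G :: "'a::euclidean_space \<Rightarrow> ennreal"
  assumes [measurable]: "G \<in> borel_measurable borel"
  shows "(\<integral>\<^sup>+y. G (y /\<^sub>R (norm y)\<^sup>2) / ennreal (norm y ^ DIM('a)) \<partial>lborel) =
         (\<integral>\<^sup>+y. G y / ennreal (norm y ^ DIM('a)) \<partial>lborel)"
proof -
  have "(\<integral>\<^sup>+t. G ((exp t *\<^sub>R y) /\<^sub>R (norm (exp t *\<^sub>R y))\<^sup>2) \<partial>lborel) = (\<integral>\<^sup>+t. G (exp t *\<^sub>R y) \<partial>lborel)"
    if "y \<noteq> 0" for y :: 'a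
  proof -
    have "(exp t *\<^sub>R y) /\<^sub>R (norm (exp t *\<^sub>R y))\<^sup>2 = exp (- (2 * ln (norm y)) + - t) *\<^sub>R y" for t
    proof -
      have "exp (2 * ln (norm y)) = (norm y)\<^sup>2" 
        using that by (metis exp_double exp_ln zero_less_norm_iff)
      then have "inverse ((norm (exp t *\<^sub>R y))\<^sup>2) * exp t = exp (- (2 * ln (norm y)) + - t)"
        unfolding exp_add exp_minus
        by (simp add: power2_eq_square field_simps)
      then show ?thesis by (simp only: scaleR_scaleR)
    qed
    then have "(\<integral>\<^sup>+t. G ((exp t *\<^sub>R y) /\<^sub>R (norm (exp t *\<^sub>R y))\<^sup>2) \<partial>lborel) =
       (\<integral>\<^sup>+t. G (exp (- (2 * ln (norm y)) + - t) *\<^sub>R y) \<partial>lborel)" by (simp only:)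
    also have "\<dots> = (\<integral>\<^sup>+t. G (exp (- (2 * ln (norm y)) + t) *\<^sub>R y) \<partial>lborel)"
      by (subst nn_integral_real_reflect) auto
    also have "\<dots> = (\<integral>\<^sup>+t. G (exp t *\<^sub>R y) \<partial>lborel)"
      by (rule nn_integral_real_shift[of "\<lambda>t. G (exp t *\<^sub>R y)"]) auto
    finally show ?thesis .
  qed
  note * = this
  show ?thesis
    apply (subst nn_integral_polar, simp)
    apply (subst nn_integral_polar[of G], simp)
    apply (rule nn_integral_cong_AE)
    using AE_lborel_singleton[of "0::'a"]
    apply eventually_elim
    apply (subst *, assumption, rule refl)
    done
qed

text \<open>The Jacobian (r/|y|)^(2N) of the inversion in the sphere of radius r comes from the
  invariance of dy/|y|^N: the density |y|^N turns into |y|^-N, and dilations adjust the radius. No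
  determinant is computed.\<close>

lemma nn_integral_inversion:
  fixes G :: "'a::euclidean_space \<Rightarrow> ennreal"
  assumes [measurable]: "G \<in> borel_measurable borel" and r: "r > 0"
  shows "(\<integral>\<^sup>+y. G y \<partial>lborel) =
    (\<integral>\<^sup>+y. G ((r / norm y)\<^sup>2 *\<^sub>R y) * ennreal ((r / norm y) ^ (2 * DIM('a))) \<partial>lborel)"
proof -
  let ?N = "DIM('a)"
  have "(\<integral>\<^sup>+y. G y \<partial>lborel) = ennreal (r ^ ?N) * (\<integral>\<^sup>+y. G (r *\<^sub>R y) \<partial>lborel)"
    using nn_integral_lborel_affine[of G r 0] r by simp
  also have "(\<integral>\<^sup>+y. G (r *\<^sub>R y) \<partial>lborel) = (\<integral>\<^sup>+y. (G (r *\<^sub>R y) * ennreal (norm y ^ ?N)) / ennreal (norm y ^ ?N) \<partial>lborel)"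
    by (rule nn_integral_cong_AE, use AE_lborel_singleton[of "0::'a"] in eventually_elim)
       (auto simp: ennreal_mult_divide_eq)
  also have "\<dots> = (\<integral>\<^sup>+y. (G (r *\<^sub>R (y /\<^sub>R (norm y)\<^sup>2)) * ennreal (norm (y /\<^sub>R (norm y)\<^sup>2) ^ ?N)) / ennreal (norm y ^ ?N) \<partial>lborel)"
    by (rule nn_integral_inversion_invariant[symmetric]) auto
  also have "\<dots> = (\<integral>\<^sup>+y. G (r *\<^sub>R (y /\<^sub>R (norm y)\<^sup>2)) * ennreal (1 / norm y ^ (2 * ?N)) \<partial>lborel)"
  proof (rule nn_integral_cong_AE, use AE_lborel_singleton[of "0::'a"] in eventually_elim)
    case (elim y)
    then have n: "norm (y /\<^sub>R (norm y)\<^sup>2) = 1 / norm y" by (simp add: field_simps power2_eq_square)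
    have "g * ennreal ((1 / norm y) ^ ?N) / ennreal (norm y ^ ?N) = g * ennreal (1 / norm y ^ (2 * ?N))" for g
      using elim by (cases g) (auto simp: divide_ennreal ennreal_mult[symmetric] ennreal_top_mult ennreal_top_divide
          power_one_over power_mult power2_eq_square power_mult_distrib mult_2 power_add)
    then show ?case unfolding n .
  qed
  also have "\<dots> = ennreal ((1 / r) ^ ?N) *
      (\<integral>\<^sup>+y. G (r *\<^sub>R (((1 / r) *\<^sub>R y) /\<^sub>R (norm ((1 / r) *\<^sub>R y))\<^sup>2)) * ennreal (1 / norm ((1 / r) *\<^sub>R y) ^ (2 * ?N)) \<partial>lborel)"
    by (subst nn_integral_lborel_affine[of _ "1 / r" 0]) (use r in auto)
  also have "ennreal (r ^ ?N) * \<dots> =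
      (\<integral>\<^sup>+y. G (r *\<^sub>R (((1 / r) *\<^sub>R y) /\<^sub>R (norm ((1 / r) *\<^sub>R y))\<^sup>2)) * ennreal (1 / norm ((1 / r) *\<^sub>R y) ^ (2 * ?N)) \<partial>lborel)"
    using r by (simp add: mult.assoc[symmetric] ennreal_mult[symmetric] power_mult_distrib[symmetric])
  also have "\<dots> = (\<integral>\<^sup>+y. G ((r / norm y)\<^sup>2 *\<^sub>R y) * ennreal ((r / norm y) ^ (2 * ?N)) \<partial>lborel)"
    using r by (intro nn_integral_cong) (simp add: power_divide power2_eq_square field_simps)
  finally show ?thesis .
qed

section \<open>Powers of the norm inside and outside balls\<close>

abbreviation pow_in :: "real \<Rightarrow> real \<Rightarrow> 'a::real_normed_vector \<Rightarrow> ennreal" where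
  "pow_in a R y \<equiv> (if norm y < R then ennreal (norm y powr (- a)) else 0)"

abbreviation pow_out :: "real \<Rightarrow> real \<Rightarrow> 'a::real_normed_vector \<Rightarrow> ennreal" where
  "pow_out b R y \<equiv> (if R < norm y then ennreal (norm y powr (- b)) else 0)"

lemma nn_integral_norm_powr_ball:
  fixes a r :: real
  assumes a: "a < DIM('a::euclidean_space)"
  obtains C where "C \<ge> 0" "\<And>r. r > 0 \<Longrightarrow>
    (\<integral>\<^sup>+y. pow_in a r (y::'a) \<partial>lborel) = ennreal (C * r powr (DIM('a) - a))"
proof -
  let ?N = "real DIM('a)"
  \<comment> \<open>The total mass of the directions, equal to the surface area of the unit sphere.
    The origin is harmless: ln 0 = 0 lies outside the open interval.\<close>
  let ?J = "\<integral>\<^sup>+y. indicator {0<..<1} (ln (norm (y::'a))) / ennreal (norm y ^ DIM('a)) \<partial>lborel"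
  have J: "?J < \<infinity>"
  proof -
    have "?J \<le> (\<integral>\<^sup>+y. indicator (cball (0::'a) (exp 1)) y \<partial>lborel)"
    proof (intro nn_integral_mono)
      fix y :: 'a
      show "indicator {0<..<1} (ln (norm y)) / ennreal (norm y ^ DIM('a)) \<le> indicator (cball (0::'a) (exp 1)) y"
      proof (cases "ln (norm y) \<in> {0<..<1}")
        case True
        then have y: "norm y > 1" by (cases "y = 0") (auto simp: ln_gt_zero_iff)
        then have "norm y \<le> exp 1" using True ln_ge_iff[of "norm y" 1]  
          by (metis exp_le_cancel_iff exp_ln greaterThanLessThan_iff less_eq_real_def norm_ge_zero order_less_le_trans zero_less_one)
        moreover have "1 / ennreal (norm y ^ DIM('a)) \<le> 1"
          using y by (subst ennreal_1[symmetric], subst divide_ennreal) (auto intro!: zero_less_power divide_le_eq_1_pos[THEN iffD2] one_le_power)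
        ultimately show ?thesis using True by auto
      qed auto
    qed
    also have "\<dots> < \<infinity>" by (simp add: emeasure_cball)
    finally show ?thesis .
  qed
  have "(\<integral>\<^sup>+y. pow_in a r (y::'a) \<partial>lborel) = ?J * ennreal (r powr (?N - a) / (?N - a))"
    if r: "r > 0" for r
  proof -
    define G where "G = (\<lambda>y::'a. if norm y < r then ennreal (norm y powr (?N - a)) else 0)"
    have [measurable]: "G \<in> borel_measurable borel" unfolding G_def by measurable
    have "(\<integral>\<^sup>+y. pow_in a r (y::'a) \<partial>lborel) =
       (\<integral>\<^sup>+y. G y / ennreal (norm y ^ DIM('a)) \<partial>lborel)"
      by (rule nn_integral_cong_AE, use AE_lborel_singleton[of "0::'a"] in eventually_elim)
         (auto simp: G_def indicator_def divide_ennreal powr_diff powr_realpow powr_minus field_simps)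
    also have "\<dots> = (\<integral>\<^sup>+y. indicator {0<..<1} (ln (norm y)) * (\<integral>\<^sup>+t. G (exp t *\<^sub>R y) \<partial>lborel) / ennreal (norm y ^ DIM('a)) \<partial>lborel)"
      by (rule nn_integral_polar) simp
    also have "\<dots> = (\<integral>\<^sup>+y. indicator {0<..<1} (ln (norm (y::'a))) / ennreal (norm y ^ DIM('a)) * ennreal (r powr (?N - a) / (?N - a)) \<partial>lborel)"
    proof (rule nn_integral_cong_AE, use AE_lborel_singleton[of "0::'a"] in eventually_elim)
      case (elim y)
      have "(\<integral>\<^sup>+t. G (exp t *\<^sub>R y) \<partial>lborel) = (\<integral>\<^sup>+t. ennreal (indicator {..<ln r} (ln (norm y) + t) * exp ((?N - a) * (ln (norm y) + t))) \<partial>lborel)"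
      proof (rule nn_integral_cong)
        fix t
        have "exp t * norm y < r \<longleftrightarrow> ln (norm y) + t < ln r"
          using ln_less_cancel_iff[of "exp t * norm y" r] elim r by (simp add: ln_mult add.commute)
        moreover have "(exp t * norm y) powr (?N - a) = exp ((?N - a) * (ln (norm y) + t))"
          using elim by (simp add: powr_def ln_mult algebra_simps)
        ultimately show "G (exp t *\<^sub>R y) = ennreal (indicator {..<ln r} (ln (norm y) + t) * exp ((?N - a) * (ln (norm y) + t)))"
          by (simp add: G_def indicator_def)
      qed
      also have "\<dots> = (\<integral>\<^sup>+t. ennreal (indicator {..<ln r} t * exp ((?N - a) * t)) \<partial>lborel)"
        by (rule nn_integral_real_shift[of "\<lambda>t. ennreal (indicator {..<ln r} t * exp ((?N - a) * t))"]) simp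
      \<comment> \<open>Substituting ln r - t for t turns the half-line below ln r into [0,
        \<infinity>), to which the fundamental theorem for improper integrals applies.\<close>
      also have "\<dots> = (\<integral>\<^sup>+t. ennreal (indicator {..<ln r} (ln r + - t) * exp ((?N - a) * (ln r + - t))) \<partial>lborel)"
        using nn_integral_real_reflect[of "\<lambda>t. ennreal (indicator {..<ln r} (ln r + t) * exp ((?N - a) * (ln r + t)))"]
              nn_integral_real_shift[of "\<lambda>t. ennreal (indicator {..<ln r} t * exp ((?N - a) * t))" "ln r"] by simp
      also have "\<dots> = (\<integral>\<^sup>+t. ennreal (exp ((?N - a) * (ln r - t))) * indicator {0..} t \<partial>lborel)"
        by (rule nn_integral_cong_AE, use AE_lborel_singleton[of "0::real"] in eventually_elim)
           (auto simp: indicator_def)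
      also have "\<dots> = ennreal (0 - (- exp ((?N - a) * (ln r - 0)) / (?N - a)))"
      proof (rule nn_integral_FTC_atLeast[where F="\<lambda>t. - exp ((?N - a) * (ln r - t)) / (?N - a)"])
        show "((\<lambda>t. - exp ((?N - a) * (ln r - t)) / (?N - a)) \<longlongrightarrow> 0) at_top"
          using a by real_asymp
        show "((\<lambda>t. - exp ((?N - a) * (ln r - t)) / (?N - a)) has_real_derivative exp ((?N - a) * (ln r - t))) (at t)" for t
        proof -
          have "c \<noteq> 0 \<Longrightarrow> ((\<lambda>t. - exp (c * (ln r - t)) / c) has_real_derivative exp (c * (ln r - t))) (at t)" for c :: real
            by (auto intro!: derivative_eq_intros)
          then show ?thesis using a by simp
        qed
      qed auto
      also have "\<dots> = ennreal (r powr (?N - a) / (?N - a))"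
        using r by (simp add: powr_def)
      finally show ?case by (simp add: ennreal_times_divide mult.commute)
    qed
    also have "\<dots> = ?J * ennreal (r powr (?N - a) / (?N - a))"
      by (rule nn_integral_multc) auto
    finally show ?thesis .
  qed
  moreover obtain j where "?J = ennreal j" "j \<ge> 0" using J by (cases ?J) auto
  ultimately show ?thesis
    using a by (intro that[of "j / (?N - a)"]) (auto simp: ennreal_mult[symmetric])
qed

text \<open>Inversion in the unit sphere maps the exterior of the ball of radius r to the ball of
  radius 1/r and |y|^-b to |y|^-(2N-b), whose singularity at 0 is integrable exactly because b >
  N.\<close>

lemma nn_integral_norm_powr_outside:
  fixes b :: real
  assumes b: "b > DIM('a::euclidean_space)"
  obtains C where "C \<ge> 0" "\<And>r. r > 0 \<Longrightarrow>
    (\<integral>\<^sup>+y. pow_out b r (y::'a) \<partial>lborel) = ennreal (C * r powr (DIM('a) - b))"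
proof -
  let ?N = "real DIM('a)"
  obtain C where C: "C \<ge> 0" "\<And>r. r > 0 \<Longrightarrow>
    (\<integral>\<^sup>+y. pow_in (2 * ?N - b) r (y::'a) \<partial>lborel) = ennreal (C * r powr (?N - (2 * ?N - b)))"
    using nn_integral_norm_powr_ball[of "2 * ?N - b", where 'a='a] b by auto
  show ?thesis
  proof (rule that[OF C(1)])
    fix r :: real assume r: "r > 0"
    have "(\<integral>\<^sup>+y. pow_out b r (y::'a) \<partial>lborel) =
      (\<integral>\<^sup>+y. (if norm ((1 / norm y)\<^sup>2 *\<^sub>R y) > r then ennreal (norm ((1 / norm y)\<^sup>2 *\<^sub>R (y::'a)) powr (- b)) else 0)
         * ennreal ((1 / norm y) ^ (2 * DIM('a))) \<partial>lborel)"
      by (rule nn_integral_inversion) auto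
    also have "\<dots> = (\<integral>\<^sup>+y. pow_in (2 * ?N - b) (1 / r) (y::'a) \<partial>lborel)"
    proof (rule nn_integral_cong_AE, use AE_lborel_singleton[of "0::'a"] in eventually_elim)
      case (elim y)
      then have n: "norm ((1 / norm y)\<^sup>2 *\<^sub>R y) = 1 / norm y" by (simp add: field_simps power2_eq_square)
      have "(1 / norm y) powr (- b) * (1 / norm y) ^ (2 * DIM('a)) = norm y powr (- (2 * ?N - b))"
        using elim by (simp add: powr_realpow[symmetric] powr_divide powr_diff powr_minus field_simps)
      moreover have "r < 1 / norm y \<longleftrightarrow> norm y < 1 / r" using r elim by (simp add: field_simps)
      ultimately show ?case
        unfolding indicator_def mem_Collect_eq n by (auto simp: ennreal_mult[symmetric])
    qed
    also have "\<dots> = ennreal (C * r powr (?N - b))"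
      using r by (subst C(2)) (auto simp: powr_divide powr_minus[symmetric] field_simps powr_diff)
    finally show "(\<integral>\<^sup>+y. pow_out b r (y::'a) \<partial>lborel) = ennreal (C * r powr (?N - b))" .
  qed
qed

subsection \<open>The homogeneous space\<close>

text \<open>The squared seminorm without its constant, over Borel Lebesgue measure: there Tonelli's
  theorem applies directly, and the completion enters only through almost everywhere
  equality.\<close>

definition energy :: "real \<Rightarrow> (real ^ 'n \<Rightarrow> real) \<Rightarrow> ennreal" where
  "energy s u = (\<integral>\<^sup>+y. \<integral>\<^sup>+x. ennreal (\<bar>u x - u y\<bar>\<^sup>2 / norm (x - y) powr (real CARD('n) + 2 * s))
          \<partial>lborel \<partial>lborel)"

definition Lp_mass :: "real \<Rightarrow> ('a::euclidean_space \<Rightarrow> real) \<Rightarrow> ennreal" where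
  "Lp_mass r u = (\<integral>\<^sup>+x. ennreal (\<bar>u x\<bar> powr r) \<partial>lborel)"

section \<open>Convergence to zero in the extended half-line\<close>

lemma tendsto_0_ennreal_iff:
  fixes f :: "'a \<Rightarrow> ennreal"
  shows "(f \<longlongrightarrow> 0) F \<longleftrightarrow> (\<forall>e>0. eventually (\<lambda>k. f k < ennreal e) F)"
proof
  assume "(f \<longlongrightarrow> 0) F"
  then show "\<forall>e>0. eventually (\<lambda>k. f k < ennreal e) F"
    by (auto intro: order_tendstoD)
next
  assume *: "\<forall>e>0. eventually (\<lambda>k. f k < ennreal e) F"
  show "(f \<longlongrightarrow> 0) F"
  proof (rule order_tendstoI)
    fix a :: ennreal assume "0 < a"
    then obtain e where "e > 0" "ennreal e \<le> a"
      by (cases a) (auto intro: that[of 1])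
    then show "eventually (\<lambda>x. f x < a) F"
      using * by (auto elim!: eventually_mono)
  qed auto
qed

lemma enn_powr_less_iff:
  assumes "a > 0" "e > 0"
  shows "enn_powr x a < ennreal (e powr a) \<longleftrightarrow> x < ennreal e"
proof (cases x)
  case (real r)
  have "r powr a < e powr a \<longleftrightarrow> r < e"
    using real assms powr_less_mono2[of a r e] powr_mono2[of a e r] by (meson linorder_not_less less_imp_le)
  then show ?thesis using real by (simp add: enn_powr_def ennreal_less_iff)
qed (simp add: enn_powr_def)

lemma enn_powr_tendsto_0_iff:
  assumes "a > 0"
  shows "((\<lambda>k. enn_powr (f k) a) \<longlongrightarrow> 0) F \<longleftrightarrow> (f \<longlongrightarrow> 0) F"
proof -
  have "(\<forall>e>0. eventually (\<lambda>k. enn_powr (f k) a < ennreal e) F) \<longleftrightarrow> (\<forall>e>0. eventually (\<lambda>k. f k < ennreal e) F)"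
  proof safe
    fix e :: real assume "e > 0" "\<forall>e>0. eventually (\<lambda>k. enn_powr (f k) a < ennreal e) F"
    then have "eventually (\<lambda>k. enn_powr (f k) a < ennreal (e powr a)) F" by simp
    then show "eventually (\<lambda>k. f k < ennreal e) F" using assms \<open>e > 0\<close> by (simp add: enn_powr_less_iff)
  next
    fix e :: real assume e: "e > 0" "\<forall>e>0. eventually (\<lambda>k. f k < ennreal e) F"
    then have "eventually (\<lambda>k. f k < ennreal (e powr (1 / a))) F" by simp
    then show "eventually (\<lambda>k. enn_powr (f k) a < ennreal e) F"
      using assms e(1) enn_powr_less_iff[of a "e powr (1 / a)"] by (simp add: powr_powr)
  qed
  then show ?thesis by (simp add: tendsto_0_ennreal_iff)
qed

lemma frac_const_pos: "0 < s \<Longrightarrow> s < 1 \<Longrightarrow> 0 < frac_const N s"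
  by (auto simp: frac_const_def intro!: mult_pos_pos divide_pos_pos Gamma_real_pos)

lemma crit_exp_pos: "0 < s \<Longrightarrow> 2 * s < real N \<Longrightarrow> 0 < crit_exp N s"
  by (simp add: crit_exp_def)

lemma Hdot_norm_eq:
  fixes u :: "real ^ 'n \<Rightarrow> real"
  shows "Hdot_norm s u = enn_powr (ennreal (frac_const CARD('n) s / 2) * energy s u) (1 / 2)"
  by (simp add: Hdot_norm_def energy_def nn_integral_completion)

lemma Lp_norm_eq: "Lp_norm r u = enn_powr (Lp_mass r u) (1 / r)"
  by (simp add: Lp_norm_def Lp_mass_def nn_integral_completion)

lemma ennreal_cmult_tendsto_0_iff:
  fixes f :: "'a \<Rightarrow> ennreal"
  assumes "c > 0"
  shows "((\<lambda>k. ennreal c * f k) \<longlongrightarrow> 0) F \<longleftrightarrow> (f \<longlongrightarrow> 0) F"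
proof
  assume "((\<lambda>k. ennreal c * f k) \<longlongrightarrow> 0) F"
  then have "((\<lambda>k. ennreal (1 / c) * (ennreal c * f k)) \<longlongrightarrow> ennreal (1 / c) * 0) F"
    by (intro ennreal_tendsto_cmult) auto
  moreover have "ennreal (1 / c) * (ennreal c * x) = x" for x
    using assms by (simp add: mult.assoc[symmetric] ennreal_mult[symmetric])
  ultimately show "(f \<longlongrightarrow> 0) F" by simp
next
  assume "(f \<longlongrightarrow> 0) F"
  then have "((\<lambda>k. ennreal c * f k) \<longlongrightarrow> ennreal c * 0) F" by (intro ennreal_tendsto_cmult) auto
  then show "((\<lambda>k. ennreal c * f k) \<longlongrightarrow> 0) F" by simp
qed

lemma ennreal_add_tendsto_0_iff:
  fixes f g :: "nat \<Rightarrow> ennreal"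
  shows "(\<lambda>k. f k + g k) \<longlonglongrightarrow> 0 \<longleftrightarrow> f \<longlonglongrightarrow> 0 \<and> g \<longlonglongrightarrow> 0"
proof safe
  assume *: "(\<lambda>k. f k + g k) \<longlonglongrightarrow> 0"
  show "f \<longlonglongrightarrow> 0" by (rule tendsto_sandwich[OF _ _ tendsto_const *]) auto
  show "g \<longlonglongrightarrow> 0" by (rule tendsto_sandwich[OF _ _ tendsto_const *]) auto
next
  assume "f \<longlonglongrightarrow> 0" "g \<longlonglongrightarrow> 0"
  from tendsto_add[OF this] show "(\<lambda>k. f k + g k) \<longlonglongrightarrow> 0" by simp
qed

lemma Hdot_iff:
  fixes u :: "real ^ 'n \<Rightarrow> real"
  assumes "0 < s" "s < 1" "2 * s < real CARD('n)"
  shows "u \<in> Hdot s \<longleftrightarrow> u \<in> borel_measurable lebesgue \<and>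
     (\<exists>f. (\<forall>k::nat. f k \<in> test_functions) \<and> (\<lambda>k. energy s (\<lambda>x. f k x - u x)) \<longlonglongrightarrow> 0 \<and>
        (\<lambda>k. Lp_mass (crit_exp CARD('n) s) (\<lambda>x. f k x - u x)) \<longlonglongrightarrow> 0)"
  unfolding Hdot_def Hdot_norm_eq Lp_norm_eq
  using assms frac_const_pos[of s "CARD('n)"] crit_exp_pos[of s "CARD('n)"]
  by (simp add: ennreal_add_tendsto_0_iff enn_powr_tendsto_0_iff ennreal_cmult_tendsto_0_iff)

section \<open>Limits of energies\<close>

lemma Lp_mass_cong_AE:
  assumes "AE x in lborel. u x = v x"
  shows "Lp_mass r u = Lp_mass r v"
  unfolding Lp_mass_def by (rule nn_integral_cong_AE) (use assms in eventually_elim, simp)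

lemma energy_cong_AE:
  assumes "AE x in lborel. u x = v x"
  shows "energy s u = energy s v"
  unfolding energy_def
proof (rule nn_integral_cong_AE, use assms in eventually_elim, rule nn_integral_cong_AE)
  fix y assume y: "u y = v y"
  show "AE x in lborel. ennreal (\<bar>u x - u y\<bar>\<^sup>2 / norm (x - y) powr (real CARD('a) + 2 * s)) =
            ennreal (\<bar>v x - v y\<bar>\<^sup>2 / norm (x - y) powr (real CARD('a) + 2 * s))"
    using assms by eventually_elim (simp add: y)
qed

lemma energy_pair:
  fixes u :: "real ^ 'n \<Rightarrow> real"
  assumes [measurable]: "u \<in> borel_measurable borel"
  shows "energy s u = (\<integral>\<^sup>+(x, y). ennreal (\<bar>u x - u y\<bar>\<^sup>2 / norm (x - y) powr (real CARD('n) + 2 * s)) \<partial>(lborel \<Otimes>\<^sub>M lborel))"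
  unfolding energy_def by (subst lborel_pair.nn_integral_snd[symmetric]) auto

text \<open>Dominated convergence with majorants \<open>a k\<close> + \<open>b\<close> of which only
  \<open>b\<close> is fixed. Truncated subtraction reduces it to the usual theorem:
  \<open>T k\<close> - \<open>a k\<close> is at most \<open>b\<close> and still tends to 0, while
  the integral of \<open>a k\<close> tends to 0 by itself.\<close>

lemma nn_integral_tendsto_0_dominated:
  fixes T a :: "nat \<Rightarrow> 'a \<Rightarrow> ennreal"
  assumes [measurable]: "\<And>k. T k \<in> borel_measurable M" "\<And>k. a k \<in> borel_measurable M" "b \<in> borel_measurable M"
    and le: "\<And>k x. x \<in> space M \<Longrightarrow> T k x \<le> a k x + b x"
    and a_fin: "\<And>k x. x \<in> space M \<Longrightarrow> a k x \<noteq> top"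
    and lim: "AE x in M. (\<lambda>k. T k x) \<longlonglongrightarrow> 0"
    and a: "(\<lambda>k. \<integral>\<^sup>+x. a k x \<partial>M) \<longlonglongrightarrow> 0" and b: "(\<integral>\<^sup>+x. b x \<partial>M) < \<infinity>"
  shows "(\<lambda>k. \<integral>\<^sup>+x. T k x \<partial>M) \<longlonglongrightarrow> 0"
proof -
  have "(\<lambda>k. \<integral>\<^sup>+x. T k x - a k x \<partial>M) \<longlonglongrightarrow> (\<integral>\<^sup>+x. 0 \<partial>M)"
  proof (rule nn_integral_dominated_convergence[where w=b])
    show "AE x in M. T j x - a j x \<le> b x" for j
    proof (rule AE_I2)
      show "T j x - a j x \<le> b x" if "x \<in> space M" for x
        using le[OF that, of j] a_fin[OF that, of j] by (auto simp: ennreal_minus_le_iff)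
    qed
    show "AE x in M. (\<lambda>i. T i x - a i x) \<longlonglongrightarrow> 0"
      using lim
    proof eventually_elim
      case (elim x)
      show ?case by (rule tendsto_sandwich[OF _ _ tendsto_const elim]) (auto intro: diff_le_self_ennreal)
    qed
  qed (use b in auto)
  from tendsto_add[OF a this] have *: "(\<lambda>k. (\<integral>\<^sup>+x. a k x \<partial>M) + (\<integral>\<^sup>+x. T k x - a k x \<partial>M)) \<longlonglongrightarrow> 0" by simp
  show ?thesis
  proof (rule tendsto_sandwich[OF _ _ tendsto_const *])
    show "eventually (\<lambda>k. (\<integral>\<^sup>+x. T k x \<partial>M) \<le> (\<integral>\<^sup>+x. a k x \<partial>M) + (\<integral>\<^sup>+x. T k x - a k x \<partial>M)) sequentially"
    proof (rule always_eventually, rule allI)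
      fix k
      have "(\<integral>\<^sup>+x. T k x \<partial>M) \<le> (\<integral>\<^sup>+x. a k x + (T k x - a k x) \<partial>M)"
        by (intro nn_integral_mono) (metis add.commute diff_add_cancel_ennreal less_eq_ennreal_def linorder_le_cases add_increasing2 zero_le order_refl)
      also have "\<dots> = (\<integral>\<^sup>+x. a k x \<partial>M) + (\<integral>\<^sup>+x. T k x - a k x \<partial>M)"
        by (rule nn_integral_add) auto
      finally show "(\<integral>\<^sup>+x. T k x \<partial>M) \<le> \<dots>" .
    qed
  qed auto
qed

lemma AE_lborel_fst:
  fixes P :: "'a::euclidean_space \<Rightarrow> bool"
  assumes "AE x in lborel. P x"
  shows "AE z in (lborel \<Otimes>\<^sub>M lborel :: ('a \<times> 'b::euclidean_space) measure). P (fst z)"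
proof -
  obtain N where N: "{x \<in> space lborel. \<not> P x} \<subseteq> N" "emeasure lborel N = 0" "N \<in> sets lborel"
    using assms by (rule AE_E)
  have "N \<times> UNIV \<in> null_sets (lborel \<Otimes>\<^sub>M lborel :: ('a \<times> 'b) measure)"
    using N lborel.emeasure_pair_measure_Times[of N "lborel :: 'a measure" "UNIV :: 'b set"]
    by (auto simp: null_sets_def)
  then show ?thesis
    by (rule AE_I') (use N(1) in \<open>auto simp: space_pair_measure\<close>)
qed

lemma AE_lborel_snd:
  fixes P :: "'b::euclidean_space \<Rightarrow> bool"
  assumes "AE x in lborel. P x"
  shows "AE z in (lborel \<Otimes>\<^sub>M lborel :: ('a::euclidean_space \<times> 'b) measure). P (snd z)"
proof -
  obtain N where N: "{x \<in> space lborel. \<not> P x} \<subseteq> N" "emeasure lborel N = 0" "N \<in> sets lborel"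
    using assms by (rule AE_E)
  have "UNIV \<times> N \<in> null_sets (lborel \<Otimes>\<^sub>M lborel :: ('a \<times> 'b) measure)"
    using N lborel.emeasure_pair_measure_Times[of "UNIV :: 'a set" "lborel :: 'a measure" N]
    by (auto simp: null_sets_def)
  then show ?thesis
    by (rule AE_I') (use N(1) in \<open>auto simp: space_pair_measure\<close>)
qed

text \<open>Needed for compositions: the increments of cutoff(f_k) - cutoff(v) are not controlled by
  those of f_k - v alone, since \<open>cutoff\<close> is not linear. Adding the increments of a
  fixed function \<open>B\<close> yields domination, and pointwise convergence does the
  rest.\<close>

lemma energy_tendsto_0:
  fixes F V :: "nat \<Rightarrow> real ^ 'n \<Rightarrow> real"
  assumes [measurable]: "\<And>k. F k \<in> borel_measurable borel" "\<And>k. V k \<in> borel_measurable borel" "B \<in> borel_measurable borel"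
    and C: "C > 0"
    and le: "\<And>k x y. \<bar>F k x - F k y\<bar> \<le> C * (\<bar>V k x - V k y\<bar> + \<bar>B x - B y\<bar>)"
    and lim: "AE x in lborel. (\<lambda>k. F k x) \<longlonglongrightarrow> 0"
    and V: "(\<lambda>k. energy s (V k)) \<longlonglongrightarrow> 0" and B: "energy s B < \<infinity>"
  shows "(\<lambda>k. energy s (F k)) \<longlonglongrightarrow> 0"
proof -
  let ?d = "\<lambda>u x y. \<bar>u x - u y\<bar>\<^sup>2 / norm (x - y) powr (real CARD('n) + 2 * s) :: real"
  let ?M = "lborel \<Otimes>\<^sub>M lborel :: ((real ^ 'n) \<times> (real ^ 'n)) measure"
  let ?c = "ennreal (2 * C\<^sup>2)"
  have "(\<lambda>k. \<integral>\<^sup>+(x, y). ennreal (?d (F k) x y) \<partial>?M) \<longlonglongrightarrow> 0"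
  proof (rule nn_integral_tendsto_0_dominated[where a="\<lambda>k (x, y). ?c * ennreal (?d (V k) x y)" and b="\<lambda>(x, y). ?c * ennreal (?d B x y)"])
    fix k and z :: "(real ^ 'n) \<times> (real ^ 'n)"
    obtain x y where z: "z = (x, y)" by (cases z)
    have "\<bar>F k x - F k y\<bar>\<^sup>2 \<le> (C * (\<bar>V k x - V k y\<bar> + \<bar>B x - B y\<bar>))\<^sup>2"
      using le by (intro power_mono) auto
    also have "\<dots> \<le> 2 * C\<^sup>2 * \<bar>V k x - V k y\<bar>\<^sup>2 + 2 * C\<^sup>2 * \<bar>B x - B y\<bar>\<^sup>2"
    proof -
      have "(a + b)\<^sup>2 \<le> 2 * a\<^sup>2 + 2 * b\<^sup>2" for a b :: real
        using sum_squares_bound[of a b] by (simp add: power2_sum)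
      from mult_left_mono[OF this[of "\<bar>V k x - V k y\<bar>" "\<bar>B x - B y\<bar>"], of "C\<^sup>2"]
      show ?thesis unfolding power_mult_distrib by (simp add: algebra_simps)
    qed
    finally have "?d (F k) x y \<le> (2 * C\<^sup>2 * \<bar>V k x - V k y\<bar>\<^sup>2 + 2 * C\<^sup>2 * \<bar>B x - B y\<bar>\<^sup>2) / norm (x - y) powr (real CARD('n) + 2 * s)"
      by (intro divide_right_mono) auto
    also have "\<dots> = 2 * C\<^sup>2 * ?d (V k) x y + 2 * C\<^sup>2 * ?d B x y" by (simp add: add_divide_distrib)
    finally show "(case z of (x, y) \<Rightarrow> ennreal (?d (F k) x y)) \<le>
      (case z of (x, y) \<Rightarrow> ?c * ennreal (?d (V k) x y)) + (case z of (x, y) \<Rightarrow> ?c * ennreal (?d B x y))"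
      unfolding z prod.case
      by (subst (1 2) ennreal_mult[symmetric]) (auto simp: ennreal_plus[symmetric] simp del: ennreal_plus intro!: ennreal_leI)
  next
    show "(case z of (x, y) \<Rightarrow> ?c * ennreal (?d (V k) x y)) \<noteq> top" for k and z :: "(real ^ 'n) \<times> (real ^ 'n)"
      by (auto simp: ennreal_mult_eq_top_iff split: prod.split)
  next
    have "AE z in ?M. (\<lambda>k. F k (fst z)) \<longlonglongrightarrow> 0 \<and> (\<lambda>k. F k (snd z)) \<longlonglongrightarrow> 0"
      using AE_lborel_fst[OF lim] AE_lborel_snd[OF lim] by auto
    then show "AE z in ?M. (\<lambda>k. case z of (x, y) \<Rightarrow> ennreal (?d (F k) x y)) \<longlonglongrightarrow> 0"
    proof eventually_elim
      case (elim z)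
      obtain x y where z: "z = (x, y)" by (cases z)
      have "(\<lambda>k. ?d (F k) x y) \<longlonglongrightarrow> \<bar>0 - 0\<bar>\<^sup>2 / norm (x - y) powr (real CARD('n) + 2 * s)"
        unfolding divide_inverse using elim by (intro tendsto_intros) (auto simp: z)
      then have "(\<lambda>k. ennreal (?d (F k) x y)) \<longlonglongrightarrow> ennreal 0" by (intro tendsto_ennrealI) simp
      then show ?case by (simp add: z)
    qed
  next
    have "(\<lambda>k. ?c * energy s (V k)) \<longlonglongrightarrow> 0" using V C by (subst ennreal_cmult_tendsto_0_iff) auto
    then show "(\<lambda>k. \<integral>\<^sup>+z. (case z of (x, y) \<Rightarrow> ?c * ennreal (?d (V k) x y)) \<partial>?M) \<longlonglongrightarrow> 0"
      by (simp add: energy_pair nn_integral_cmult[symmetric] split_beta')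
    have "?c * energy s B < \<infinity>" using B by (auto simp: ennreal_mult_less_top)
    then show "(\<integral>\<^sup>+z. (case z of (x, y) \<Rightarrow> ?c * ennreal (?d B x y)) \<partial>?M) < \<infinity>"
      by (simp add: energy_pair nn_integral_cmult[symmetric] split_beta')
  qed auto
  then show ?thesis by (simp add: energy_pair)
qed

lemma energy_diff_finite:
  fixes u v :: "real ^ 'n \<Rightarrow> real"
  assumes [measurable]: "u \<in> borel_measurable borel" "v \<in> borel_measurable borel"
    and "energy s u < \<infinity>" "energy s v < \<infinity>"
  shows "energy s (\<lambda>x. u x - v x) < \<infinity>"
proof -
  let ?d = "\<lambda>u x y. \<bar>u x - u y\<bar>\<^sup>2 / norm (x - y) powr (real CARD('n) + 2 * s) :: real"
  have "energy s (\<lambda>x. u x - v x) \<le> (\<integral>\<^sup>+y. \<integral>\<^sup>+x. 2 * ennreal (?d u x y) + 2 * ennreal (?d v x y) \<partial>lborel \<partial>lborel)"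
    unfolding energy_def
  proof (intro nn_integral_mono)
    fix x y :: "real ^ 'n"
    have "(a - b)\<^sup>2 \<le> 2 * a\<^sup>2 + 2 * b\<^sup>2" for a b :: real
      using sum_squares_bound[of a "- b"] by (simp add: power2_diff)
    from this[of "u x - u y" "v x - v y"]
    have "\<bar>u x - v x - (u y - v y)\<bar>\<^sup>2 \<le> 2 * \<bar>u x - u y\<bar>\<^sup>2 + 2 * \<bar>v x - v y\<bar>\<^sup>2"
      by (simp add: algebra_simps)
    then have "?d (\<lambda>x. u x - v x) x y \<le> (2 * \<bar>u x - u y\<bar>\<^sup>2 + 2 * \<bar>v x - v y\<bar>\<^sup>2) / norm (x - y) powr (real CARD('n) + 2 * s)"
      by (rule divide_right_mono) simp
    also have "\<dots> = 2 * ?d u x y + 2 * ?d v x y" by (simp add: add_divide_distrib)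
    finally have "ennreal (?d (\<lambda>x. u x - v x) x y) \<le> ennreal (2 * ?d u x y + 2 * ?d v x y)" by (rule ennreal_leI)
    also have "\<dots> = 2 * ennreal (?d u x y) + 2 * ennreal (?d v x y)"
      by (subst ennreal_plus) (auto simp: ennreal_mult simp del: times_divide_eq_right)
    finally show "ennreal (?d (\<lambda>x. u x - v x) x y) \<le> 2 * ennreal (?d u x y) + 2 * ennreal (?d v x y)" .
  qed
  also have "\<dots> = 2 * energy s u + 2 * energy s v"
    unfolding energy_def by (simp add: nn_integral_add nn_integral_cmult)
  also have "\<dots> < \<infinity>" using assms(3,4) by (simp add: ennreal_mult_less_top)
  finally show ?thesis .
qed

section \<open>Test functions\<close>

lemma test_function_bounds:
  fixes f :: "'a::euclidean_space \<Rightarrow> real"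
  assumes "f \<in> test_functions"
  obtains L M R where "L \<ge> 0" "M \<ge> 0" "R > 0" "\<And>x y. \<bar>f x - f y\<bar> \<le> L * norm (x - y)" "\<And>x. \<bar>f x\<bar> \<le> M"
    "\<And>x. x \<notin> ball 0 R \<Longrightarrow> f x = 0" "f \<in> borel_measurable borel"
proof -
  define S where "S = closure {x. f x \<noteq> 0}"
  have sm: "smooth f" and S: "compact S" using assms by (auto simp: test_functions_def S_def)
  have S0: "f x = 0" if "x \<notin> S" for x using that closure_subset[of "{x. f x \<noteq> 0}"] by (auto simp: S_def)
  have cont: "continuous_on UNIV f" using sm by (rule smooth_continuous_on)
  obtain R where R: "R > 0" "S \<subseteq> ball 0 R"
    using compact_imp_bounded[OF S] bounded_subset_ballD by blast
  have bdd: "\<exists>M\<ge>0. \<forall>x. \<bar>g x\<bar> \<le> M" if "continuous_on UNIV g" "\<And>x. x \<notin> S \<Longrightarrow> g x = 0" for g :: "'a \<Rightarrow> real"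
  proof -
    have "bounded (g ` S)"
      using S that(1) by (intro compact_imp_bounded compact_continuous_image) (auto intro: continuous_on_subset)
    then obtain M where "\<And>x. x \<in> S \<Longrightarrow> \<bar>g x\<bar> \<le> M" by (auto simp: bounded_iff)
    then have "\<bar>g x\<bar> \<le> max M 0" for x using that(2)[of x] by (cases "x \<in> S") (auto simp: max.coboundedI1)
    then show ?thesis by (intro exI[of _ "max M 0"]) auto
  qed
  obtain M where M: "M \<ge> 0" "\<And>x. \<bar>f x\<bar> \<le> M" using bdd[OF cont S0] by auto
  have "C_k 1 f" using sm by (simp only: smooth_def)
  then have "C_k (Suc 0) f" by simp
  then obtain f' where f': "\<And>x. (f has_derivative f' x) (at x)" "\<And>b. b \<in> Basis \<Longrightarrow> C_k 0 (\<lambda>x. f' x b)"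
    using C_k_SucE[of 0 f] by blast
  have "\<exists>K\<ge>0. \<forall>x. \<bar>f' x b\<bar> \<le> K" if b: "b \<in> Basis" for b
  proof (rule bdd)
    show "continuous_on UNIV (\<lambda>x. f' x b)" using f'(2)[OF b] by simp
    fix x assume x: "x \<notin> S"
    have "((\<lambda>x. 0) has_derivative (\<lambda>h. 0)) (at x)" by simp
    then have "(f has_derivative (\<lambda>h. 0)) (at x)"
      by (rule has_derivative_transform_within_open[of _ _ _ _ "- S"]) (use compact_imp_closed[OF S] x S0 in \<open>auto simp: open_Compl\<close>)
    then have "f' x = (\<lambda>h. 0)" using f'(1) has_derivative_unique by blast
    then show "f' x b = 0" by simp
  qed
  then obtain K where K: "\<And>b. b \<in> Basis \<Longrightarrow> K b \<ge> 0" "\<And>b x. b \<in> Basis \<Longrightarrow> \<bar>f' x b\<bar> \<le> K b" by metis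
  define L where "L = (\<Sum>b\<in>Basis. K b)"
  have "norm (f x - f y) \<le> L * norm (x - y)" for x y
  proof (rule differentiable_bound[of UNIV f f'])
    show "onorm (f' x) \<le> L" for x
    proof (rule onorm_le)
      fix h
      have "f' x h = (\<Sum>b\<in>Basis. (h \<bullet> b) * f' x b)"
        using Linear_Algebra.linear_componentwise[OF has_derivative_linear[OF f'(1)], of x h 1] by simp
      also have "\<bar>\<dots>\<bar> \<le> (\<Sum>b\<in>Basis. \<bar>(h \<bullet> b) * f' x b\<bar>)" by (rule sum_abs)
      also have "\<dots> \<le> (\<Sum>b\<in>Basis. norm h * K b)"
        by (intro sum_mono) (auto simp: abs_mult intro!: mult_mono Basis_le_norm K)
      finally show "norm (f' x h) \<le> L * norm h" by (simp add: L_def sum_distrib_left mult.commute)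
    qed
  qed (use f'(1) has_derivative_at_withinI in auto)
  moreover have "L \<ge> 0" unfolding L_def by (intro sum_nonneg K)
  moreover have "f x = 0" if "x \<notin> ball 0 R" for x using that R(2) S0 by blast
  moreover have "f \<in> borel_measurable borel" using cont by (rule borel_measurable_continuous_onI)
  ultimately show ?thesis using M R(1) by (intro that[of L M R]) auto
qed

lemma test_function_measurable: "f \<in> test_functions \<Longrightarrow> f \<in> borel_measurable borel"
  by (erule test_function_bounds)

lemma energy_test_function_finite:
  fixes f :: "real ^ 'n \<Rightarrow> real"
  assumes s: "0 < s" "s < 1" and f: "f \<in> test_functions"
  shows "energy s f < \<infinity>"
proof -
  obtain L M R where LM: "L \<ge> 0" "M \<ge> 0" "R > 0" "\<And>x y. \<bar>f x - f y\<bar> \<le> L * norm (x - y)" "\<And>x. \<bar>f x\<bar> \<le> M"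
    "\<And>x. x \<notin> ball 0 R \<Longrightarrow> f x = 0" and [measurable]: "f \<in> borel_measurable borel"
    by (rule test_function_bounds[OF f]) (rule that)
  let ?N = "real CARD('n)"
  \<comment> \<open>A majorant of the integrand that depends on x - y only. The Lipschitz bound
    leaves |z|^(2-N-2s), integrable at 0 since s < 1; boundedness leaves |z|^-(N+2s), integrable at
    infinity since s > 0. The radii 2 and 1 overlap because both restrictions are strict.\<close>
  define \<psi> where "\<psi> = (\<lambda>z::real^'n. ennreal (L\<^sup>2) * pow_in (?N + 2 * s - 2) 2 z + ennreal ((2 * M)\<^sup>2) * pow_out (?N + 2 * s) 1 z)"
  have [measurable]: "\<psi> \<in> borel_measurable borel" unfolding \<psi>_def by measurable
  have [measurable]: "ball (0::real^'n) R \<in> sets borel" by simp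
  have \<psi>: "(\<integral>\<^sup>+z. \<psi> z \<partial>lborel) < \<infinity>"
  proof -
    obtain C1 where C1: "\<And>r. r > 0 \<Longrightarrow> (\<integral>\<^sup>+y. pow_in (?N + 2 * s - 2) r (y::real^'n) \<partial>lborel)
        = ennreal (C1 * r powr (DIM(real^'n) - (?N + 2 * s - 2)))"
      using nn_integral_norm_powr_ball[of "?N + 2 * s - 2", where 'a="real^'n"] s by auto
    obtain C2 where C2: "\<And>r. r > 0 \<Longrightarrow> (\<integral>\<^sup>+y. pow_out (?N + 2 * s) r (y::real^'n) \<partial>lborel)
        = ennreal (C2 * r powr (DIM(real^'n) - (?N + 2 * s)))"
      using nn_integral_norm_powr_outside[of "?N + 2 * s", where 'a="real^'n"] s by auto
    have fin1: "(\<integral>\<^sup>+y. pow_in (?N + 2 * s - 2) 2 (y::real^'n) \<partial>lborel) < top" by (subst C1) auto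
    have fin2: "(\<integral>\<^sup>+y. pow_out (?N + 2 * s) 1 (y::real^'n) \<partial>lborel) < top" by (subst C2) auto
    have "(\<integral>\<^sup>+z. \<psi> z \<partial>lborel) = ennreal (L\<^sup>2) * (\<integral>\<^sup>+y. pow_in (?N + 2 * s - 2) 2 (y::real^'n) \<partial>lborel) +
       ennreal ((2 * M)\<^sup>2) * (\<integral>\<^sup>+y. pow_out (?N + 2 * s) 1 (y::real^'n) \<partial>lborel)"
      unfolding \<psi>_def by (simp add: nn_integral_add nn_integral_cmult)
    also have "\<dots> < \<infinity>" using fin1 fin2 by (auto intro!: ennreal_mult_less_top[THEN iffD2])
    finally show ?thesis .
  qed
  \<comment> \<open>The left side vanishes unless one of the two points lies in the ball, so one of
    the indicator terms pays for it; each has a finite double integral.\<close>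
  have key: "ennreal (\<bar>f x - f y\<bar>\<^sup>2 / norm (x - y) powr (?N + 2 * s)) \<le>
     indicator (ball 0 R) x * \<psi> (x - y) + indicator (ball 0 R) y * \<psi> (x - y)" for x y
  proof (cases "x \<notin> ball 0 R \<and> y \<notin> ball 0 R \<or> x = y")
    case True
    then show ?thesis using LM(6) by auto
  next
    case False
    have "ennreal (\<bar>f x - f y\<bar>\<^sup>2 / norm (x - y) powr (?N + 2 * s)) \<le> \<psi> (x - y)"
    proof (cases "norm (x - y) < 2")
      case True
      have "\<bar>f x - f y\<bar>\<^sup>2 \<le> (L * norm (x - y))\<^sup>2" using LM(4) by (intro power_mono) auto
      then have "\<bar>f x - f y\<bar>\<^sup>2 / norm (x - y) powr (?N + 2 * s) \<le> (L * norm (x - y))\<^sup>2 / norm (x - y) powr (?N + 2 * s)"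
        by (rule divide_right_mono) simp
      also have "\<dots> = L\<^sup>2 * norm (x - y) powr (- (?N + 2 * s - 2))"
      proof -
        have "norm (x - y) powr (- (?N + 2 * s - 2)) = norm (x - y) powr (2 - (?N + 2 * s))" by simp
        also have "\<dots> = (norm (x - y))\<^sup>2 / norm (x - y) powr (?N + 2 * s)"
          using False by (subst powr_diff) simp
        finally show ?thesis by (simp add: power_mult_distrib)
      qed
      finally have "ennreal (\<bar>f x - f y\<bar>\<^sup>2 / norm (x - y) powr (?N + 2 * s)) \<le>
          ennreal (L\<^sup>2) * pow_in (?N + 2 * s - 2) 2 (x - y)"
        using True by (simp only: if_True ennreal_mult[symmetric] zero_le_power2 powr_ge_zero ennreal_leI)
      then show ?thesis unfolding \<psi>_def by (rule add_increasing2[OF zero_le])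
    next
      case far: False
      have "\<bar>f x - f y\<bar> \<le> 2 * M" using LM(5)[of x] LM(5)[of y] by linarith
      then have "\<bar>f x - f y\<bar>\<^sup>2 \<le> (2 * M)\<^sup>2" by (intro power_mono) auto
      then have "\<bar>f x - f y\<bar>\<^sup>2 / norm (x - y) powr (?N + 2 * s) \<le> (2 * M)\<^sup>2 / norm (x - y) powr (?N + 2 * s)"
        by (rule divide_right_mono) simp
      also have "\<dots> = (2 * M)\<^sup>2 * norm (x - y) powr (- (?N + 2 * s))" by (simp only: powr_minus divide_inverse)
      finally have "ennreal (\<bar>f x - f y\<bar>\<^sup>2 / norm (x - y) powr (?N + 2 * s)) \<le>
          ennreal ((2 * M)\<^sup>2) * pow_out (?N + 2 * s) 1 (x - y)"
        using far by (simp add: ennreal_mult[symmetric] ennreal_leI)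
      then show ?thesis unfolding \<psi>_def by (rule add_increasing[OF zero_le])
    qed
    with False show ?thesis
      by (cases "x \<in> ball 0 R"; cases "y \<in> ball 0 R") (simp_all add: add_increasing2)
  qed
  have "energy s f \<le> (\<integral>\<^sup>+y. \<integral>\<^sup>+x. indicator (ball 0 R) x * \<psi> (x - y) + indicator (ball 0 R) y * \<psi> (x - y) \<partial>lborel \<partial>lborel)"
    unfolding energy_def by (intro nn_integral_mono key)
  also have "\<dots> = (\<integral>\<^sup>+y. \<integral>\<^sup>+x. indicator (ball 0 R) x * \<psi> (x - y) \<partial>lborel \<partial>lborel) + (\<integral>\<^sup>+y. \<integral>\<^sup>+x. indicator (ball 0 R) y * \<psi> (x - y) \<partial>lborel \<partial>lborel)"
    by (subst nn_integral_add[symmetric]) (auto intro!: nn_integral_cong nn_integral_add)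
  also have "(\<integral>\<^sup>+y. \<integral>\<^sup>+x. indicator (ball 0 R) x * \<psi> (x - y) \<partial>lborel \<partial>lborel) = (\<integral>\<^sup>+x. \<integral>\<^sup>+y. indicator (ball 0 R) x * \<psi> (x - y) \<partial>lborel \<partial>lborel)"
    by (rule lborel_pair.Fubini') auto
  also have "\<dots> = emeasure lborel (ball (0::real^'n) R) * (\<integral>\<^sup>+z. \<psi> z \<partial>lborel)"
    by (simp add: nn_integral_cmult nn_integral_lborel_diff nn_integral_multc)
  also have "(\<integral>\<^sup>+y. \<integral>\<^sup>+x. indicator (ball 0 R) y * \<psi> (x - y) \<partial>lborel \<partial>lborel) = emeasure lborel (ball (0::real^'n) R) * (\<integral>\<^sup>+z. \<psi> z \<partial>lborel)"
    using nn_integral_lborel_translation[of \<psi> "- y" for y]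
    by (simp add: nn_integral_cmult nn_integral_multc)
  also have "emeasure lborel (ball (0::real^'n) R) * (\<integral>\<^sup>+z. \<psi> z \<partial>lborel) + emeasure lborel (ball (0::real^'n) R) * (\<integral>\<^sup>+z. \<psi> z \<partial>lborel) < \<infinity>"
    using \<psi> LM(3) by (simp add: ennreal_mult_less_top emeasure_ball)
  finally show ?thesis .
qed

lemma test_function_cutoff:
  assumes "f \<in> test_functions"
  shows "(\<lambda>x. cutoff (f x)) \<in> test_functions"
proof -
  have "{x. cutoff (f x) \<noteq> 0} \<subseteq> {x. f x \<noteq> 0}" using cutoff_zero[of 0] by fastforce
  then have "closure {x. cutoff (f x) \<noteq> 0} \<subseteq> closure {x. f x \<noteq> 0}" by (rule closure_mono)
  then have "closure {x. cutoff (f x) \<noteq> 0} \<inter> closure {x. f x \<noteq> 0} = closure {x. cutoff (f x) \<noteq> 0}" by blast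
  then show ?thesis
    using assms closed_Int_compact[of "closure {x. cutoff (f x) \<noteq> 0}" "closure {x. f x \<noteq> 0}"]
    by (simp add: test_functions_def smooth_cutoff)
qed

section \<open>Elements of the homogeneous space\<close>

lemma lebesgue_AE_eq_borel:
  fixes u :: "'a::euclidean_space \<Rightarrow> real"
  assumes "u \<in> borel_measurable lebesgue"
  obtains v where "v \<in> borel_measurable borel" "AE x in lborel. u x = v x"
  using completion_ex_borel_measurable_real[OF assms] by auto

lemma borel_measurable_lebesgueI:
  "v \<in> borel_measurable borel \<Longrightarrow> v \<in> borel_measurable lebesgue"
  by (rule measurable_completion) simp

lemma Hdot_borel:
  fixes u v :: "real ^ 'n \<Rightarrow> real"
  assumes s: "0 < s" "s < 1" "2 * s < real CARD('n)"
    and "u \<in> Hdot s" "v \<in> borel_measurable lebesgue" "AE x in lborel. u x = v x"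
  shows "v \<in> Hdot s"
proof -
  have "energy s (\<lambda>x. f x - u x) = energy s (\<lambda>x. f x - v x)" "Lp_mass r (\<lambda>x. f x - u x) = Lp_mass r (\<lambda>x. f x - v x)" for f r
    using assms(6) by (auto intro!: energy_cong_AE Lp_mass_cong_AE)
  then show ?thesis using assms unfolding Hdot_iff[OF s] by simp
qed

lemma Hdot_energy_finite:
  fixes u :: "real ^ 'n \<Rightarrow> real"
  assumes s: "0 < s" "s < 1" "2 * s < real CARD('n)" and u: "u \<in> Hdot s"
  shows "energy s u < \<infinity>"
proof -
  obtain v where [measurable]: "v \<in> borel_measurable borel" and uv: "AE x in lborel. u x = v x"
    using lebesgue_AE_eq_borel[of u] u Hdot_iff[OF s] by blast
  have "v \<in> Hdot s" using Hdot_borel[OF s u _ uv] by (simp add: borel_measurable_lebesgueI)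
  then obtain f where f: "\<And>k::nat. f k \<in> test_functions" "(\<lambda>k. energy s (\<lambda>x. f k x - v x)) \<longlonglongrightarrow> 0"
    using Hdot_iff[OF s] by blast
  have "eventually (\<lambda>k. energy s (\<lambda>x. f k x - v x) < \<infinity>) sequentially"
    using f(2) by (rule order_tendstoD) simp
  then obtain k where k: "energy s (\<lambda>x. f k x - v x) < \<infinity>" by (auto simp: eventually_sequentially)
  have [measurable]: "f k \<in> borel_measurable borel" by (rule test_function_measurable[OF f(1)])
  have "energy s (\<lambda>x. f k x - (f k x - v x)) < \<infinity>"
    using energy_test_function_finite[OF s(1,2) f(1)] k
    by (intro energy_diff_finite[of "f k" "\<lambda>x. f k x - v x" s]) auto
  then have "energy s v < \<infinity>" by simp
  with energy_cong_AE[OF uv] show ?thesis by metis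
qed

lemma Hdot_AE_approx:
  fixes u :: "real ^ 'n \<Rightarrow> real"
  assumes s: "0 < s" "s < 1" "2 * s < real CARD('n)" and u: "u \<in> Hdot s" and [measurable]: "u \<in> borel_measurable borel"
  obtains f where "\<And>k::nat. f k \<in> test_functions" "(\<lambda>k. energy s (\<lambda>x. f k x - u x)) \<longlonglongrightarrow> 0"
    "(\<lambda>k. Lp_mass (crit_exp CARD('n) s) (\<lambda>x. f k x - u x)) \<longlonglongrightarrow> 0" "AE x in lborel. (\<lambda>k. f k x) \<longlonglongrightarrow> u x"
proof -
  define r where "r = crit_exp CARD('n) s"
  have r: "r > 0" unfolding r_def using s by (intro crit_exp_pos) auto
  obtain f where f: "\<And>k::nat. f k \<in> test_functions" "(\<lambda>k. energy s (\<lambda>x. f k x - u x)) \<longlonglongrightarrow> 0"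
    "(\<lambda>k. Lp_mass r (\<lambda>x. f k x - u x)) \<longlonglongrightarrow> 0"
    using u Hdot_iff[OF s] unfolding r_def by blast
  have [measurable]: "f k \<in> borel_measurable borel" for k by (rule test_function_measurable[OF f(1)])
  have "eventually (\<lambda>k. Lp_mass r (\<lambda>x. f k x - u x) < \<infinity>) sequentially"
    using f(3) by (rule order_tendstoD) simp
  then obtain K where K: "\<And>k. k \<ge> K \<Longrightarrow> Lp_mass r (\<lambda>x. f k x - u x) < \<infinity>" by (auto simp: eventually_sequentially)
  \<comment> \<open>The shift by \<open>K\<close> makes every term integrable, as required for
    extracting an almost everywhere convergent subsequence from L^1 convergence.\<close>
  define g where "g k x = \<bar>f (k + K) x - u x\<bar> powr r" for k x
  have [measurable]: "g k \<in> borel_measurable borel" for k unfolding g_def by measurable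
  have int: "integrable lborel (g k)" for k
    using K[of "k + K"] by (intro integrableI_bounded) (auto simp: g_def Lp_mass_def)
  have "(\<lambda>k. \<integral>x. norm (g k x) \<partial>lborel) \<longlonglongrightarrow> 0"
  proof -
    have "(\<integral>x. norm (g k x) \<partial>lborel) = enn2real (Lp_mass r (\<lambda>x. f (k + K) x - u x))" for k
      by (subst integral_eq_nn_integral) (auto simp: g_def Lp_mass_def)
    moreover have "(\<lambda>k. Lp_mass r (\<lambda>x. f (k + K) x - u x)) \<longlonglongrightarrow> ennreal 0"
      using LIMSEQ_ignore_initial_segment[OF f(3), of K] by simp
    then have "(\<lambda>k. enn2real (Lp_mass r (\<lambda>x. f (k + K) x - u x))) \<longlonglongrightarrow> 0"
      by (rule tendsto_enn2real) simp
    ultimately show ?thesis by simp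
  qed
  from tendsto_L1_AE_subseq[OF int this] obtain \<rho> where \<rho>: "strict_mono \<rho>" "AE x in lborel. (\<lambda>k. g (\<rho> k) x) \<longlonglongrightarrow> 0"
    by blast
  define \<sigma> where "\<sigma> k = \<rho> k + K" for k
  have \<sigma>: "strict_mono \<sigma>" using \<rho>(1) by (simp add: \<sigma>_def strict_mono_def)
  show ?thesis
  proof (rule that[of "\<lambda>k. f (\<sigma> k)"])
    show "(\<lambda>k. energy s (\<lambda>x. f (\<sigma> k) x - u x)) \<longlonglongrightarrow> 0"
      using LIMSEQ_subseq_LIMSEQ[OF f(2) \<sigma>] by (simp add: o_def)
    show "(\<lambda>k. Lp_mass (crit_exp CARD('n) s) (\<lambda>x. f (\<sigma> k) x - u x)) \<longlonglongrightarrow> 0"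
      using LIMSEQ_subseq_LIMSEQ[OF f(3) \<sigma>] by (simp add: o_def r_def)
    show "AE x in lborel. (\<lambda>k. f (\<sigma> k) x) \<longlonglongrightarrow> u x"
      using \<rho>(2)
    proof eventually_elim
      case (elim x)
      have "(\<lambda>k. g (\<rho> k) x powr (1 / r)) \<longlonglongrightarrow> 0 powr (1 / r)"
        using r by (intro tendsto_powr'[OF elim tendsto_const]) (auto simp: g_def)
      then have "(\<lambda>k. \<bar>f (\<sigma> k) x - u x\<bar>) \<longlonglongrightarrow> 0" using r by (simp add: g_def \<sigma>_def powr_powr)
      then show ?case by (simp add: tendsto_rabs_zero_iff LIM_zero_iff)
    qed
  qed (auto intro: f)
qed

text \<open>Since \<open>cutoff\<close> is smooth and vanishes at 0, the composed approximations are
  again test functions. They converge in the Lebesgue norm by the Lipschitz bound and in energy by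
  \<open>energy_tendsto_0\<close>.\<close>

lemma Hdot_cutoff:
  fixes u :: "real ^ 'n \<Rightarrow> real"
  assumes s: "0 < s" "s < 1" "2 * s < real CARD('n)" and u: "u \<in> Hdot s"
  shows "(\<lambda>x. cutoff (u x)) \<in> Hdot s"
proof -
  have cm[measurable]: "cutoff \<in> borel_measurable borel"
    using smooth_continuous_on[OF smooth_cutoff[OF smooth_inner[of "1::real"]]]
    by (intro borel_measurable_continuous_onI) simp
  have [measurable]: "u \<in> borel_measurable lebesgue" using u Hdot_iff[OF s] by blast
  obtain v where [measurable]: "v \<in> borel_measurable borel" and uv: "AE x in lborel. u x = v x"
    using lebesgue_AE_eq_borel[of u] by auto
  have v: "v \<in> Hdot s" using Hdot_borel[OF s u _ uv] by (simp add: borel_measurable_lebesgueI)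
  obtain f where f: "\<And>k::nat. f k \<in> test_functions" "(\<lambda>k. energy s (\<lambda>x. f k x - v x)) \<longlonglongrightarrow> 0"
    "(\<lambda>k. Lp_mass (crit_exp CARD('n) s) (\<lambda>x. f k x - v x)) \<longlonglongrightarrow> 0" "AE x in lborel. (\<lambda>k. f k x) \<longlonglongrightarrow> v x"
    using Hdot_AE_approx[OF s v] by auto
  have [measurable]: "f k \<in> borel_measurable borel" for k by (rule test_function_measurable[OF f(1)])
  let ?r = "crit_exp CARD('n) s"
  have r: "?r > 0" using s by (intro crit_exp_pos) auto
  have "(\<lambda>x. cutoff (v x)) \<in> Hdot s"
    unfolding Hdot_iff[OF s]
  proof (intro conjI exI[of _ "\<lambda>k x. cutoff (f k x)"] allI)
    show "(\<lambda>x. cutoff (f k x)) \<in> test_functions" for k by (intro test_function_cutoff f)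
    show "(\<lambda>k. energy s (\<lambda>x. cutoff (f k x) - cutoff (v x))) \<longlonglongrightarrow> 0"
    \<comment> \<open>With P the increment of f_k, Q that of v and R that of their difference, 2P +
      2Q <= 2R + 4Q <= 4 (R + Q).\<close>
    proof (rule energy_tendsto_0[where V="\<lambda>k x. f k x - v x" and B=v and C=4])
      show "\<bar>cutoff (f k x) - cutoff (v x) - (cutoff (f k y) - cutoff (v y))\<bar> \<le> 4 * (\<bar>f k x - v x - (f k y - v y)\<bar> + \<bar>v x - v y\<bar>)" for k x y
      proof -
        have gen: "A \<le> 2 * P + 2 * Q \<Longrightarrow> P \<le> R + Q \<Longrightarrow> 0 \<le> R \<Longrightarrow> 0 \<le> Q \<Longrightarrow> A \<le> 4 * (R + Q)" for A P Q R :: real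
          by (simp add: algebra_simps)
        have "\<bar>(cutoff (f k x) - cutoff (f k y)) - (cutoff (v x) - cutoff (v y))\<bar> \<le> 2 * \<bar>f k x - f k y\<bar> + 2 * \<bar>v x - v y\<bar>"
          by (rule order_trans[OF abs_triangle_ineq4 add_mono]) (rule cutoff_lipschitz)+
        moreover have "\<bar>f k x - f k y\<bar> \<le> \<bar>f k x - v x - (f k y - v y)\<bar> + \<bar>v x - v y\<bar>"
          using abs_triangle_ineq[of "f k x - v x - (f k y - v y)" "v x - v y"] by simp
        ultimately have "\<bar>(cutoff (f k x) - cutoff (f k y)) - (cutoff (v x) - cutoff (v y))\<bar> \<le>
            4 * (\<bar>f k x - v x - (f k y - v y)\<bar> + \<bar>v x - v y\<bar>)"
          by (rule gen) (rule abs_ge_zero)+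
        moreover have "cutoff (f k x) - cutoff (v x) - (cutoff (f k y) - cutoff (v y)) =
            cutoff (f k x) - cutoff (f k y) - (cutoff (v x) - cutoff (v y))" by simp
        ultimately show ?thesis by (simp only:)
      qed
      show "AE x in lborel. (\<lambda>k. cutoff (f k x) - cutoff (v x)) \<longlonglongrightarrow> 0"
        using f(4)
      proof eventually_elim
        case (elim x)
        have "isCont cutoff (v x)" using cutoff_derivative DERIV_isCont by metis
        then have "(\<lambda>k. cutoff (f k x)) \<longlonglongrightarrow> cutoff (v x)" using elim by (rule isCont_tendsto_compose)
        then show ?case by (simp add: LIM_zero_iff)
      qed
      show "energy s v < \<infinity>" using Hdot_energy_finite[OF s v] .
    qed (auto simp: f)
    have bd: "Lp_mass ?r (\<lambda>x. cutoff (f k x) - cutoff (v x)) \<le> ennreal (2 powr ?r) * Lp_mass ?r (\<lambda>x. f k x - v x)" for k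
    proof -
      have "ennreal (\<bar>cutoff (f k x) - cutoff (v x)\<bar> powr ?r) \<le> ennreal (2 powr ?r) * ennreal (\<bar>f k x - v x\<bar> powr ?r)" for x
        using powr_mono2[OF less_imp_le[OF r] _ cutoff_lipschitz[of "f k x" "v x"]]
        by (simp add: ennreal_mult[symmetric] powr_mult ennreal_leI)
      then show ?thesis unfolding Lp_mass_def by (subst nn_integral_cmult[symmetric]) (auto intro: nn_integral_mono)
    qed
    have lim: "(\<lambda>k. ennreal (2 powr ?r) * Lp_mass ?r (\<lambda>x. f k x - v x)) \<longlonglongrightarrow> 0"
      using f(3) by (subst ennreal_cmult_tendsto_0_iff) auto
    show "(\<lambda>k. Lp_mass ?r (\<lambda>x. cutoff (f k x) - cutoff (v x))) \<longlonglongrightarrow> 0"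
      by (rule tendsto_sandwich[OF _ _ tendsto_const lim]) (auto intro: always_eventually bd)
  qed (auto intro!: borel_measurable_lebesgueI)
  then show ?thesis
    by (rule Hdot_borel[OF s]) (use uv in \<open>auto intro!: measurable_compose[OF _ cm]\<close>)
qed

text \<open>The truncations cutoff(k w)/k act on the values of \<open>w\<close> and not on the space
  variable: they vanish where k w <= 1, so the decay of \<open>w\<close> confines them to a ball,
  and their increments are at most twice those of \<open>w\<close>. Hence \<open>w\<close> itself
  dominates the energies, and no estimate for spatial cut-off functions arises.\<close>

lemma Hdot_I_dominating:
  fixes w :: "real ^ 'n \<Rightarrow> real"
  assumes s: "0 < s" "s < 1" "2 * s < real CARD('n)"
    and sm: "smooth w" and pos: "\<And>x. 0 < w x"
    and decay: "\<And>\<epsilon>. \<epsilon> > 0 \<Longrightarrow> \<exists>R. \<forall>x. w x \<ge> \<epsilon> \<longrightarrow> norm x \<le> R"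
    and en: "energy s w < \<infinity>" and mass: "Lp_mass (crit_exp CARD('n) s) w < \<infinity>"
  shows "w \<in> Hdot s"
proof -
  let ?r = "crit_exp CARD('n) s"
  have r: "?r > 0" using s by (intro crit_exp_pos) auto
  have [measurable]: "w \<in> borel_measurable borel"
    using smooth_continuous_on[OF sm] by (rule borel_measurable_continuous_onI)
  define f where "f k x = cutoff (real (Suc k) * w x) / real (Suc k)" for k x
  have fsm: "smooth (f k)" for k
  proof -
    have "smooth (\<lambda>x. (1 / real (Suc k)) * cutoff (real (Suc k) * w x))"
      by (intro smooth_mult smooth_const smooth_cutoff sm)
    then show ?thesis by (simp add: f_def[abs_def])
  qed
  have [measurable]: "f k \<in> borel_measurable borel" for k
    using smooth_continuous_on[OF fsm] by (rule borel_measurable_continuous_onI)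
  have f_lip: "\<bar>f k x - f k y\<bar> \<le> 2 * \<bar>w x - w y\<bar>" for k x y
  proof -
    have "\<bar>f k x - f k y\<bar> = \<bar>cutoff (real (Suc k) * w x) - cutoff (real (Suc k) * w y)\<bar> / real (Suc k)"
      unfolding f_def diff_divide_distrib[symmetric] by simp
    also have "\<dots> \<le> 2 * \<bar>real (Suc k) * w x - real (Suc k) * w y\<bar> / real (Suc k)"
      by (intro divide_right_mono cutoff_lipschitz) auto
    also have "\<dots> = 2 * \<bar>w x - w y\<bar>"
      unfolding right_diff_distrib[symmetric] abs_mult by simp
    finally show ?thesis .
  qed
  have f_bd: "0 \<le> f k x" "f k x \<le> w x" for k x
  proof -
    show "0 \<le> f k x" by (simp add: f_def cutoff_nonneg)
    have "cutoff (real (Suc k) * w x) \<le> real (Suc k) * w x" using less_imp_le[OF pos[of x]] by (intro cutoff_le) simp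
    then show "f k x \<le> w x" by (simp add: f_def field_simps)
  qed
  have lim: "(\<lambda>k. f k x) \<longlonglongrightarrow> w x" for x unfolding f_def by (intro cutoff_rescaled_tendsto pos)
  show ?thesis
    unfolding Hdot_iff[OF s]
  proof (intro conjI exI[of _ f] allI)
    show "f k \<in> test_functions" for k
    proof -
      obtain R where R: "\<And>x. w x \<ge> 1 / real (Suc k) \<Longrightarrow> norm x \<le> R" using decay[of "1 / real (Suc k)"] by auto
      have "x \<in> cball 0 R" if "f k x \<noteq> 0" for x
      proof -
        have "\<not> real (Suc k) * w x \<le> 1" using that cutoff_zero by (auto simp: f_def)
        then show ?thesis using R[of x] by (auto simp: field_simps)
      qed
      then have "closure {x. f k x \<noteq> 0} \<subseteq> cball 0 R" by (intro closure_minimal) auto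
      then have "compact (closure {x. f k x \<noteq> 0})"
        using compact_cball closed_Int_compact[of "closure {x. f k x \<noteq> 0}" "cball 0 R"] by (simp add: Int_absorb2)
      then show ?thesis using fsm by (simp add: test_functions_def)
    qed
    show "(\<lambda>k. energy s (\<lambda>x. f k x - w x)) \<longlonglongrightarrow> 0"
    proof (rule energy_tendsto_0[where V="\<lambda>k x. 0" and B=w and C=3])
      show "\<bar>f k x - w x - (f k y - w y)\<bar> \<le> 3 * (\<bar>0 - 0\<bar> + \<bar>w x - w y\<bar>)" for k x y
        using f_lip[of k x y] abs_triangle_ineq4[of "f k x - f k y" "w x - w y"] by (simp add: algebra_simps)
      show "AE x in lborel. (\<lambda>k. f k x - w x) \<longlonglongrightarrow> 0" using lim by (simp add: LIM_zero)
    qed (use en in \<open>auto simp: energy_def\<close>)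
    have "(\<lambda>k. \<integral>\<^sup>+x. ennreal (\<bar>f k x - w x\<bar> powr ?r) \<partial>lborel) \<longlonglongrightarrow> (\<integral>\<^sup>+x. 0 \<partial>(lborel :: (real^'n) measure))"
    proof (rule nn_integral_dominated_convergence[where w="\<lambda>x. ennreal (\<bar>w x\<bar> powr ?r)"])
      show "AE x in lborel. ennreal (\<bar>f k x - w x\<bar> powr ?r) \<le> ennreal (\<bar>w x\<bar> powr ?r)" for k
        using f_bd[of k] pos r by (intro AE_I2 ennreal_leI powr_mono2) (auto simp: abs_le_iff add_increasing less_imp_le)
      show "AE x in lborel. (\<lambda>k. ennreal (\<bar>f k x - w x\<bar> powr ?r)) \<longlonglongrightarrow> 0"
      proof (rule AE_I2)
        fix x
        have "(\<lambda>k. \<bar>f k x - w x\<bar> powr ?r) \<longlonglongrightarrow> 0 powr ?r"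
          using r lim[of x] by (intro tendsto_powr'[OF _ tendsto_const]) (auto simp: tendsto_rabs_zero_iff LIM_zero)
        then show "(\<lambda>k. ennreal (\<bar>f k x - w x\<bar> powr ?r)) \<longlonglongrightarrow> 0"
          using tendsto_ennrealI by fastforce
      qed
    qed (use mass in \<open>auto simp: Lp_mass_def\<close>)
    then show "(\<lambda>k. Lp_mass ?r (\<lambda>x. f k x - w x)) \<longlonglongrightarrow> 0" by (simp add: Lp_mass_def)
  qed (auto intro: borel_measurable_lebesgueI)
qed

subsection \<open>Boundedness\<close>

text \<open>The integrand has a sign because \<open>cutoff\<close> is monotone. The iterated Bochner
  integral inherits it even where an integral diverges, since its value is then 0.\<close>

lemma Hdot_form_cutoff_nonneg:
  assumes "0 < s" "s < 1"
  shows "0 \<le> Hdot_form s u (\<lambda>x. cutoff (u x))"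
proof -
  have "0 \<le> (u x - u y) * (cutoff (u x) - cutoff (u y))" for x y
    using cutoff_mono[of "u x" "u y"] cutoff_mono[of "u y" "u x"]
    by (cases "u x \<le> u y") (auto intro: mult_nonneg_nonneg mult_nonpos_nonpos)
  then show ?thesis
    unfolding Hdot_form_def using frac_const_pos[OF assms, of "CARD('a)"]
    by (intro mult_nonneg_nonneg[of "_ / 2"] Bochner_Integration.integral_nonneg divide_nonneg_nonneg) auto
qed

lemma weak_identity_cutoff_bound:
  fixes u :: "real ^ 'n \<Rightarrow> real"
  assumes s: "0 < s" "s < 1" and pq: "p < q"
    and [measurable]: "u \<in> borel_measurable lebesgue"
    and id: "weak_identity s p q u (\<lambda>x. cutoff (u x))"
  shows "AE x in lebesgue. u x \<le> 1"
proof -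
  define F where "F = (\<lambda>x. u x powr q * cutoff (u x) - u x powr p * cutoff (u x))"
  have F: "0 \<le> F x" for x
    using pq powr_mono[of p q "u x"] cutoff_zero[of "u x"] cutoff_nonneg[of "u x"]
    by (cases "u x > 1") (auto simp: F_def left_diff_distrib[symmetric])
  have int: "integrable lebesgue (\<lambda>x. u x powr p * cutoff (u x))" "integrable lebesgue (\<lambda>x. u x powr q * cutoff (u x))"
    and eq: "Hdot_form s u (\<lambda>x. cutoff (u x)) = (\<integral>x. u x powr p * cutoff (u x) \<partial>lebesgue) - (\<integral>x. u x powr q * cutoff (u x) \<partial>lebesgue)"
    using id by (auto simp: weak_identity_def)
  have iF: "integrable lebesgue F" unfolding F_def using int by (intro Bochner_Integration.integrable_diff)
  have "integral\<^sup>L lebesgue F = - Hdot_form s u (\<lambda>x. cutoff (u x))"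
    unfolding F_def eq using int by (subst Bochner_Integration.integral_diff) auto
  moreover have "0 \<le> integral\<^sup>L lebesgue F" using F by (intro Bochner_Integration.integral_nonneg) auto
  ultimately have "integral\<^sup>L lebesgue F = 0" using Hdot_form_cutoff_nonneg[OF s, of u] by linarith
  then have "AE x in lebesgue. F x = 0"
    using integral_nonneg_eq_0_iff_AE[OF iF] F by auto
  then show ?thesis
  proof eventually_elim
    case (elim x)
    show ?case
    proof (rule ccontr)
      assume "\<not> u x \<le> 1"
      then have "u x powr p < u x powr q" "cutoff (u x) > 0" using pq powr_less_mono by (auto simp: cutoff_pos_iff)
      with elim show False by (simp add: F_def)
    qed
  qed
qed

subsection \<open>The fractional Laplacian of the bubble\<close>

text \<open>D is a mixed second difference of the convex function t^-m. Two applications of the mean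
  value theorem give D = m (m+1) u v xi^(-m-2) with some xi >= b.\<close>

lemma powr_second_difference:
  fixes m b u v :: real
  assumes m: "m > 0" and b: "b > 0" and u: "u \<ge> 0" and v: "v \<ge> 0"
  defines "D \<equiv> (b + u + v) powr (-m) + b powr (-m) - (b + u) powr (-m) - (b + v) powr (-m)"
  shows "0 \<le> D" and "D \<le> m * (m + 1) * u * v * b powr (-m - 2)"
proof -
  have "0 \<le> D \<and> D \<le> m * (m + 1) * u * v * b powr (-m - 2)"
  proof (cases "u = 0 \<or> v = 0")
    case False
    then have u: "u > 0" and v: "v > 0" using u v by auto
    have "\<exists>z>0. z < v \<and> ((b + v + u) powr (-m) - (b + v) powr (-m)) - ((b + 0 + u) powr (-m) - (b + 0) powr (-m)) =
        (v - 0) * (- m * (b + z + u) powr (-m - 1) - (- m * (b + z) powr (-m - 1)))"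
      by (rule MVT2[OF v, of "\<lambda>z. (b + z + u) powr (-m) - (b + z) powr (-m)"])
         (use b u in \<open>auto intro!: derivative_eq_intros\<close>)
    then obtain z where z: "0 < z" "z < v" "D = v * (m * (b + z) powr (-m - 1) - m * (b + z + u) powr (-m - 1))"
      by (auto simp: D_def algebra_simps)
    have "\<exists>y>0. y < u \<and> (b + z + u) powr (-m - 1) - (b + z + 0) powr (-m - 1) = (u - 0) * ((-m - 1) * (b + z + y) powr (-m - 1 - 1))"
      by (rule MVT2[OF u, of "\<lambda>y. (b + z + y) powr (-m - 1)"])
         (use b z in \<open>auto intro!: derivative_eq_intros\<close>)
    then obtain y where y: "0 < y" "y < u" "(b + z + u) powr (-m - 1) - (b + z) powr (-m - 1) = u * ((-m - 1) * (b + z + y) powr (-m - 2))"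
      by (auto simp: diff_diff_eq)
    have "D = - (v * m) * ((b + z + u) powr (-m - 1) - (b + z) powr (-m - 1))"
      unfolding z(3) by (simp add: algebra_simps)
    also have "\<dots> = m * (m + 1) * u * v * (b + z + y) powr (-m - 2)" unfolding y(3) by (simp add: algebra_simps)
    finally have D: "D = m * (m + 1) * u * v * (b + z + y) powr (-m - 2)" .
    have "(b + z + y) powr (-m - 2) \<le> b powr (-m - 2)"
      using m b z y by (intro powr_mono2') auto
    then show ?thesis unfolding D using m u v by (auto intro!: mult_left_mono)
  qed (auto simp: D_def)
  then show "0 \<le> D" "D \<le> m * (m + 1) * u * v * b powr (-m - 2)" by auto
qed

text \<open>Up to scaling the extremal of the fractional Sobolev inequality (Aubin-Talenti). Two
  features matter: it decays like the Riesz kernel, to which multiples of its rescalings increase,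
  and inversions act on it by a simple formula.\<close>

definition bubble :: "real \<Rightarrow> real ^ 'n \<Rightarrow> real" where
  "bubble s x = (1 + (norm x)\<^sup>2) powr (- ((real CARD('n) - 2 * s) / 2))"

text \<open>The excess is the integrand of \<open>(-\<Delta>)\<^sup>s bubble\<close> after the exterior of the ball of radius \<open>r = |x|\<close>
  has been folded into its interior by the inversion \<open>y \<mapsto> r\<^sup>2 y / |y|\<^sup>2\<close>; here \<open>t = |y|\<close>.\<close>

definition excess :: "real \<Rightarrow> real \<Rightarrow> real \<Rightarrow> real" where
  "excess m r t = (1 + r\<^sup>2) powr (-m) + (t\<^sup>2 / r\<^sup>2 * (1 + r\<^sup>2)) powr (-m)
     - (1 + t\<^sup>2) powr (-m) - (t\<^sup>2 / r\<^sup>2 + r\<^sup>2) powr (-m)"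

text \<open>The four arguments of the power are b, b + u, b + v and b + u + v with u = 1 -
  \<open>\<theta>\<close> and v = (1 - \<open>\<theta>\<close>) r^2. Convexity of t^-m therefore
  gives the excess its sign.\<close>

lemma excess_eq_second_difference:
  fixes m r t :: real
  assumes "r > 0"
  defines "\<theta> \<equiv> t\<^sup>2 / r\<^sup>2"
  defines "b \<equiv> \<theta> * (1 + r\<^sup>2)"
  shows "excess m r t = (b + (1 - \<theta>) + (1 - \<theta>) * r\<^sup>2) powr (-m) + b powr (-m)
      - (b + (1 - \<theta>)) powr (-m) - (b + (1 - \<theta>) * r\<^sup>2) powr (-m)"
proof -
  have e1: "b + (1 - \<theta>) + (1 - \<theta>) * r\<^sup>2 = 1 + r\<^sup>2" and e2: "b + (1 - \<theta>) * r\<^sup>2 = \<theta> + r\<^sup>2"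
    by (simp_all add: b_def algebra_simps)
  have e3: "b + (1 - \<theta>) = 1 + t\<^sup>2" using assms(1) by (simp add: b_def \<theta>_def field_simps)
  show ?thesis by (subst e1, subst e2, subst e3) (simp only: excess_def b_def \<theta>_def)
qed

text \<open>The bound must vanish to second order on the sphere t = r, where the kernel is singular,
  and be integrable at t = 0. The second difference estimate achieves the former but is too singular
  for small \<open>\<theta>\<close>. There only b^-m - c^-m is kept; it is at most b^-m and at most
  m b^(-m-1), and the exponent -m-\<open>\<sigma>\<close> interpolates between the two.\<close>

lemma excess_bounds:
  fixes m \<sigma> :: real
  assumes m: "m > 0" and \<sigma>: "0 < \<sigma>" "\<sigma> < 1"
  obtains C where "C > 0" "\<And>r t. 0 < t \<Longrightarrow> t < r \<Longrightarrow> 0 \<le> excess m r t"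
    "\<And>r t. 0 < t \<Longrightarrow> t < r \<Longrightarrow> excess m r t \<le> C * (1 - t\<^sup>2 / r\<^sup>2)\<^sup>2 * (t\<^sup>2 / r\<^sup>2 * (1 + r\<^sup>2)) powr (- m - \<sigma>)"
proof -
  \<comment> \<open>16 collects r^2 <= 4b and b^(\<open>\<sigma>\<close>-1) <= 4 for
    \<open>\<theta>\<close> >= 1/4; the 2 comes from (1 - \<open>\<theta>\<close>)^2 >= 9/16 for
    \<open>\<theta>\<close> < 1/4.\<close>
  define C where "C = max (2 * max 1 m) (16 * m * (m + 1))"
  show ?thesis
  proof (rule that[of C])
    show "C > 0" by (simp add: C_def)
    fix r t :: real assume t: "0 < t" "t < r"
    define \<theta> where "\<theta> = t\<^sup>2 / r\<^sup>2"
    define b where "b = \<theta> * (1 + r\<^sup>2)"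
    define c where "c = b + (1 - \<theta>)"
    have \<theta>: "0 < \<theta>" "\<theta> < 1" using t by (auto simp: \<theta>_def power_strict_mono)
    have b: "b > 0" using \<theta> by (auto simp: b_def intro!: mult_pos_pos add_pos_nonneg)
    have eq: "excess m r t = (b + (1 - \<theta>) + (1 - \<theta>) * r\<^sup>2) powr (-m) + b powr (-m)
      - (b + (1 - \<theta>)) powr (-m) - (b + (1 - \<theta>) * r\<^sup>2) powr (-m)"
      unfolding b_def \<theta>_def using t by (intro excess_eq_second_difference) auto
    note sd = powr_second_difference[OF m b, of "1 - \<theta>" "(1 - \<theta>) * r\<^sup>2", folded eq]
    show "0 \<le> excess m r t" using sd(1) \<theta> by simp
    have "excess m r t \<le> C * (1 - \<theta>)\<^sup>2 * b powr (- m - \<sigma>)"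
    proof (cases "\<theta> \<ge> 1 / 4")
      case True
      have "(1 + r\<^sup>2) * (1 / 4) \<le> (1 + r\<^sup>2) * \<theta>" using True by (intro mult_left_mono) auto
      then have "(1 + r\<^sup>2) / 4 \<le> b" by (simp add: b_def mult.commute)
      then have rb: "r\<^sup>2 \<le> 4 * b" by simp
      have "1 / 4 \<le> (1 + r\<^sup>2) / 4" by simp
      then have b4: "1 / 4 \<le> b" using \<open>(1 + r\<^sup>2) / 4 \<le> b\<close> by linarith
      have "b * b powr (- m - 2) = b powr (- m - 1)"
      proof -
        have "1 + (- m - 2) = - m - 1" by simp
        then show ?thesis using powr_mult_base[of b "- m - 2"] b by (metis less_imp_le)
      qed
      moreover have "r\<^sup>2 * b powr (-m - 2) \<le> 4 * b * b powr (-m - 2)" using rb by (intro mult_right_mono) auto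
      ultimately have 1: "r\<^sup>2 * b powr (-m - 2) \<le> 4 * b powr (-m - 1)" by simp
      have "b powr (\<sigma> - 1) \<le> (1 / 4) powr (\<sigma> - 1)" using b4 \<sigma> by (intro powr_mono2') auto
      also have "(1 / 4) powr (\<sigma> - 1) \<le> (1 / 4) powr (-1::real)" using \<sigma> by (intro powr_mono') auto
      also have "(1 / 4) powr (-1::real) = 4" by (simp add: powr_minus)
      finally have "b powr (-m - \<sigma>) * b powr (\<sigma> - 1) \<le> b powr (-m - \<sigma>) * 4" by (intro mult_left_mono) auto
      moreover have "b powr (-m - \<sigma>) * b powr (\<sigma> - 1) = b powr (-m - 1)"
        by (simp add: powr_add[symmetric])
      ultimately have 2: "r\<^sup>2 * b powr (-m - 2) \<le> 16 * b powr (-m - \<sigma>)" using 1 by linarith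
      have "excess m r t \<le> m * (m + 1) * (1 - \<theta>) * ((1 - \<theta>) * r\<^sup>2) * b powr (-m - 2)"
        using sd(2) \<theta> by simp
      also have "\<dots> = m * (m + 1) * (1 - \<theta>)\<^sup>2 * (r\<^sup>2 * b powr (-m - 2))"
        by (simp add: power2_eq_square)
      also have "\<dots> \<le> m * (m + 1) * (1 - \<theta>)\<^sup>2 * (16 * b powr (-m - \<sigma>))"
        using 2 m by (intro mult_left_mono) auto
      also have "\<dots> = (16 * m * (m + 1)) * ((1 - \<theta>)\<^sup>2 * b powr (- m - \<sigma>))" by simp
      also have "\<dots> \<le> C * ((1 - \<theta>)\<^sup>2 * b powr (- m - \<sigma>))" by (intro mult_right_mono) (auto simp: C_def)
      finally show ?thesis by (simp add: mult_ac)
    next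
      case False
      have "(b + (1 - \<theta>) + (1 - \<theta>) * r\<^sup>2) powr (-m) \<le> (b + (1 - \<theta>) * r\<^sup>2) powr (-m)"
        using \<theta> b m by (intro powr_mono2') (auto intro!: add_pos_nonneg)
      then have le1: "excess m r t \<le> b powr (-m) - c powr (-m)" unfolding eq c_def by linarith
      have "b powr (-m) - c powr (-m) \<le> max 1 m * b powr (- m - \<sigma>)"
      proof (cases "b \<le> 1")
        case True
        have "b powr (-m) - c powr (-m) \<le> b powr (-m)" by simp
        also have "\<dots> \<le> 1 * b powr (-m - \<sigma>)" using True b \<sigma> by (auto intro: powr_mono')
        also have "\<dots> \<le> max 1 m * b powr (- m - \<sigma>)" by (intro mult_right_mono) auto
        finally show ?thesis .
      next
        case False
        have bc: "b < c" using \<theta> by (simp add: c_def)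
        have "\<exists>z>b. z < c \<and> c powr (-m) - b powr (-m) = (c - b) * (- m * z powr (-m - 1))"
          by (rule MVT2[OF bc]) (use b in \<open>auto intro!: derivative_eq_intros\<close>)
        then obtain z where z: "z > b" "z < c" "c powr (-m) - b powr (-m) = (c - b) * (- m * z powr (-m - 1))" by blast
        have "b powr (-m) - c powr (-m) = (1 - \<theta>) * (m * z powr (-m - 1))" using z(3) by (simp add: c_def algebra_simps)
        also have "\<dots> \<le> 1 * (m * z powr (-m - 1))" using \<theta> m by (intro mult_right_mono) auto
        also have "\<dots> \<le> m * b powr (-m - 1)" using z b m by (auto intro!: mult_left_mono powr_mono2')
        also have "\<dots> \<le> max 1 m * b powr (-m - \<sigma>)" using False \<sigma> m by (intro mult_mono powr_mono) auto
        finally show ?thesis .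
      qed
      also have "\<dots> = max 1 m * b powr (- m - \<sigma>) * 1" by simp
      also have "\<dots> \<le> max 1 m * b powr (- m - \<sigma>) * (2 * (1 - \<theta>)\<^sup>2)"
      proof (intro mult_left_mono)
        have "(3 / 4)\<^sup>2 \<le> (1 - \<theta>)\<^sup>2" using False by (intro power_mono) auto
        then show "1 \<le> 2 * (1 - \<theta>)\<^sup>2" by (simp add: power2_eq_square)
      qed (auto simp: le_max_iff_disj)
      also have "\<dots> = (2 * max 1 m) * ((1 - \<theta>)\<^sup>2 * b powr (- m - \<sigma>))" by (simp add: mult_ac)
      also have "\<dots> \<le> C * ((1 - \<theta>)\<^sup>2 * b powr (- m - \<sigma>))" by (intro mult_right_mono) (auto simp: C_def)
      finally show ?thesis using le1 by (simp add: mult_ac)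
    qed
    then show "excess m r t \<le> C * (1 - t\<^sup>2 / r\<^sup>2)\<^sup>2 * (t\<^sup>2 / r\<^sup>2 * (1 + r\<^sup>2)) powr (- m - \<sigma>)"
      by (simp add: b_def \<theta>_def)
  qed
qed

lemma excess_measurable[measurable]: "(\<lambda>(r, t). excess m r t) \<in> borel_measurable (borel \<Otimes>\<^sub>M borel)"
  unfolding excess_def by measurable

section \<open>The kernel and inversion in a sphere\<close>

definition kern :: "real \<Rightarrow> real ^ 'n \<Rightarrow> real" where
  "kern s z = 1 / norm z powr (real CARD('n) + 2 * s)"

lemma kern_measurable[measurable]: "kern s \<in> borel_measurable borel"
  unfolding kern_def by measurable

lemma kern_nonneg[simp]: "0 \<le> kern s z" by (simp add: kern_def)

lemma bubble_measurable[measurable]: "bubble s \<in> borel_measurable borel"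
  unfolding bubble_def by measurable

lemma bubble_pos: "0 < bubble s x"
proof -
  have "0 < 1 + (norm x)\<^sup>2" by (simp add: add_pos_nonneg)
  then show ?thesis unfolding bubble_def by simp
qed

text \<open>The point x lies on the sphere of inversion and is fixed by it, so that the distance
  from x to y changes just by the factor |x|/|y|.\<close>

lemma norm_diff_inversion:
  fixes x y :: "'a::euclidean_space"
  assumes "y \<noteq> 0"
  shows "norm (x - (norm x / norm y)\<^sup>2 *\<^sub>R y) = norm (x - y) * (norm x / norm y)"
proof (rule power2_eq_imp_eq)
  define c where "c = (norm x / norm y)\<^sup>2"
  have c: "c * (norm y)\<^sup>2 = (norm x)\<^sup>2" using assms by (simp add: c_def power_divide)
  have "(norm (x - c *\<^sub>R y))\<^sup>2 = (norm x)\<^sup>2 - 2 * c * (x \<bullet> y) + c * (c * (norm y)\<^sup>2)"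
    unfolding power2_norm_eq_inner
    by (simp add: inner_diff_left inner_diff_right inner_commute[of y x] algebra_simps)
  also have "\<dots> = c * ((norm x)\<^sup>2 - 2 * (x \<bullet> y) + (norm y)\<^sup>2)"
    unfolding distrib_left right_diff_distrib c by (simp add: algebra_simps)
  also have "(norm x)\<^sup>2 - 2 * (x \<bullet> y) + (norm y)\<^sup>2 = (norm (x - y))\<^sup>2"
    unfolding power2_norm_eq_inner by (simp add: inner_diff_left inner_diff_right inner_commute[of y x])
  finally show "(norm (x - (norm x / norm y)\<^sup>2 *\<^sub>R y))\<^sup>2 = (norm (x - y) * (norm x / norm y))\<^sup>2"
    by (simp only: power_mult_distrib c_def mult.commute)
qed auto

text \<open>The weight (|x|/|y|)^(N-2s) is the Jacobian (|x|/|y|)^(2N) divided by the factor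
  (|x|/|y|)^(N+2s) coming from the kernel. The bubble, a power of 1 + |.|^2, absorbs it:
  \<open>\<theta>\<close> (1 + |y'|^2) = \<open>\<theta>\<close> + |x|^2 for the reflected point
  y'.\<close>

lemma bubble_inversion_identity:
  fixes x y :: "real ^ 'n"
  assumes "x \<noteq> 0" "y \<noteq> 0"
  shows "(bubble s x - bubble s ((norm x / norm y)\<^sup>2 *\<^sub>R y)) * (norm x / norm y) powr (real CARD('n) - 2 * s)
     = (bubble s y - bubble s x) + excess ((real CARD('n) - 2 * s) / 2) (norm x) (norm y)"
proof -
  define m where "m = (real CARD('n) - 2 * s) / 2"
  define \<theta> where "\<theta> = (norm y)\<^sup>2 / (norm x)\<^sup>2"
  have nx: "norm x > 0" and ny: "norm y > 0" using assms by auto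
  have A: "(norm x / norm y) powr (real CARD('n) - 2 * s) = \<theta> powr (-m)"
  proof -
    have "\<theta> = (norm x / norm y) powr (-2)"
      using nx ny by (simp add: \<theta>_def powr_minus power_divide field_simps)
    moreover have "- 2 * - m = real CARD('n) - 2 * s" by (simp add: m_def field_simps)
    ultimately show ?thesis by (simp only: powr_powr)
  qed
  have \<theta>: "\<theta> > 0" using nx ny by (simp add: \<theta>_def)
  have 1: "bubble s x * \<theta> powr (-m) = (\<theta> * (1 + (norm x)\<^sup>2)) powr (-m)"
    using \<theta> by (simp add: bubble_def m_def powr_mult mult.commute)
  have "norm ((norm x / norm y)\<^sup>2 *\<^sub>R y) = (norm x)\<^sup>2 / norm y" using ny by (simp add: power2_eq_square)
  then have "bubble s ((norm x / norm y)\<^sup>2 *\<^sub>R y) * \<theta> powr (-m) = (\<theta> * (1 + ((norm x)\<^sup>2 / norm y)\<^sup>2)) powr (-m)"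
    using \<theta> by (simp only: bubble_def m_def) (subst powr_mult, auto)
  also have "\<theta> * (1 + ((norm x)\<^sup>2 / norm y)\<^sup>2) = \<theta> + (norm x)\<^sup>2"
    using nx ny by (simp add: \<theta>_def field_simps power2_eq_square)
  finally have 2: "bubble s ((norm x / norm y)\<^sup>2 *\<^sub>R y) * \<theta> powr (-m) = (\<theta> + (norm x)\<^sup>2) powr (-m)" .
  show ?thesis
    unfolding A left_diff_distrib 1 2 m_def[symmetric] excess_def \<theta>_def[symmetric]
    by (simp add: bubble_def m_def[symmetric])
qed

text \<open>The principal value over y of (\<open>bubble s x\<close> - \<open>bubble s y\<close>)
  \<open>kern s (x - y)\<close> in folded form: the inner half cancels against the image of the
  outer one and only the excess remains. As its integrand is nonnegative, it is an ordinary
  integral.\<close>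

definition frac_bubble :: "real \<Rightarrow> real ^ 'n \<Rightarrow> ennreal" where
  "frac_bubble s x = (\<integral>\<^sup>+y. (if norm y < norm x
      then ennreal (excess ((real CARD('n) - 2 * s) / 2) (norm x) (norm y) * kern s (x - y)) else 0) \<partial>lborel)"

lemma excess_measurable'[measurable (raw)]:
  assumes [measurable]: "f \<in> borel_measurable M" "g \<in> borel_measurable M"
  shows "(\<lambda>x. excess m (f x) (g x)) \<in> borel_measurable M"
  unfolding excess_def by measurable

lemma frac_bubble_measurable[measurable]: "frac_bubble s \<in> borel_measurable borel"
  unfolding frac_bubble_def[abs_def] by measurable

lemma kern_minus: "kern s (x - y) = kern s (y - x)"
  by (simp add: kern_def norm_minus_commute)

lemma kern_le:
  fixes z :: "real ^ 'n"
  assumes "0 < s" "0 < d" "d \<le> norm z"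
  shows "kern s z \<le> d powr (- (real CARD('n) + 2 * s))"
proof -
  have "kern s z = norm z powr (- (real CARD('n) + 2 * s))" by (simp only: kern_def powr_minus inverse_eq_divide)
  also have "\<dots> \<le> d powr (- (real CARD('n) + 2 * s))" using assms by (intro powr_mono2') auto
  finally show ?thesis .
qed

lemma frac_bubble_bound:
  fixes s :: real
  assumes s: "0 < s" "s < 1" "2 * s < real CARD('n)"
  obtains C where "C \<ge> 0" "\<And>x::real^'n. x \<noteq> 0 \<Longrightarrow> frac_bubble s x \<le>
    ennreal (C * (norm x powr (- (2 * s)) * (1 + (norm x)\<^sup>2) powr (- ((real CARD('n) - s) / 2))))"
proof -
  let ?N = "real CARD('n)"
  define A where "A = ?N - 2 * s"
  define m where "m = (?N - 2 * s) / 2"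
  \<comment> \<open>The choice \<open>\<sigma>\<close> = s/2: |y|^(-A-2\<open>\<sigma>\<close>) is
    integrable at 0 for \<open>\<sigma>\<close> < s, and the resulting tail
    |x|^(-N-2\<open>\<sigma>\<close>) is integrable at infinity for \<open>\<sigma>\<close> >
    0.\<close>
  define e where "e = - m - s / 2"
  have m: "m > 0" using s by (simp add: m_def)
  have e2: "2 * e = - (A + s)" and e': "e = - ((?N - s) / 2)" by (simp_all add: e_def m_def A_def field_simps)
  obtain K where K: "K > 0" "\<And>r t. 0 < t \<Longrightarrow> t < r \<Longrightarrow> 0 \<le> excess m r t"
    "\<And>r t. 0 < t \<Longrightarrow> t < r \<Longrightarrow> excess m r t \<le> K * (1 - t\<^sup>2 / r\<^sup>2)\<^sup>2 * (t\<^sup>2 / r\<^sup>2 * (1 + r\<^sup>2)) powr e"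
    using excess_bounds[OF m, of "s / 2"] s unfolding e_def by auto
  obtain C1 where C1: "C1 \<ge> 0" "\<And>r. r > 0 \<Longrightarrow>
    (\<integral>\<^sup>+y. pow_in (A + s) r (y::real^'n) \<partial>lborel) = ennreal (C1 * r powr (?N - (A + s)))"
    using nn_integral_norm_powr_ball[of "A + s", where 'a="real^'n"] s by (auto simp: A_def)
  obtain C2 where C2: "C2 \<ge> 0" "\<And>r. r > 0 \<Longrightarrow>
    (\<integral>\<^sup>+y. pow_in (?N + 2 * s - 2) r (y::real^'n) \<partial>lborel) = ennreal (C2 * r powr (?N - (?N + 2 * s - 2)))"
    using nn_integral_norm_powr_ball[of "?N + 2 * s - 2", where 'a="real^'n"] s by auto
  define c1 where "c1 = 2 powr (?N + 2 * s)"
  define c2 where "c2 = 4 * 4 powr (- e)"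
  define C where "C = K * (c1 * C1 + c2 * C2 * 2 powr (2 - 2 * s))"
  show ?thesis
  proof (rule that[of C])
    show "C \<ge> 0" using K C1 C2 by (auto simp: C_def c1_def c2_def)
    fix x :: "real ^ 'n" assume x: "x \<noteq> 0"
    define r where "r = norm x"
    have r: "r > 0" using x by (simp add: r_def)
    define G where "G = K * (1 + r\<^sup>2) powr e"
    have G: "G \<ge> 0" using K by (simp add: G_def)
    define a1 where "a1 = G * (c1 * r powr (A + s - (?N + 2 * s)))"
    define a2 where "a2 = G * (c2 * r powr (-2))"
    have a: "a1 \<ge> 0" "a2 \<ge> 0" using G by (auto simp: a1_def a2_def c1_def c2_def)
    have "frac_bubble s x \<le> (\<integral>\<^sup>+y. ennreal a1 * pow_in (A + s) r (y::real^'n)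
       + ennreal a2 * pow_in (?N + 2 * s - 2) (2 * r) (x - y) \<partial>lborel)"
      unfolding frac_bubble_def
    proof (rule nn_integral_mono_AE, use AE_lborel_singleton[of "0::real^'n"] in eventually_elim)
      case (elim y)
      define t where "t = norm y"
      define \<theta> where "\<theta> = t\<^sup>2 / r\<^sup>2"
      have t: "t > 0" using elim by (simp add: t_def)
      have \<theta>: "\<theta> > 0" using t r by (simp add: \<theta>_def)
      have \<theta>e: "\<theta> powr e = r powr (A + s) * t powr (- (A + s))"
      proof -
        have "\<theta> = (t / r) powr 2" using t r by (simp add: \<theta>_def power_divide)
        then have "\<theta> powr e = (t / r) powr (2 * e)" by (simp add: powr_powr)
        also have "\<dots> = t powr (- (A + s)) / r powr (- (A + s))" using t r unfolding e2 by (subst powr_divide) auto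
        also have "\<dots> = t powr (- (A + s)) * r powr (A + s)"
          by (simp only: powr_minus divide_inverse inverse_inverse_eq)
        finally show ?thesis by simp
      qed
      show "(if norm y < norm x then ennreal (excess ((?N - 2 * s) / 2) (norm x) (norm y) * kern s (x - y)) else 0)
        \<le> ennreal a1 * pow_in (A + s) r y
       + ennreal a2 * pow_in (?N + 2 * s - 2) (2 * r) (x - y)"
      proof (cases "t < r")
        case True
        have \<theta>1: "\<theta> < 1" using t True by (auto simp: \<theta>_def power_strict_mono)
        have "excess m r t \<le> K * (1 - \<theta>)\<^sup>2 * (\<theta> * (1 + r\<^sup>2)) powr e" using K(3)[OF t True] by (simp add: \<theta>_def)
        also have "(\<theta> * (1 + r\<^sup>2)) powr e = \<theta> powr e * (1 + r\<^sup>2) powr e"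
          by (rule powr_mult)
        finally have "excess m r t \<le> G * ((1 - \<theta>)\<^sup>2 * \<theta> powr e)" by (simp add: G_def mult_ac)
        from mult_right_mono[OF this kern_nonneg[of s "x - y"]]
        have le: "excess m r t * kern s (x - y) \<le> G * ((1 - \<theta>)\<^sup>2 * \<theta> powr e * kern s (x - y))" by (simp add: mult_ac)
        have xy: "norm (x - y) \<ge> r - t" using norm_triangle_ineq2[of x y] by (simp add: r_def t_def)
        show ?thesis
        \<comment> \<open>For |y| < |x|/2 the kernel has size |x|^-(N+2s), and the singularity of
          the bound at y = 0 is integrated; otherwise \<open>\<theta>\<close> is bounded below and
          the singularity at y = x is the one that matters.\<close>
        proof (cases "t < r / 2")
          case near: True
          have "kern s (x - y) \<le> (r / 2) powr (- (?N + 2 * s))"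
            using xy near r s by (intro kern_le) auto
          also have "\<dots> = r powr (- (?N + 2 * s)) * c1"
          proof -
            have "(r / 2) powr (- (?N + 2 * s)) = r powr (- (?N + 2 * s)) / 2 powr (- (?N + 2 * s))" by (rule powr_divide)
            also have "\<dots> = r powr (- (?N + 2 * s)) * c1" by (simp only: c1_def powr_minus divide_inverse inverse_inverse_eq)
            finally show ?thesis .
          qed
          finally have k: "kern s (x - y) \<le> r powr (- (?N + 2 * s)) * c1" .
          have "(1 - \<theta>)\<^sup>2 \<le> 1" using \<theta> \<theta>1 by (simp add: power_le_one)
          then have "(1 - \<theta>)\<^sup>2 * \<theta> powr e * kern s (x - y) \<le> 1 * \<theta> powr e * (r powr (- (?N + 2 * s)) * c1)"
            using k by (intro mult_mono) auto
          also have "\<dots> = c1 * (r powr (A + s) * r powr (- (?N + 2 * s))) * t powr (- (A + s))"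
            by (simp only: \<theta>e mult_1 mult_ac)
          also have "r powr (A + s) * r powr (- (?N + 2 * s)) = r powr (A + s - (?N + 2 * s))"
            by (simp only: powr_add[symmetric] diff_conv_add_uminus)
          finally have "G * ((1 - \<theta>)\<^sup>2 * \<theta> powr e * kern s (x - y)) \<le> a1 * t powr (- (A + s))"
            using G unfolding a1_def mult.assoc by (intro mult_left_mono) auto
          with le have "ennreal (excess m r t * kern s (x - y)) \<le> ennreal (a1 * t powr (- (A + s)))"
            by (intro ennreal_leI) linarith
          also have "\<dots> = ennreal a1 * ennreal (t powr (- (A + s)))" using a by (simp add: ennreal_mult)
          finally show ?thesis
            using True by (simp add: r_def[symmetric] t_def[symmetric] m_def[symmetric] add_increasing2)
        next
          case far: False
          show ?thesis
          proof (cases "x = y")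
            case True then show ?thesis using \<open>t < r\<close> by (simp add: t_def r_def)
          next
            case False
            define n where "n = norm (x - y)"
            have n: "n > 0" using False by (simp add: n_def)
            have n2: "n < 2 * r" using norm_triangle_ineq4[of x y] True by (simp add: n_def r_def t_def)
            \<comment> \<open>By r - t <= |x - y| the double zero of (1 - \<open>\<theta>\<close>)^2
              yields two powers of |x - y|, which make the kernel integrable at y = x since s <
              1.\<close>
            have "1 - \<theta> = (1 + t / r) * ((r - t) / r)" using r by (simp add: \<theta>_def field_simps power2_eq_square)
            also have "\<dots> \<le> 2 * (n / r)"
              using r t True xy by (intro mult_mono divide_right_mono) (auto simp: n_def)
            finally have "(1 - \<theta>)\<^sup>2 \<le> (2 * (n / r))\<^sup>2" using \<theta>1 by (intro power_mono) auto
            also have "\<dots> = 4 * (n powr 2 * r powr (-2))"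
              using n r by (simp add: power_divide powr_minus power_mult_distrib field_simps)
            finally have 1: "(1 - \<theta>)\<^sup>2 \<le> 4 * (n powr 2 * r powr (-2))" .
            have "1 / 4 \<le> \<theta>"
            proof -
              have "(1 / 2)\<^sup>2 \<le> (t / r)\<^sup>2" using far r by (intro power_mono) (auto simp: field_simps)
              then show ?thesis by (simp add: \<theta>_def power_divide power2_eq_square)
            qed
            then have "\<theta> powr e \<le> (1 / 4) powr e" using m s by (intro powr_mono2') (auto simp: e_def)
            also have "\<dots> = 4 powr (- e)" by (simp add: powr_divide powr_minus field_simps)
            finally have 2: "\<theta> powr e \<le> 4 powr (- e)" .
            have kn: "kern s (x - y) = n powr (- (?N + 2 * s))" by (simp only: kern_def powr_minus inverse_eq_divide n_def)
            have nn: "n powr 2 * n powr (- (?N + 2 * s)) = n powr (- (?N + 2 * s - 2))"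
            proof -
              have "2 + - (?N + 2 * s) = - (?N + 2 * s - 2)" by simp
              then show ?thesis by (simp only: powr_add[symmetric])
            qed
            have "(1 - \<theta>)\<^sup>2 * \<theta> powr e * kern s (x - y) \<le> (4 * (n powr 2 * r powr (-2))) * 4 powr (- e) * kern s (x - y)"
              using 1 2 by (intro mult_mono) auto
            also have "\<dots> = c2 * r powr (-2) * (n powr 2 * n powr (- (?N + 2 * s)))"
              by (simp only: kn c2_def mult_ac)
            also have "\<dots> = c2 * r powr (-2) * n powr (- (?N + 2 * s - 2))" by (simp only: nn)
            finally have "G * ((1 - \<theta>)\<^sup>2 * \<theta> powr e * kern s (x - y)) \<le> a2 * n powr (- (?N + 2 * s - 2))"
              using G unfolding a2_def mult.assoc by (intro mult_left_mono) auto
            with le have "ennreal (excess m r t * kern s (x - y)) \<le> ennreal (a2 * n powr (- (?N + 2 * s - 2)))"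
              by (intro ennreal_leI) linarith
            also have "\<dots> = ennreal a2 * ennreal (n powr (- (?N + 2 * s - 2)))" using a by (simp only: ennreal_mult powr_ge_zero)
            finally show ?thesis
              using True n2 by (simp add: r_def[symmetric] t_def[symmetric] m_def[symmetric] n_def[symmetric] add_increasing)
          qed
        qed
      qed (simp add: r_def t_def)
    qed
    also have "\<dots> = ennreal a1 * (\<integral>\<^sup>+y. pow_in (A + s) r (y::real^'n) \<partial>lborel) +
       ennreal a2 * (\<integral>\<^sup>+y. pow_in (?N + 2 * s - 2) (2 * r) (x - y) \<partial>lborel)"
      by (subst nn_integral_add) (auto simp: nn_integral_cmult)
    also have "(\<integral>\<^sup>+y. pow_in (?N + 2 * s - 2) (2 * r) (x - y) \<partial>lborel) =
       (\<integral>\<^sup>+y. pow_in (?N + 2 * s - 2) (2 * r) (y::real^'n) \<partial>lborel)"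
      by (rule nn_integral_lborel_diff[of "\<lambda>y. pow_in (?N + 2 * s - 2) (2 * r) (y::real^'n)"]) measurable
    also have "\<dots> = ennreal (C2 * (2 * r) powr (2 - 2 * s))" using r by (subst C2(2)) auto
    also have "(\<integral>\<^sup>+y. pow_in (A + s) r (y::real^'n) \<partial>lborel) = ennreal (C1 * r powr s)"
      using r by (subst C1(2)) (auto simp: A_def)
    also have "ennreal a1 * ennreal (C1 * r powr s) + ennreal a2 * ennreal (C2 * (2 * r) powr (2 - 2 * s)) =
        ennreal (a1 * (C1 * r powr s) + a2 * (C2 * (2 * r) powr (2 - 2 * s)))"
      using a C1 C2 by (simp add: ennreal_mult[symmetric])
    also have "a1 * (C1 * r powr s) + a2 * (C2 * (2 * r) powr (2 - 2 * s)) = C * (r powr (- (2 * s)) * (1 + r\<^sup>2) powr e)"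
    proof -
      have "r powr (A + s - (?N + 2 * s)) * r powr s = r powr (- (2 * s))"
        by (simp add: powr_add[symmetric] A_def)
      then have "a1 * (C1 * r powr s) = G * c1 * C1 * r powr (- (2 * s))" by (simp add: a1_def mult_ac)
      moreover have "r powr (-2) * r powr (2 - 2 * s) = r powr (- (2 * s))"
        by (subst powr_add[symmetric]) simp
      then have "a2 * (C2 * (2 * r) powr (2 - 2 * s)) = G * c2 * C2 * 2 powr (2 - 2 * s) * r powr (- (2 * s))"
        using r by (simp only: a2_def powr_mult less_imp_le zero_le_numeral mult_ac) (simp add: mult_ac)
      moreover have "G * c1 * C1 * r powr (- (2 * s)) + G * c2 * C2 * 2 powr (2 - 2 * s) * r powr (- (2 * s)) =
          C * (r powr (- (2 * s)) * (1 + r\<^sup>2) powr e)" by (simp add: C_def G_def algebra_simps)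
      ultimately show ?thesis by (simp only:)
    qed
    finally show "frac_bubble s x \<le> ennreal (C * (norm x powr (- (2 * s)) * (1 + (norm x)\<^sup>2) powr (- ((?N - s) / 2))))"
      by (simp add: r_def e')
  qed
qed

lemma frac_bubble_integral_finite:
  fixes s :: real
  assumes s: "0 < s" "s < 1" "2 * s < real CARD('n)"
  shows "(\<integral>\<^sup>+x. frac_bubble s (x::real^'n) \<partial>lborel) < \<infinity>"
proof -
  let ?N = "real CARD('n)"
  obtain C where C: "C \<ge> 0" "\<And>x::real^'n. x \<noteq> 0 \<Longrightarrow> frac_bubble s x \<le>
    ennreal (C * (norm x powr (- (2 * s)) * (1 + (norm x)\<^sup>2) powr (- ((?N - s) / 2))))"
    using frac_bubble_bound[OF s] by blast
  obtain C1 where C1: "C1 \<ge> 0" "\<And>r. r > 0 \<Longrightarrow>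
    (\<integral>\<^sup>+y. pow_in (2 * s) r (y::real^'n) \<partial>lborel) = ennreal (C1 * r powr (?N - 2 * s))"
    using nn_integral_norm_powr_ball[of "2 * s", where 'a="real^'n"] s by auto
  obtain C2 where C2: "C2 \<ge> 0" "\<And>r. r > 0 \<Longrightarrow>
    (\<integral>\<^sup>+y. pow_out (?N + s) r (y::real^'n) \<partial>lborel) = ennreal (C2 * r powr (?N - (?N + s)))"
    using nn_integral_norm_powr_outside[of "?N + s", where 'a="real^'n"] s by auto
  have "(\<integral>\<^sup>+x. frac_bubble s (x::real^'n) \<partial>lborel) \<le> (\<integral>\<^sup>+y. ennreal C * pow_in (2 * s) 2 (y::real^'n)
     + ennreal C * pow_out (?N + s) 1 (y::real^'n) \<partial>lborel)"
  proof (rule nn_integral_mono_AE, use AE_lborel_singleton[of "0::real^'n"] in eventually_elim)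
    case (elim x)
    define r where "r = norm x"
    have r: "r > 0" using elim by (simp add: r_def)
    have fb: "frac_bubble s x \<le> ennreal (C * (r powr (- (2 * s)) * (1 + r\<^sup>2) powr (- ((?N - s) / 2))))"
      using C(2)[OF elim] by (simp add: r_def)
    show ?case
    proof (cases "r < 2")
      case True
      have "(1 + r\<^sup>2) powr (- ((?N - s) / 2)) \<le> 1 powr (- ((?N - s) / 2))" using s by (intro powr_mono2') auto
      then have "C * (r powr (- (2 * s)) * (1 + r\<^sup>2) powr (- ((?N - s) / 2))) \<le> C * (r powr (- (2 * s)) * 1)"
        using C(1) by (intro mult_left_mono) auto
      then have "frac_bubble s x \<le> ennreal (C * r powr (- (2 * s)))" using fb by (auto intro: order_trans ennreal_leI)
      also have "\<dots> = ennreal C * ennreal (r powr (- (2 * s)))" using C(1) by (simp only: ennreal_mult powr_ge_zero)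
      finally show ?thesis using True by (simp add: r_def[symmetric] add_increasing2)
    next
      case False
      have "(1 + r\<^sup>2) powr (- ((?N - s) / 2)) \<le> (r\<^sup>2) powr (- ((?N - s) / 2))" using s r by (intro powr_mono2') auto
      also have "(r\<^sup>2) powr (- ((?N - s) / 2)) = r powr (- (?N - s))"
      proof -
        have "r\<^sup>2 = r powr 2" using r by simp
        moreover have "2 * (- ((?N - s) / 2)) = - (?N - s)" by (simp add: field_simps)
        ultimately show ?thesis by (simp only: powr_powr)
      qed
      finally have "C * (r powr (- (2 * s)) * (1 + r\<^sup>2) powr (- ((?N - s) / 2))) \<le> C * (r powr (- (2 * s)) * r powr (- (?N - s)))"
        using C(1) by (intro mult_left_mono) auto
      also have "r powr (- (2 * s)) * r powr (- (?N - s)) = r powr (- (?N + s))"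
      proof -
        have "- (2 * s) + - (?N - s) = - (?N + s)" by simp
        then show ?thesis by (simp only: powr_add[symmetric])
      qed
      finally have "frac_bubble s x \<le> ennreal (C * r powr (- (?N + s)))" using fb by (auto intro: order_trans ennreal_leI)
      also have "\<dots> = ennreal C * ennreal (r powr (- (?N + s)))" using C(1) by (simp only: ennreal_mult powr_ge_zero)
      finally show ?thesis using False by (simp add: r_def[symmetric] add_increasing)
    qed
  qed
  also have "\<dots> = ennreal C * (\<integral>\<^sup>+y. pow_in (2 * s) 2 (y::real^'n) \<partial>lborel)
     + ennreal C * (\<integral>\<^sup>+y. pow_out (?N + s) 1 (y::real^'n) \<partial>lborel)"
    by (subst nn_integral_add) (auto simp: nn_integral_cmult)
  also have "(\<integral>\<^sup>+y. pow_in (2 * s) 2 (y::real^'n) \<partial>lborel) = ennreal (C1 * 2 powr (?N - 2 * s))"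
    by (subst C1(2)) auto
  also have "(\<integral>\<^sup>+y. pow_out (?N + s) 1 (y::real^'n) \<partial>lborel) = ennreal (C2 * 1 powr (?N - (?N + s)))"
    by (subst C2(2)) auto
  finally show ?thesis by (auto simp: ennreal_mult[symmetric] C(1) C1(1) C2(1) less_top[symmetric] top_unique elim!: order_le_less_trans)
qed

section \<open>Truncated integrals of the bubble\<close>

lemma bubble_antimono:
  fixes x y :: "real ^ 'n"
  assumes "2 * s < real CARD('n)" "norm y \<le> norm x"
  shows "bubble s x \<le> bubble s y"
  unfolding bubble_def using assms by (intro powr_mono2') (auto intro: add_pos_nonneg power_mono)

lemma bubble_le_1:
  fixes x :: "real ^ 'n"
  assumes "2 * s < real CARD('n)"
  shows "bubble s x \<le> 1"
  using bubble_antimono[OF assms, of 0 x] by (simp add: bubble_def)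

lemma bubble_le_powr:
  fixes x :: "real ^ 'n"
  assumes "2 * s < real CARD('n)" "x \<noteq> 0"
  shows "bubble s x \<le> norm x powr (- (real CARD('n) - 2 * s))"
proof -
  have "bubble s x \<le> (norm x powr 2) powr (- ((real CARD('n) - 2 * s) / 2))"
    unfolding bubble_def using assms by (intro powr_mono2') auto
  also have "2 * (- ((real CARD('n) - 2 * s) / 2)) = - (real CARD('n) - 2 * s)" by (simp add: field_simps)
  then have "(norm x powr 2) powr (- ((real CARD('n) - 2 * s) / 2)) = norm x powr (- (real CARD('n) - 2 * s))"
    by (simp only: powr_powr)
  finally show ?thesis .
qed

lemma excess_nonneg:
  assumes "m > 0" "0 < t" "t < r"
  shows "0 \<le> excess m r t"
proof -
  obtain C where "\<And>r t. 0 < t \<Longrightarrow> t < r \<Longrightarrow> 0 \<le> excess m r t"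
    by (rule excess_bounds[OF assms(1), of "1/2"]) auto
  then show ?thesis using assms by simp
qed

text \<open>\<open>bubble_inner\<close> and \<open>bubble_outer\<close> are the two halves of the
  principal value at x, restricted to ratios |y|/|x| below q and above 1/q, and signed so that both
  integrands are nonnegative.\<close>

definition bubble_inner :: "real \<Rightarrow> real \<Rightarrow> real ^ 'n \<Rightarrow> ennreal" where
  "bubble_inner s q x = (\<integral>\<^sup>+y. (if norm y < q * norm x
      then ennreal ((bubble s y - bubble s x) * kern s (x - y)) else 0) \<partial>lborel)"

definition bubble_outer :: "real \<Rightarrow> real \<Rightarrow> real ^ 'n \<Rightarrow> ennreal" where
  "bubble_outer s q x = (\<integral>\<^sup>+y. (if norm x < q * norm y
      then ennreal ((bubble s x - bubble s y) * kern s (x - y)) else 0) \<partial>lborel)"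

definition bubble_excess :: "real \<Rightarrow> real \<Rightarrow> real ^ 'n \<Rightarrow> ennreal" where
  "bubble_excess s q x = (\<integral>\<^sup>+y. (if norm y < q * norm x
      then ennreal (excess ((real CARD('n) - 2 * s) / 2) (norm x) (norm y) * kern s (x - y)) else 0) \<partial>lborel)"

lemma bubble_parts_measurable[measurable]:
  "bubble_inner s q \<in> borel_measurable borel"
  "bubble_outer s q \<in> borel_measurable borel"
  "bubble_excess s q \<in> borel_measurable borel"
  unfolding bubble_inner_def[abs_def] bubble_outer_def[abs_def] bubble_excess_def[abs_def] by measurable

lemma bubble_excess_le:
  assumes "q \<le> 1"
  shows "bubble_excess s q x \<le> frac_bubble s x"
proof -
  have "norm y < norm x" if "norm y < q * norm x" for y
    using that mult_right_mono[OF assms norm_ge_zero[of x]] by simp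
  then show ?thesis unfolding bubble_excess_def frac_bubble_def by (intro nn_integral_mono) auto
qed

text \<open>The inversion through x exchanges the regions |y| < q |x| and |x| < q |y|, so the outer
  half folds exactly onto the inner one. The identity is additive, as finiteness is proved only
  below.\<close>

lemma bubble_outer_eq:
  fixes x :: "real ^ 'n"
  assumes s: "0 < s" "2 * s < real CARD('n)" and q: "0 < q" "q < 1" and x: "x \<noteq> 0"
  shows "bubble_outer s q x = bubble_inner s q x + bubble_excess s q x"
proof -
  let ?N = "real CARD('n)"
  let ?m = "(?N - 2 * s) / 2"
  define r where "r = norm x"
  have r: "r > 0" using x by (simp add: r_def)
  have "bubble_outer s q x = (\<integral>\<^sup>+y. (if norm x < q * norm ((r / norm y)\<^sup>2 *\<^sub>R y)
      then ennreal ((bubble s x - bubble s ((r / norm y)\<^sup>2 *\<^sub>R y)) * kern s (x - (r / norm y)\<^sup>2 *\<^sub>R y)) else 0) *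
       ennreal ((r / norm y) ^ (2 * CARD('n))) \<partial>lborel)"
    unfolding bubble_outer_def by (subst nn_integral_inversion[OF _ r]) auto
  also have "\<dots> = (\<integral>\<^sup>+y. (if norm y < q * norm x then ennreal ((bubble s y - bubble s x) * kern s (x - y)) else 0) +
      (if norm y < q * norm x then ennreal (excess ?m (norm x) (norm y) * kern s (x - y)) else 0) \<partial>lborel)"
  proof (rule nn_integral_cong_AE, use AE_lborel_singleton[of "0::real^'n"] in eventually_elim)
    case (elim y)
    define t where "t = norm y"
    have t: "t > 0" using elim by (simp add: t_def)
    have nz: "norm ((r / norm y)\<^sup>2 *\<^sub>R y) = r\<^sup>2 / t"
      using t by (simp add: power2_eq_square t_def)
    have iff: "norm x < q * norm ((r / norm y)\<^sup>2 *\<^sub>R y) \<longleftrightarrow> norm y < q * norm x"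
      unfolding nz unfolding r_def[symmetric] t_def[symmetric] using r t by (simp add: field_simps power2_eq_square)
    show ?case
    proof (cases "t < q * r")
      case True
      have tr: "t < r" using True q(2) mult_strict_right_mono[OF q(2) r] by simp
      have "kern s (x - (r / norm y)\<^sup>2 *\<^sub>R y) * (r / t) ^ (2 * CARD('n)) = kern s (x - y) * (r / t) powr (?N - 2 * s)"
      proof -
        have "norm (x - (r / norm y)\<^sup>2 *\<^sub>R y) = norm (x - y) * (r / t)"
          using norm_diff_inversion[OF elim, of x] by (simp add: r_def t_def)
        then have "kern s (x - (r / norm y)\<^sup>2 *\<^sub>R y) = kern s (x - y) / (r / t) powr (?N + 2 * s)"
          by (simp only: kern_def powr_mult divide_divide_eq_left)
        moreover have "(r / t) ^ (2 * CARD('n)) = (r / t) powr (2 * ?N)"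
          using r t by (subst powr_realpow[symmetric]) auto
        moreover have "(r / t) powr (2 * ?N) / (r / t) powr (?N + 2 * s) = (r / t) powr (?N - 2 * s)"
          by (subst powr_diff[symmetric]) simp
        moreover have "k / Q * P = k * (P / Q)" for k P Q :: real by simp
        ultimately show ?thesis by (simp only:)
      qed
      then have "(bubble s x - bubble s ((r / norm y)\<^sup>2 *\<^sub>R y)) * kern s (x - (r / norm y)\<^sup>2 *\<^sub>R y) * (r / t) ^ (2 * CARD('n))
         = ((bubble s x - bubble s ((norm x / norm y)\<^sup>2 *\<^sub>R y)) * (norm x / norm y) powr (?N - 2 * s)) * kern s (x - y)"
        by (simp add: r_def t_def mult_ac)
      also have "\<dots> = ((bubble s y - bubble s x) + excess ?m (norm x) (norm y)) * kern s (x - y)"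
        unfolding bubble_inversion_identity[OF x elim] ..
      finally have eq: "(bubble s x - bubble s ((r / norm y)\<^sup>2 *\<^sub>R y)) * kern s (x - (r / norm y)\<^sup>2 *\<^sub>R y) * (r / t) ^ (2 * CARD('n))
         = (bubble s y - bubble s x) * kern s (x - y) + excess ?m (norm x) (norm y) * kern s (x - y)"
        by (simp add: distrib_right)
      have "r \<le> r\<^sup>2 / t" using tr t r by (simp add: field_simps power2_eq_square)
      then have "bubble s x - bubble s ((r / norm y)\<^sup>2 *\<^sub>R y) \<ge> 0"
        using bubble_antimono[of s x "(r / norm y)\<^sup>2 *\<^sub>R y"] s nz by (simp add: r_def)
      then have "ennreal ((bubble s x - bubble s ((r / norm y)\<^sup>2 *\<^sub>R y)) * kern s (x - (r / norm y)\<^sup>2 *\<^sub>R y)) * ennreal ((r / norm y) ^ (2 * CARD('n)))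
        = ennreal ((bubble s y - bubble s x) * kern s (x - y) + excess ?m (norm x) (norm y) * kern s (x - y))"
        using r t eq by (subst ennreal_mult[symmetric]) (auto simp: t_def)
      also have "\<dots> = ennreal ((bubble s y - bubble s x) * kern s (x - y)) + ennreal (excess ?m (norm x) (norm y) * kern s (x - y))"
        using bubble_antimono[of s y x] s tr excess_nonneg[of ?m t r] t
        by (intro ennreal_plus mult_nonneg_nonneg) (auto simp: r_def t_def)
      finally show ?thesis using True iff by (simp add: r_def t_def)
    next
      case False
      then show ?thesis using iff by (simp add: r_def t_def)
    qed
  qed
  also have "\<dots> = bubble_inner s q x + bubble_excess s q x"
    unfolding bubble_inner_def bubble_excess_def by (rule nn_integral_add) auto
  finally show ?thesis .
qed

text \<open>Since |x - y| >= (1 - q) |x|, the kernel is bounded by a multiple of |x|^-(N+2s), and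
  what remains is the integral of the bubble over a ball of radius q |x|. The bound 1 for the bubble
  gives the rate near 0, the bound |y|^-(N-2s) the rate at infinity. The constant blows up as q
  tends to 1; only finiteness for fixed q is drawn from it.\<close>

lemma bubble_inner_bound:
  fixes s q :: real
  assumes s: "0 < s" "2 * s < real CARD('n)" and q: "0 < q" "q < 1"
  obtains C where "C \<ge> 0" "\<And>x::real^'n. x \<noteq> 0 \<Longrightarrow> bubble_inner s q x \<le> ennreal (C * norm x powr (- (2 * s)))"
     "\<And>x::real^'n. x \<noteq> 0 \<Longrightarrow> bubble_inner s q x \<le> ennreal (C * norm x powr (- real CARD('n)))"
proof -
  let ?N = "real CARD('n)"
  define A where "A = ?N - 2 * s"
  obtain C0 where C0: "C0 \<ge> 0" "\<And>r. r > 0 \<Longrightarrow>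
    (\<integral>\<^sup>+y. pow_in 0 r (y::real^'n) \<partial>lborel) = ennreal (C0 * r powr (?N - 0))"
    using nn_integral_norm_powr_ball[of "0", where 'a="real^'n"] by auto
  obtain C1 where C1: "C1 \<ge> 0" "\<And>r. r > 0 \<Longrightarrow>
    (\<integral>\<^sup>+y. pow_in A r (y::real^'n) \<partial>lborel) = ennreal (C1 * r powr (?N - A))"
    using nn_integral_norm_powr_ball[of A, where 'a="real^'n"] s by (auto simp: A_def)
  define c where "c = (1 - q) powr (- (?N + 2 * s))"
  have gen: "bubble_inner s q x \<le> ennreal (c * D * q powr (?N - a) * norm x powr (- (2 * s) - a))"
    if x: "x \<noteq> 0" and D: "D \<ge> 0" "\<And>r. r > 0 \<Longrightarrow>
      (\<integral>\<^sup>+y. pow_in a r (y::real^'n) \<partial>lborel) = ennreal (D * r powr (?N - a))"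
     and le: "\<And>y::real^'n. y \<noteq> 0 \<Longrightarrow> bubble s y \<le> norm y powr (- a)" for x :: "real^'n" and a D
  proof -
    define r where "r = norm x"
    have r: "r > 0" using x by (simp add: r_def)
    have "bubble_inner s q x \<le> (\<integral>\<^sup>+y. ennreal (c * r powr (- (?N + 2 * s))) * pow_in a (q * r) (y::real^'n) \<partial>lborel)"
      unfolding bubble_inner_def
    proof (rule nn_integral_mono_AE, use AE_lborel_singleton[of "0::real^'n"] in eventually_elim)
      case (elim y)
      have "(bubble s y - bubble s x) * kern s (x - y) \<le> c * r powr (- (?N + 2 * s)) * norm y powr (- a)" if *: "norm y < q * r"
      proof -
        have "(1 - q) * r \<le> norm (x - y)" using norm_triangle_ineq2[of x y] * by (simp add: r_def algebra_simps)
        then have "kern s (x - y) \<le> ((1 - q) * r) powr (- (?N + 2 * s))" using q r s by (intro kern_le) auto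
        also have "\<dots> = c * r powr (- (?N + 2 * s))" by (simp only: powr_mult c_def)
        finally have k: "kern s (x - y) \<le> c * r powr (- (?N + 2 * s))" .
        have "bubble s y - bubble s x \<le> norm y powr (- a)" using le[OF elim] bubble_pos[of s x] by linarith
        then have "(bubble s y - bubble s x) * kern s (x - y) \<le> norm y powr (- a) * (c * r powr (- (?N + 2 * s)))"
          using k by (intro mult_mono) auto
        then show ?thesis by (simp add: mult_ac)
      qed
      then show ?case
        by (auto simp: r_def[symmetric] ennreal_mult[symmetric] c_def intro!: ennreal_leI)
    qed
    also have "\<dots> = ennreal (c * r powr (- (?N + 2 * s))) * ennreal (D * (q * r) powr (?N - a))"
      using q r by (subst nn_integral_cmult) (auto simp: D(2))
    also have "\<dots> = ennreal (c * D * q powr (?N - a) * (r powr (- (?N + 2 * s)) * r powr (?N - a)))"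
      using D(1) by (subst ennreal_mult[symmetric]) (auto simp: c_def powr_mult mult_ac)
    also have "r powr (- (?N + 2 * s)) * r powr (?N - a) = r powr (- (2 * s) - a)"
    proof -
      have "- (?N + 2 * s) + (?N - a) = - (2 * s) - a" by simp
      then show ?thesis by (simp only: powr_add[symmetric])
    qed
    finally show ?thesis by (simp add: r_def)
  qed
  define C where "C = max (c * C0 * q powr (?N - 0)) (c * C1 * q powr (?N - A))"
  show ?thesis
  proof (rule that[of C])
    show "C \<ge> 0" using C0 by (auto simp: C_def c_def le_max_iff_disj)
    fix x :: "real^'n" assume x: "x \<noteq> 0"
    have "bubble s y \<le> norm y powr (- 0)" if "y \<noteq> 0" for y :: "real^'n" using bubble_le_1[OF s(2)] that by simp
    from gen[OF x C0 this] have "bubble_inner s q x \<le> ennreal (c * C0 * q powr (?N - 0) * norm x powr (- (2 * s) - 0))" by simp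
    also have "\<dots> \<le> ennreal (C * norm x powr (- (2 * s) - 0))" by (intro ennreal_leI mult_right_mono) (auto simp: C_def)
    finally show "bubble_inner s q x \<le> ennreal (C * norm x powr (- (2 * s)))" by simp
    have "bubble s y \<le> norm y powr (- A)" if "y \<noteq> 0" for y :: "real^'n" using bubble_le_powr[OF s(2) that] by (simp add: A_def)
    from gen[OF x C1 this] have "bubble_inner s q x \<le> ennreal (c * C1 * q powr (?N - A) * norm x powr (- (2 * s) - A))" .
    also have "\<dots> \<le> ennreal (C * norm x powr (- (2 * s) - A))" by (intro ennreal_leI mult_right_mono) (auto simp: C_def)
    also have "- (2 * s) - A = - ?N" by (simp add: A_def)
    finally show "bubble_inner s q x \<le> ennreal (C * norm x powr (- ?N))" .
  qed
qed

text \<open>The rate |x|^-N at infinity narrowly fails to be integrable; the finite mass of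
  \<open>\<phi>\<close> has to compensate.\<close>

lemma bubble_inner_integrable:
  fixes \<phi> :: "real ^ 'n \<Rightarrow> real"
  assumes s: "0 < s" "2 * s < real CARD('n)" and q: "0 < q" "q < 1"
    and [measurable]: "\<phi> \<in> borel_measurable borel" and \<phi>: "\<And>x. 0 \<le> \<phi> x" "\<And>x. \<phi> x \<le> 1"
    and mass: "Lp_mass (crit_exp CARD('n) s) \<phi> < \<infinity>"
  shows "(\<integral>\<^sup>+x. ennreal (\<phi> x) * bubble_inner s q x \<partial>lborel) < \<infinity>"
proof -
  let ?N = "real CARD('n)"
  define p where "p = crit_exp CARD('n) s"
  have p: "p > 1" using s by (simp add: p_def crit_exp_def field_simps)
  \<comment> \<open>Chosen so that \<open>\<phi>\<close> <= |x|^-d is equivalent to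
    \<open>\<phi>\<close>^(p-1) <= |x|^-N: the product \<open>\<phi>\<close> |x|^-N is then at most
    \<open>\<phi>\<close>^p or at most |x|^-(N+d).\<close>
  define d where "d = ?N / (p - 1)"
  have d: "d > 0" using p s by (simp add: d_def)
  obtain C where C: "C \<ge> 0" "\<And>x::real^'n. x \<noteq> 0 \<Longrightarrow> bubble_inner s q x \<le> ennreal (C * norm x powr (- (2 * s)))"
     "\<And>x::real^'n. x \<noteq> 0 \<Longrightarrow> bubble_inner s q x \<le> ennreal (C * norm x powr (- ?N))"
    using bubble_inner_bound[OF s q] by blast
  obtain C1 where C1: "C1 \<ge> 0" "\<And>r. r > 0 \<Longrightarrow>
    (\<integral>\<^sup>+y. pow_in (2 * s) r (y::real^'n) \<partial>lborel) = ennreal (C1 * r powr (?N - 2 * s))"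
    using nn_integral_norm_powr_ball[of "2 * s", where 'a="real^'n"] s by auto
  obtain C2 where C2: "C2 \<ge> 0" "\<And>r. r > 0 \<Longrightarrow>
    (\<integral>\<^sup>+y. pow_out (?N + d) r (y::real^'n) \<partial>lborel) = ennreal (C2 * r powr (?N - (?N + d)))"
    using nn_integral_norm_powr_outside[of "?N + d", where 'a="real^'n"] d by auto
  have "(\<integral>\<^sup>+x. ennreal (\<phi> x) * bubble_inner s q x \<partial>lborel) \<le>
     (\<integral>\<^sup>+y. ennreal C * (pow_in (2 * s) 2 (y::real^'n) +
       pow_out (?N + d) 1 (y::real^'n) + ennreal (\<bar>\<phi> y\<bar> powr p)) \<partial>lborel)"
  proof (rule nn_integral_mono_AE, use AE_lborel_singleton[of "0::real^'n"] in eventually_elim)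
    case (elim y)
    define r where "r = norm y"
    have r: "r > 0" using elim by (simp add: r_def)
    show ?case
    proof (cases "r < 2")
      case True
      have "ennreal (\<phi> y) * bubble_inner s q y \<le> 1 * ennreal (C * r powr (- (2 * s)))"
        using C(2)[OF elim] \<phi>[of y] by (intro mult_mono) (auto simp: r_def)
      also have "\<dots> = ennreal C * ennreal (r powr (- (2 * s)))" using C(1) by (simp add: ennreal_mult)
      also have "\<dots> \<le> ennreal C * (pow_in (2 * s) 2 y +
       pow_out (?N + d) 1 y + ennreal (\<bar>\<phi> y\<bar> powr p))"
        using True by (intro mult_left_mono) (auto simp: r_def add_increasing2)
      finally show ?thesis .
    next
      case False
      have key: "\<phi> y * r powr (- ?N) \<le> r powr (- (?N + d)) + \<phi> y powr p"
      proof (cases "r powr (- ?N) \<le> \<phi> y powr (p - 1)")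
        case True
        have "\<phi> y * r powr (- ?N) \<le> \<phi> y * \<phi> y powr (p - 1)" using True \<phi> by (intro mult_left_mono) auto
        also have "\<dots> = \<phi> y powr p" using powr_mult_base[of "\<phi> y" "p - 1"] \<phi>[of y] by simp
        finally show ?thesis by (simp add: add_increasing)
      next
        case False
        have "\<phi> y \<le> r powr (- d)"
        proof (rule ccontr)
          assume "\<not> \<phi> y \<le> r powr (- d)"
          then have "(r powr (- d)) powr (p - 1) \<le> \<phi> y powr (p - 1)" using p by (intro powr_mono2) auto
          moreover have "- d * (p - 1) = - ?N" using p by (simp add: d_def)
          ultimately show False using False by (simp only: powr_powr)
        qed
        then have "\<phi> y * r powr (- ?N) \<le> r powr (- d) * r powr (- ?N)" by (intro mult_right_mono) auto
        also have "\<dots> = r powr (- (?N + d))"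
        proof -
          have "- d + - ?N = - (?N + d)" by simp
          then show ?thesis by (simp only: powr_add[symmetric])
        qed
        finally show ?thesis by (simp add: add_increasing2)
      qed
      have "ennreal (\<phi> y) * bubble_inner s q y \<le> ennreal (\<phi> y) * ennreal (C * r powr (- ?N))"
        using C(3)[OF elim] by (intro mult_left_mono) (auto simp: r_def)
      also have "\<dots> = ennreal (C * (\<phi> y * r powr (- ?N)))" using C(1) \<phi>[of y] by (simp add: ennreal_mult[symmetric] mult_ac)
      also have "\<dots> \<le> ennreal (C * (r powr (- (?N + d)) + \<phi> y powr p))" using key C(1) by (intro ennreal_leI mult_left_mono) auto
      also have "\<dots> = ennreal C * (ennreal (r powr (- (?N + d))) + ennreal (\<bar>\<phi> y\<bar> powr p))"
        using C(1) \<phi>[of y] by (simp only: ennreal_mult ennreal_plus powr_ge_zero add_nonneg_nonneg abs_of_nonneg)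
      also have "\<dots> \<le> ennreal C * (pow_in (2 * s) 2 y +
       pow_out (?N + d) 1 y + ennreal (\<bar>\<phi> y\<bar> powr p))"
        using False by (intro mult_left_mono add_mono) (auto simp: r_def)
      finally show ?thesis .
    qed
  qed
  also have "\<dots> = ennreal C * ((\<integral>\<^sup>+y. pow_in (2 * s) 2 (y::real^'n) \<partial>lborel) +
     (\<integral>\<^sup>+y. pow_out (?N + d) 1 (y::real^'n) \<partial>lborel) + (\<integral>\<^sup>+y. ennreal (\<bar>\<phi> y\<bar> powr p) \<partial>lborel))"
    by (subst nn_integral_cmult) (auto simp: nn_integral_add)
  also have "\<dots> = ennreal C * (ennreal (C1 * 2 powr (?N - 2 * s)) + ennreal (C2 * 1 powr (?N - (?N + d))) + Lp_mass p \<phi>)"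
    by (subst C1(2), simp, subst C2(2), simp) (simp add: Lp_mass_def)
  also have "\<dots> < \<infinity>" using mass by (simp add: ennreal_mult_less_top p_def)
  finally show ?thesis .
qed

lemma lborel_pair_iterated:
  fixes f :: "'a::euclidean_space \<times> 'b::euclidean_space \<Rightarrow> ennreal"
  assumes "f \<in> borel_measurable (lborel \<Otimes>\<^sub>M lborel)"
  shows "(\<integral>\<^sup>+z. f z \<partial>(lborel \<Otimes>\<^sub>M lborel)) = (\<integral>\<^sup>+x. \<integral>\<^sup>+y. f (x, y) \<partial>lborel \<partial>lborel)"
    and "(\<integral>\<^sup>+z. f z \<partial>(lborel \<Otimes>\<^sub>M lborel)) = (\<integral>\<^sup>+y. \<integral>\<^sup>+x. f (x, y) \<partial>lborel \<partial>lborel)"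
  using lborel.nn_integral_fst[OF assms] lborel_pair.nn_integral_snd[OF assms] by auto

text \<open>Truncating at \<open>|y| < q |x|\<close> instead of \<open>|x - y| > \<epsilon>\<close> respects the inversion in the sphere through \<open>x\<close>,
  so that the truncated integrals converge without principal values.\<close>

definition nearer :: "real \<Rightarrow> (real ^ 'n) \<times> (real ^ 'n) \<Rightarrow> bool" where
  "nearer q z \<longleftrightarrow> norm (snd z) < q * norm (fst z)"

lemma nearer_measurable[measurable]: "Measurable.pred (lborel \<Otimes>\<^sub>M lborel) (nearer q)"
  unfolding nearer_def[abs_def] by measurable

text \<open>\<open>bubble_outer_eq\<close> integrated against \<open>\<phi>\<close>, where Tonelli's
  theorem exchanges the variables in the outer half. The common term stays on the right, since it
  may be subtracted only once it is known to be finite.\<close>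

lemma truncated_identity:
  fixes \<phi> :: "real ^ 'n \<Rightarrow> real"
  assumes s: "0 < s" "2 * s < real CARD('n)" and q: "0 < q" "q < 1"
    and [measurable]: "\<phi> \<in> borel_measurable borel" and \<phi>: "\<And>x. 0 \<le> \<phi> x"
  shows "(\<integral>\<^sup>+z. (if nearer q z then ennreal (\<phi> (snd z) * (bubble s (snd z) - bubble s (fst z)) * kern s (fst z - snd z)) else 0) \<partial>(lborel \<Otimes>\<^sub>M lborel)) =
     (\<integral>\<^sup>+z. (if nearer q z then ennreal (\<phi> (fst z) * (bubble s (snd z) - bubble s (fst z)) * kern s (fst z - snd z)) else 0) \<partial>(lborel \<Otimes>\<^sub>M lborel))
     + (\<integral>\<^sup>+x. ennreal (\<phi> x) * bubble_excess s q x \<partial>lborel)" (is "?L = ?R + _")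
    and "(\<integral>\<^sup>+z. (if nearer q z then ennreal (\<phi> (fst z) * (bubble s (snd z) - bubble s (fst z)) * kern s (fst z - snd z)) else 0) \<partial>(lborel \<Otimes>\<^sub>M lborel))
     = (\<integral>\<^sup>+x. ennreal (\<phi> x) * bubble_inner s q x \<partial>lborel)"
proof -
  have "?L = (\<integral>\<^sup>+y. \<integral>\<^sup>+x. (if nearer q (x, y) then ennreal (\<phi> y * (bubble s y - bubble s x) * kern s (x - y)) else 0) \<partial>lborel \<partial>lborel)"
    by (subst lborel_pair_iterated(2)) (measurable, simp only: fst_conv snd_conv)
  also have "\<dots> = (\<integral>\<^sup>+y. ennreal (\<phi> y) * bubble_outer s q y \<partial>lborel)"
    unfolding bubble_outer_def
    by (subst nn_integral_cmult[symmetric])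
       (auto intro!: nn_integral_cong simp: nearer_def ennreal_mult'[OF \<phi>, symmetric] kern_minus mult_ac)
  also have "\<dots> = (\<integral>\<^sup>+y. ennreal (\<phi> y) * bubble_inner s q y + ennreal (\<phi> y) * bubble_excess s q y \<partial>lborel)"
    by (rule nn_integral_cong_AE, use AE_lborel_singleton[of "0::real^'n"] in eventually_elim)
       (simp add: bubble_outer_eq[OF s q] distrib_left)
  also have "\<dots> = (\<integral>\<^sup>+y. ennreal (\<phi> y) * bubble_inner s q y \<partial>lborel) + (\<integral>\<^sup>+y. ennreal (\<phi> y) * bubble_excess s q y \<partial>lborel)"
    by (rule nn_integral_add) auto
  finally have L: "?L = \<dots>" .
  have "?R = (\<integral>\<^sup>+x. \<integral>\<^sup>+y. (if nearer q (x, y) then ennreal (\<phi> x * (bubble s y - bubble s x) * kern s (x - y)) else 0) \<partial>lborel \<partial>lborel)"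
    by (subst lborel_pair_iterated(1)) (measurable, simp only: fst_conv snd_conv)
  also have "\<dots> = (\<integral>\<^sup>+x. ennreal (\<phi> x) * bubble_inner s q x \<partial>lborel)"
    unfolding bubble_inner_def
    by (subst nn_integral_cmult[symmetric])
       (auto intro!: nn_integral_cong simp: nearer_def ennreal_mult'[OF \<phi>, symmetric] mult_ac)
  finally show R: "?R = \<dots>" .
  show "?L = ?R + (\<integral>\<^sup>+x. ennreal (\<phi> x) * bubble_excess s q x \<partial>lborel)" unfolding L R ..
qed

definition qseq :: "nat \<Rightarrow> real" where "qseq n = 1 - 1 / (real n + 2)"

lemma qseq: "0 < qseq n" "qseq n < 1" "incseq qseq" "qseq \<longlonglongrightarrow> 1"
proof -
  show "0 < qseq n" "qseq n < 1" by (auto simp: qseq_def field_simps)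
  show "incseq qseq" by (auto simp: qseq_def incseq_def field_simps)
  have "(\<lambda>n. 1 / (real n + 2)) \<longlonglongrightarrow> 0" by real_asymp
  from tendsto_diff[OF tendsto_const[of 1] this] show "qseq \<longlonglongrightarrow> 1" unfolding qseq_def by simp
qed

lemma nearer_qseq_mono: "m \<le> n \<Longrightarrow> nearer (qseq m) z \<Longrightarrow> nearer (qseq n) z"
  using mult_right_mono[OF incseqD[OF qseq(3), of m n] norm_ge_zero[of "fst z"]] unfolding nearer_def by linarith

lemma nearer_qseq_le: "nearer (qseq n) z \<Longrightarrow> nearer 1 z"
  using mult_right_mono[OF less_imp_le[OF qseq(2), of n] norm_ge_zero[of "fst z"]] unfolding nearer_def by linarith

lemma nearer_qseq_eventually:
  assumes "nearer 1 z"
  shows "eventually (\<lambda>n. nearer (qseq n) z) sequentially"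
proof -
  have "(\<lambda>n. qseq n * norm (fst z)) \<longlonglongrightarrow> 1 * norm (fst z)" by (intro tendsto_intros qseq)
  then show ?thesis using assms unfolding nearer_def by (intro order_tendstoD) auto
qed

lemma tendsto_nearer_qseq: "(\<lambda>n. if nearer (qseq n) z then c else 0) \<longlonglongrightarrow> (if nearer 1 z then c else (0::'a::{zero,topological_space}))"
proof (cases "nearer 1 z")
  case True
  have "eventually (\<lambda>n. (if nearer (qseq n) z then c else 0) = c) sequentially"
    using nearer_qseq_eventually[OF True] by (rule eventually_mono) simp
  then show ?thesis using True by (simp only: if_True tendsto_eventually)
next
  case False
  then have "\<not> nearer (qseq n) z" for n using nearer_qseq_le by blast
  then show ?thesis using False by simp
qed

lemma nn_integral_pair_swap:
  fixes f :: "'a::euclidean_space \<times> 'a \<Rightarrow> ennreal"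
  assumes "f \<in> borel_measurable (lborel \<Otimes>\<^sub>M lborel)"
  shows "(\<integral>\<^sup>+z. f (snd z, fst z) \<partial>(lborel \<Otimes>\<^sub>M lborel)) = (\<integral>\<^sup>+z. f z \<partial>(lborel \<Otimes>\<^sub>M lborel))"
proof -
  have [measurable]: "f \<in> borel_measurable (borel \<Otimes>\<^sub>M borel)"
    using assms by (simp cong: measurable_cong_sets sets_pair_measure_cong)
  show ?thesis
    by (subst lborel_pair_iterated(1)) (auto simp: lborel_pair_iterated(2)[OF assms])
qed

text \<open>The truncated balance tested with the bubble w itself: w(y) (w(y) - w(x)) - w(x) (w(y) -
  w(x)) is a square, so the truncated energy equals the integral of w against the truncated excess,
  which for every q is at most the integral of \<open>frac_bubble\<close>. Monotone convergence and
  symmetry give the whole energy; points with |x| = |y| contribute nothing as w is radial.\<close>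

lemma energy_bubble_finite:
  assumes s: "0 < s" "s < 1" "2 * s < real CARD('n)"
    and mass: "Lp_mass (crit_exp CARD('n) s) (bubble s :: real^'n \<Rightarrow> real) < \<infinity>"
  shows "energy s (bubble s :: real^'n \<Rightarrow> real) < \<infinity>"
proof -
  let ?M = "lborel \<Otimes>\<^sub>M lborel :: ((real ^ 'n) \<times> (real ^ 'n)) measure"
  let ?w = "bubble s :: real^'n \<Rightarrow> real"
  define E where "E = (\<lambda>z. (?w (fst z) - ?w (snd z))\<^sup>2 * kern s (fst z - snd z))"
  have [measurable]: "E \<in> borel_measurable ?M" unfolding E_def by measurable
  have E0: "0 \<le> E z" for z by (simp add: E_def)
  let ?h = "\<integral>\<^sup>+x. frac_bubble s (x::real^'n) \<partial>lborel"
  have trunc: "(\<integral>\<^sup>+z. (if nearer (qseq n) z then ennreal (E z) else 0) \<partial>?M) \<le> ?h" for n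
  proof -
    let ?q = "qseq n"
    let ?Y = "\<integral>\<^sup>+z. (if nearer ?q z then ennreal (?w (fst z) * (?w (snd z) - ?w (fst z)) * kern s (fst z - snd z)) else 0) \<partial>?M"
    have id: "(\<integral>\<^sup>+z. (if nearer ?q z then ennreal (?w (snd z) * (?w (snd z) - ?w (fst z)) * kern s (fst z - snd z)) else 0) \<partial>?M) =
      ?Y + (\<integral>\<^sup>+x. ennreal (?w x) * bubble_excess s ?q x \<partial>lborel)"
      using s qseq(1,2) by (intro truncated_identity(1)) (auto simp: less_imp_le bubble_pos)
    have "?Y = (\<integral>\<^sup>+x. ennreal (?w x) * bubble_inner s ?q x \<partial>lborel)"
      using s qseq(1,2) by (intro truncated_identity(2)) (auto simp: less_imp_le bubble_pos)
    also have "\<dots> < \<infinity>"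
      using s qseq(1,2) mass by (intro bubble_inner_integrable) (auto simp: less_imp_le bubble_pos bubble_le_1)
    finally have Y: "?Y < \<infinity>" .
    have "(\<integral>\<^sup>+z. (if nearer ?q z then ennreal (E z) else 0) \<partial>?M) + ?Y =
       (\<integral>\<^sup>+z. (if nearer ?q z then ennreal (E z) else 0) + (if nearer ?q z then ennreal (?w (fst z) * (?w (snd z) - ?w (fst z)) * kern s (fst z - snd z)) else 0) \<partial>?M)"
      by (rule nn_integral_add[symmetric]) auto
    also have "\<dots> = (\<integral>\<^sup>+z. (if nearer ?q z then ennreal (?w (snd z) * (?w (snd z) - ?w (fst z)) * kern s (fst z - snd z)) else 0) \<partial>?M)"
    proof (rule nn_integral_cong)
      fix z
      show "(if nearer ?q z then ennreal (E z) else 0) + (if nearer ?q z then ennreal (?w (fst z) * (?w (snd z) - ?w (fst z)) * kern s (fst z - snd z)) else 0)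
        = (if nearer ?q z then ennreal (?w (snd z) * (?w (snd z) - ?w (fst z)) * kern s (fst z - snd z)) else 0)"
      proof (cases "nearer ?q z")
        case True
        then have "norm (snd z) \<le> norm (fst z)" using nearer_qseq_le[OF True] by (simp add: nearer_def)
        then have "?w (fst z) \<le> ?w (snd z)" using s by (intro bubble_antimono) auto
        then have "0 \<le> ?w (fst z) * (?w (snd z) - ?w (fst z)) * kern s (fst z - snd z)" by (auto simp: less_imp_le bubble_pos)
        from ennreal_plus[OF E0[of z] this]
        have "ennreal (E z) + ennreal (?w (fst z) * (?w (snd z) - ?w (fst z)) * kern s (fst z - snd z)) =
          ennreal (E z + ?w (fst z) * (?w (snd z) - ?w (fst z)) * kern s (fst z - snd z))" by (rule sym)
        also have "E z + ?w (fst z) * (?w (snd z) - ?w (fst z)) * kern s (fst z - snd z) =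
            ?w (snd z) * (?w (snd z) - ?w (fst z)) * kern s (fst z - snd z)"
          by (simp add: E_def power2_eq_square algebra_simps)
        finally show ?thesis using True by (simp only: if_True)
      qed simp
    qed
    also have "\<dots> = (\<integral>\<^sup>+x. ennreal (?w x) * bubble_excess s ?q x \<partial>lborel) + ?Y" unfolding id by (rule add.commute)
    finally have "?Y = \<infinity> \<or> (\<integral>\<^sup>+z. (if nearer ?q z then ennreal (E z) else 0) \<partial>?M) = (\<integral>\<^sup>+x. ennreal (?w x) * bubble_excess s ?q x \<partial>lborel)"
      by (simp only: add.commute[of _ ?Y] ennreal_add_left_cancel)
    moreover have "?Y \<noteq> \<infinity>" using Y by (rule less_imp_neq)
    ultimately have "(\<integral>\<^sup>+z. (if nearer ?q z then ennreal (E z) else 0) \<partial>?M) = (\<integral>\<^sup>+x. ennreal (?w x) * bubble_excess s ?q x \<partial>lborel)"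
      by blast
    also have "\<dots> \<le> (\<integral>\<^sup>+x. 1 * frac_bubble s (x::real^'n) \<partial>lborel)"
      using s bubble_le_1[of s] bubble_excess_le[of ?q s] qseq(2)[of n]
      by (intro nn_integral_mono mult_mono) (auto simp: less_imp_le)
    finally show ?thesis by simp
  qed
  have "(\<lambda>n. \<integral>\<^sup>+z. (if nearer (qseq n) z then ennreal (E z) else 0) \<partial>?M) \<longlonglongrightarrow> (\<integral>\<^sup>+z. (if nearer 1 z then ennreal (E z) else 0) \<partial>?M)"
    by (rule nn_integral_LIMSEQ[OF _ _ tendsto_nearer_qseq]) (auto simp: incseq_def le_fun_def intro: nearer_qseq_mono)
  then have half: "(\<integral>\<^sup>+z. (if nearer 1 z then ennreal (E z) else 0) \<partial>?M) \<le> ?h"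
    by (rule LIMSEQ_le_const2) (use trunc in auto)
  have "energy s ?w = (\<integral>\<^sup>+z. ennreal (E z) \<partial>?M)"
    by (subst energy_pair) (auto intro!: nn_integral_cong simp: E_def kern_def split: prod.split)
  also have "\<dots> \<le> (\<integral>\<^sup>+z. (if nearer 1 z then ennreal (E z) else 0) + (if nearer 1 (snd z, fst z) then ennreal (E (snd z, fst z)) else 0) \<partial>?M)"
  proof (intro nn_integral_mono)
    fix z
    have sym: "E (snd z, fst z) = E z" by (simp add: E_def kern_minus[of s "snd z"] power2_commute)
    have "E z = 0" if "norm (fst z) = norm (snd z)" using that by (simp add: E_def bubble_def)
    then show "ennreal (E z) \<le> (if nearer 1 z then ennreal (E z) else 0) + (if nearer 1 (snd z, fst z) then ennreal (E (snd z, fst z)) else 0)"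
      unfolding sym by (cases "norm (fst z)" "norm (snd z)" rule: linorder_cases) (auto simp: nearer_def)
  qed
  also have "\<dots> = (\<integral>\<^sup>+z. (if nearer 1 z then ennreal (E z) else 0) \<partial>?M) + (\<integral>\<^sup>+z. (if nearer 1 (snd z, fst z) then ennreal (E (snd z, fst z)) else 0) \<partial>?M)"
    by (rule nn_integral_add) auto
  also have "(\<integral>\<^sup>+z. (if nearer 1 (snd z, fst z) then ennreal (E (snd z, fst z)) else 0) \<partial>?M) = (\<integral>\<^sup>+z. (if nearer 1 z then ennreal (E z) else 0) \<partial>?M)"
    by (rule nn_integral_pair_swap[of "\<lambda>z. if nearer 1 z then ennreal (E z) else 0"]) measurable
  also have "(\<integral>\<^sup>+z. (if nearer 1 z then ennreal (E z) else 0) \<partial>?M) + (\<integral>\<^sup>+z. (if nearer 1 z then ennreal (E z) else 0) \<partial>?M) \<le> ?h + ?h"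
    by (intro add_mono half)
  also have "\<dots> < \<infinity>" using frac_bubble_integral_finite[OF s] by simp
  finally show ?thesis .
qed

lemma bubble_mass_finite:
  assumes s: "0 < s" "2 * s < real CARD('n)"
  shows "Lp_mass (crit_exp CARD('n) s) (bubble s :: real^'n \<Rightarrow> real) < \<infinity>"
proof -
  let ?N = "real CARD('n)" and ?p = "crit_exp CARD('n) s"
  have p: "?p > 0" using s by (rule crit_exp_pos)
  have Ap: "(?N - 2 * s) * ?p = 2 * ?N" using s by (simp add: crit_exp_def)
  obtain C1 where C1: "C1 \<ge> 0" "\<And>r. r > 0 \<Longrightarrow>
    (\<integral>\<^sup>+y. pow_in 0 r (y::real^'n) \<partial>lborel) = ennreal (C1 * r powr (?N - 0))"
    using nn_integral_norm_powr_ball[of "0", where 'a="real^'n"] s by auto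
  obtain C2 where C2: "C2 \<ge> 0" "\<And>r. r > 0 \<Longrightarrow>
    (\<integral>\<^sup>+y. pow_out (2 * ?N) r (y::real^'n) \<partial>lborel) = ennreal (C2 * r powr (?N - 2 * ?N))"
    using nn_integral_norm_powr_outside[of "2 * ?N", where 'a="real^'n"] by auto
  have "Lp_mass ?p (bubble s :: real^'n \<Rightarrow> real) \<le>
     (\<integral>\<^sup>+y. pow_in 0 2 (y::real^'n) + pow_out (2 * ?N) 1 (y::real^'n) \<partial>lborel)"
    unfolding Lp_mass_def
  proof (rule nn_integral_mono_AE, use AE_lborel_singleton[of "0::real^'n"] in eventually_elim)
    case (elim y)
    show ?case
    proof (cases "norm y < 2")
      case True
      have "bubble s y powr ?p \<le> 1 powr ?p" using bubble_le_1[OF s(2)] p bubble_pos[of s y] by (intro powr_mono2) auto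
      then show ?thesis using True elim bubble_pos[of s y] by (auto simp: add_increasing2)
    next
      case False
      have "bubble s y powr ?p \<le> (norm y powr (- (?N - 2 * s))) powr ?p"
        using bubble_le_powr[OF s(2) elim] p bubble_pos[of s y] by (intro powr_mono2) auto
      also have "\<dots> = norm y powr (- (2 * ?N))" by (simp only: powr_powr mult_minus_left Ap)
      finally show ?thesis using False bubble_pos[of s y] by (auto intro!: ennreal_leI)
    qed
  qed
  also have "\<dots> = (\<integral>\<^sup>+y. pow_in 0 2 (y::real^'n) \<partial>lborel) +
      (\<integral>\<^sup>+y. pow_out (2 * ?N) 1 (y::real^'n) \<partial>lborel)"
    by (rule nn_integral_add) auto
  also have "\<dots> = ennreal (C1 * 2 powr (?N - 0)) + ennreal (C2 * 1 powr (?N - 2 * ?N))"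
    by (subst C1(2), simp, subst C2(2), simp) simp
  also have "\<dots> < \<infinity>" by simp
  finally show ?thesis .
qed

text \<open>Integration by parts: the form of \<open>\<phi>\<close> and the bubble is the integral
  of \<open>\<phi>\<close> against the fractional Laplacian of the bubble. After truncation,
  \<open>D\<close> is the difference of the two integrands in \<open>truncated_identity\<close>. The
  limit q -> 1 is taken by dominated convergence on the side of \<open>D\<close>, where both
  energies are finite, and by monotone convergence on the other. The factor 2 counts the regions |y|
  < |x| and |x| < |y|.\<close>

lemma bubble_pairing:
  fixes \<phi> :: "real ^ 'n \<Rightarrow> real"
  assumes s: "0 < s" "s < 1" "2 * s < real CARD('n)"
    and [measurable]: "\<phi> \<in> borel_measurable borel" and \<phi>: "\<And>x. 0 \<le> \<phi> x" "\<And>x. \<phi> x \<le> 1"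
    and mass: "Lp_mass (crit_exp CARD('n) s) \<phi> < \<infinity>" and en: "energy s \<phi> < \<infinity>"
  defines "D \<equiv> (\<lambda>(x, y). (\<phi> x - \<phi> y) * (bubble s x - bubble s y) * kern s (x - y))"
  shows "integrable (lborel \<Otimes>\<^sub>M lborel) D"
    and "integral\<^sup>L (lborel \<Otimes>\<^sub>M lborel) D = 2 * enn2real (\<integral>\<^sup>+x. ennreal (\<phi> x) * frac_bubble s x \<partial>lborel)"
proof -
  let ?M = "lborel \<Otimes>\<^sub>M lborel :: ((real ^ 'n) \<times> (real ^ 'n)) measure"
  let ?w = "bubble s :: real^'n \<Rightarrow> real"
  have [measurable]: "D \<in> borel_measurable ?M" unfolding D_def by measurable
  have enw: "energy s ?w < \<infinity>" by (intro energy_bubble_finite bubble_mass_finite s)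
  let ?d = "\<lambda>u (x, y). ennreal (\<bar>u x - u y\<bar>\<^sup>2 / norm (x - y) powr (real CARD('n) + 2 * s))"
  have "(\<integral>\<^sup>+z. ennreal (norm (D z)) \<partial>?M) \<le> (\<integral>\<^sup>+z. ?d \<phi> z + ?d ?w z \<partial>?M)"
  proof (intro nn_integral_mono)
    fix z :: "(real ^ 'n) \<times> (real ^ 'n)"
    obtain x y where z: "z = (x, y)" by (cases z)
    have ab: "\<bar>a * b\<bar> \<le> \<bar>a\<bar>\<^sup>2 + \<bar>b\<bar>\<^sup>2" for a b :: real
      using sum_squares_bound[of "\<bar>a\<bar>" "\<bar>b\<bar>"] mult_nonneg_nonneg[OF abs_ge_zero abs_ge_zero, of a b] unfolding abs_mult by linarith
    have "norm (D z) = \<bar>(\<phi> x - \<phi> y) * (?w x - ?w y)\<bar> * kern s (x - y)" by (simp add: D_def z abs_mult)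
    also have "\<dots> \<le> (\<bar>\<phi> x - \<phi> y\<bar>\<^sup>2 + \<bar>?w x - ?w y\<bar>\<^sup>2) * kern s (x - y)" by (intro mult_right_mono ab) simp
    also have "\<dots> = \<bar>\<phi> x - \<phi> y\<bar>\<^sup>2 / norm (x - y) powr (real CARD('n) + 2 * s) + \<bar>?w x - ?w y\<bar>\<^sup>2 / norm (x - y) powr (real CARD('n) + 2 * s)"
      by (simp add: kern_def add_divide_distrib)
    finally show "ennreal (norm (D z)) \<le> ?d \<phi> z + ?d ?w z"
      by (simp add: z ennreal_plus[symmetric] ennreal_leI del: ennreal_plus)
  qed
  also have "\<dots> = energy s \<phi> + energy s ?w"
    by (subst nn_integral_add) (auto simp: energy_pair)
  also have "\<dots> < \<infinity>" using en enw by simp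
  finally show int: "integrable ?M D" by (intro integrableI_bounded) auto
  define F where "F = (\<lambda>q z. if nearer q z then D z else 0)"
  define G1 where "G1 = (\<lambda>q z. if nearer q z then \<phi> (snd z) * (?w (snd z) - ?w (fst z)) * kern s (fst z - snd z) else 0)"
  define G2 where "G2 = (\<lambda>q z. if nearer q z then \<phi> (fst z) * (?w (snd z) - ?w (fst z)) * kern s (fst z - snd z) else 0)"
  have [measurable]: "F q \<in> borel_measurable ?M" "G1 q \<in> borel_measurable ?M" "G2 q \<in> borel_measurable ?M" for q
    unfolding F_def G1_def G2_def by measurable
  have h: "(\<integral>\<^sup>+x. frac_bubble s (x::real^'n) \<partial>lborel) < \<infinity>" by (rule frac_bubble_integral_finite[OF s])
  have trunc: "integral\<^sup>L ?M (F (qseq n)) = enn2real (\<integral>\<^sup>+x. ennreal (\<phi> x) * bubble_excess s (qseq n) x \<partial>lborel)" for n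
  proof -
    let ?q = "qseq n"
    have sgn: "0 \<le> G1 ?q z" "0 \<le> G2 ?q z" for z
    proof -
      have "?w (fst z) \<le> ?w (snd z)" if "nearer ?q z"
        using nearer_qseq_le[OF that] s by (intro bubble_antimono) (auto simp: nearer_def)
      then show "0 \<le> G1 ?q z" "0 \<le> G2 ?q z" using \<phi> by (auto simp: G1_def G2_def)
    qed
    have if_enn: "ennreal (if P then a else 0) = (if P then ennreal a else 0)" for P a by simp
    have G2: "(\<integral>\<^sup>+z. ennreal (G2 ?q z) \<partial>?M) = (\<integral>\<^sup>+x. ennreal (\<phi> x) * bubble_inner s ?q x \<partial>lborel)"
      unfolding G2_def if_enn using s qseq \<phi> by (intro truncated_identity(2)) auto
    have G1: "(\<integral>\<^sup>+z. ennreal (G1 ?q z) \<partial>?M) = (\<integral>\<^sup>+z. ennreal (G2 ?q z) \<partial>?M) + (\<integral>\<^sup>+x. ennreal (\<phi> x) * bubble_excess s ?q x \<partial>lborel)"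
      unfolding G1_def G2_def if_enn using s qseq \<phi> by (intro truncated_identity(1)) auto
    have f2: "(\<integral>\<^sup>+z. ennreal (G2 ?q z) \<partial>?M) < \<infinity>"
      unfolding G2 using s qseq \<phi> mass by (intro bubble_inner_integrable) auto
    have "(\<integral>\<^sup>+x. ennreal (\<phi> x) * bubble_excess s ?q x \<partial>lborel) \<le> (\<integral>\<^sup>+x. 1 * frac_bubble s (x::real^'n) \<partial>lborel)"
      using \<phi> bubble_excess_le[of ?q s] qseq(2)[of n] by (intro nn_integral_mono mult_mono) (auto simp: less_imp_le)
    then have f3: "(\<integral>\<^sup>+x. ennreal (\<phi> x) * bubble_excess s ?q x \<partial>lborel) < \<infinity>" using h by (simp add: order_le_less_trans)
    have f1: "(\<integral>\<^sup>+z. ennreal (G1 ?q z) \<partial>?M) < \<infinity>" unfolding G1 using f2 f3 by simp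
    have i1: "integrable ?M (G1 ?q)" "integrable ?M (G2 ?q)"
      using f1 f2 sgn by (auto intro!: integrableI_nonneg simp del: split_paired_All)
    have "F ?q z = G1 ?q z - G2 ?q z" for z
      by (simp add: F_def G1_def G2_def D_def split_beta algebra_simps)
    then have "integral\<^sup>L ?M (F ?q) = integral\<^sup>L ?M (\<lambda>z. G1 ?q z - G2 ?q z)"
      by (intro Bochner_Integration.integral_cong refl)
    also have "\<dots> = integral\<^sup>L ?M (G1 ?q) - integral\<^sup>L ?M (G2 ?q)"
      using i1 by (rule Bochner_Integration.integral_diff)
    also have "integral\<^sup>L ?M (G1 ?q) = enn2real (\<integral>\<^sup>+z. ennreal (G1 ?q z) \<partial>?M)" by (rule integral_eq_nn_integral) (auto simp: sgn)
    also have "integral\<^sup>L ?M (G2 ?q) = enn2real (\<integral>\<^sup>+z. ennreal (G2 ?q z) \<partial>?M)" by (rule integral_eq_nn_integral) (auto simp: sgn)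
    also have "enn2real (\<integral>\<^sup>+z. ennreal (G1 ?q z) \<partial>?M) = enn2real (\<integral>\<^sup>+z. ennreal (G2 ?q z) \<partial>?M) + enn2real (\<integral>\<^sup>+x. ennreal (\<phi> x) * bubble_excess s ?q x \<partial>lborel)"
      unfolding G1 using f2 f3 by (intro enn2real_plus) auto
    finally show ?thesis by simp
  qed
  have "(\<lambda>n. integral\<^sup>L ?M (F (qseq n))) \<longlonglongrightarrow> integral\<^sup>L ?M (F 1)"
  proof (rule integral_dominated_convergence[where w="\<lambda>z. norm (D z)"])
    show "AE z in ?M. (\<lambda>n. F (qseq n) z) \<longlonglongrightarrow> F 1 z" unfolding F_def by (intro AE_I2 tendsto_nearer_qseq)
  qed (use int in \<open>auto simp: F_def\<close>)
  moreover have "(\<lambda>n. enn2real (\<integral>\<^sup>+x. ennreal (\<phi> x) * bubble_excess s (qseq n) x \<partial>lborel)) \<longlonglongrightarrow>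
      enn2real (\<integral>\<^sup>+x. ennreal (\<phi> x) * frac_bubble s x \<partial>lborel)"
  proof -
    let ?m = "(real CARD('n) - 2 * s) / 2"
    have m: "?m > 0" using s by simp
    define X where "X = (\<lambda>z::(real^'n)\<times>(real^'n). ennreal (\<phi> (fst z)) * ennreal (excess ?m (norm (fst z)) (norm (snd z)) * kern s (fst z - snd z)))"
    have [measurable]: "X \<in> borel_measurable ?M" unfolding X_def by measurable
    have rew: "(\<integral>\<^sup>+x. ennreal (\<phi> x) * bubble_excess s q x \<partial>lborel) = (\<integral>\<^sup>+z. (if nearer q z then X z else 0) \<partial>?M)" for q
      unfolding bubble_excess_def
      by (subst lborel_pair_iterated(1), measurable, subst nn_integral_cmult[symmetric])
         (auto intro!: nn_integral_cong simp: nearer_def X_def)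
    have fb: "frac_bubble s x = bubble_excess s 1 x" for x :: "real^'n" by (simp add: frac_bubble_def bubble_excess_def)
    have "(\<integral>\<^sup>+x. ennreal (\<phi> x) * frac_bubble s x \<partial>lborel) \<le> (\<integral>\<^sup>+x. 1 * frac_bubble s (x::real^'n) \<partial>lborel)"
      using \<phi> by (intro nn_integral_mono mult_right_mono) auto
    then have fin: "(\<integral>\<^sup>+x. ennreal (\<phi> x) * frac_bubble s x \<partial>lborel) < \<infinity>" using h by (simp add: order_le_less_trans)
    have "(\<lambda>n. \<integral>\<^sup>+z. (if nearer (qseq n) z then X z else 0) \<partial>?M) \<longlonglongrightarrow> (\<integral>\<^sup>+z. (if nearer 1 z then X z else 0) \<partial>?M)"
      by (rule nn_integral_LIMSEQ[OF _ _ tendsto_nearer_qseq]) (auto simp: incseq_def le_fun_def intro: nearer_qseq_mono)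
    then have "(\<lambda>n. \<integral>\<^sup>+x. ennreal (\<phi> x) * bubble_excess s (qseq n) x \<partial>lborel) \<longlonglongrightarrow> ennreal (enn2real (\<integral>\<^sup>+x. ennreal (\<phi> x) * frac_bubble s x \<partial>lborel))"
      unfolding rew using fin unfolding fb rew by simp
    then show ?thesis by (rule tendsto_enn2real) simp
  qed
  ultimately have half: "integral\<^sup>L ?M (F 1) = enn2real (\<integral>\<^sup>+x. ennreal (\<phi> x) * frac_bubble s x \<partial>lborel)"
    unfolding trunc by (rule LIMSEQ_unique)
  have iF: "integrable ?M (F 1)"
    by (rule Bochner_Integration.integrable_bound[OF int]) (auto simp: F_def)
  have "D z = F 1 z + (case z of (x, y) \<Rightarrow> F 1 (y, x))" for z
  proof -
    obtain x y where z: "z = (x, y)" by (cases z)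
    have "D (y, x) = D (x, y)" by (simp add: D_def kern_minus[of s y x] algebra_simps)
    moreover have "D (x, y) = 0" if "norm x = norm y" using that by (simp add: D_def bubble_def)
    ultimately show ?thesis
      by (cases "norm x" "norm y" rule: linorder_cases) (auto simp: z F_def nearer_def)
  qed
  then have "integral\<^sup>L ?M D = integral\<^sup>L ?M (\<lambda>z. F 1 z + (case z of (x, y) \<Rightarrow> F 1 (y, x)))" by metis
  also have "\<dots> = integral\<^sup>L ?M (F 1) + integral\<^sup>L ?M (\<lambda>(x, y). F 1 (y, x))"
    by (rule Bochner_Integration.integral_add[OF iF lborel_pair.integrable_product_swap[OF iF]])
  also have "integral\<^sup>L ?M (\<lambda>(x, y). F 1 (y, x)) = integral\<^sup>L ?M (F 1)"
    by (rule lborel_pair.integral_product_swap) measurable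
  finally show "integral\<^sup>L ?M D = 2 * enn2real (\<integral>\<^sup>+x. ennreal (\<phi> x) * frac_bubble s x \<partial>lborel)"
    by (simp add: half)
qed

subsection \<open>The potential representation\<close>

lemma lebesgue_measurable_cong_AE:
  fixes f g :: "'a::euclidean_space \<Rightarrow> real"
  assumes g: "g \<in> borel_measurable lebesgue" and eq: "AE x in lebesgue. f x = g x"
  shows "f \<in> borel_measurable lebesgue"
proof (rule measurableI)
  fix A :: "real set" assume A: "A \<in> sets borel"
  show "f -` A \<inter> space lebesgue \<in> sets lebesgue"
  proof (rule completion.in_sets_AE)
    show "AE x in lebesgue. (x \<in> g -` A \<inter> space lebesgue) = (x \<in> f -` A \<inter> space lebesgue)"
      using eq by eventually_elim auto
  qed (use measurable_sets[OF g A] in auto)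
qed auto

lemma integral_lebesgue_cong_AE:
  fixes f g :: "'a::euclidean_space \<Rightarrow> real"
  assumes g: "g \<in> borel_measurable borel" and eq: "AE x in lborel. f x = g x"
  shows "integral\<^sup>L lebesgue f = integral\<^sup>L lborel g"
proof -
  have eq': "AE x in lebesgue. f x = g x" using eq by (rule AE_completion)
  have g': "g \<in> borel_measurable lebesgue" using g by (rule borel_measurable_lebesgueI)
  have "integral\<^sup>L lebesgue f = integral\<^sup>L lebesgue g"
    by (rule integral_cong_AE[OF lebesgue_measurable_cong_AE[OF g' eq'] g' eq'])
  also have "\<dots> = integral\<^sup>L lborel g" using g by (intro integral_completion) simp
  finally show ?thesis .
qed

lemma Hdot_form_borel:
  fixes u v \<phi> :: "real ^ 'n \<Rightarrow> real"
  assumes [measurable]: "v \<in> borel_measurable borel" "\<phi> \<in> borel_measurable borel"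
    and uv: "AE x in lborel. u x = v x"
  shows "Hdot_form s u \<phi> = frac_const CARD('n) s / 2 *
     (\<integral>y. \<integral>x. (v x - v y) * (\<phi> x - \<phi> y) * kern s (x - y) \<partial>lborel \<partial>lborel)"
proof -
  have "(\<integral>y. \<integral>x. (u x - u y) * (\<phi> x - \<phi> y) / norm (x - y) powr (real CARD('n) + 2 * s) \<partial>lebesgue \<partial>lebesgue) =
     (\<integral>y. \<integral>x. (v x - v y) * (\<phi> x - \<phi> y) * kern s (x - y) \<partial>lborel \<partial>lborel)"
  proof (rule integral_lebesgue_cong_AE, measurable, use uv in eventually_elim)
    fix y assume y: "u y = v y"
    show "(\<integral>x. (u x - u y) * (\<phi> x - \<phi> y) / norm (x - y) powr (real CARD('n) + 2 * s) \<partial>lebesgue) =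
        (\<integral>x. (v x - v y) * (\<phi> x - \<phi> y) * kern s (x - y) \<partial>lborel)"
    proof (rule integral_lebesgue_cong_AE, measurable, use uv in eventually_elim)
      fix x assume "u x = v x"
      with y show "(u x - u y) * (\<phi> x - \<phi> y) / norm (x - y) powr (real CARD('n) + 2 * s) =
        (v x - v y) * (\<phi> x - \<phi> y) * kern s (x - y)" by (simp add: kern_def)
    qed
  qed
  then show ?thesis by (simp add: Hdot_form_def)
qed

section \<open>Scaling of energy and form\<close>

lemma integral_lborel_affine:
  fixes f :: "'a::euclidean_space \<Rightarrow> real"
  assumes [measurable]: "f \<in> borel_measurable borel" and c: "c > 0"
  shows "(\<integral>x. f x \<partial>lborel) = c ^ DIM('a) * (\<integral>x. f (t + c *\<^sub>R x) \<partial>lborel)"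
proof -
  have "(\<integral>x. f x \<partial>lborel) = (\<integral>x. f x \<partial>density (distr lborel borel (\<lambda>x. t + c *\<^sub>R x)) (\<lambda>_. ennreal (c ^ DIM('a))))"
    using lborel_affine[of c t] c by simp
  also have "\<dots> = (\<integral>x. c ^ DIM('a) *\<^sub>R f x \<partial>distr lborel borel (\<lambda>x. t + c *\<^sub>R x))"
    using c by (subst integral_density) auto
  also have "\<dots> = (\<integral>x. c ^ DIM('a) *\<^sub>R f (t + c *\<^sub>R x) \<partial>lborel)"
    by (subst integral_distr) auto
  finally show ?thesis by simp
qed

lemma Lp_mass_affine_finite:
  fixes u :: "'a::euclidean_space \<Rightarrow> real"
  assumes [measurable]: "u \<in> borel_measurable borel" and c: "c > 0" and fin: "Lp_mass r u < \<infinity>"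
  shows "Lp_mass r (\<lambda>x. u (t + c *\<^sub>R x)) < \<infinity>"
proof -
  have "Lp_mass r u = ennreal (c ^ DIM('a)) * Lp_mass r (\<lambda>x. u (t + c *\<^sub>R x))"
    unfolding Lp_mass_def using c by (subst nn_integral_lborel_affine[of _ c t]) auto
  then show ?thesis using fin c by (auto simp: ennreal_mult_less_top)
qed

lemma kern_scaleR:
  fixes z :: "real ^ 'n"
  assumes "c > 0"
  shows "kern s (c *\<^sub>R z) = c powr (- (real CARD('n) + 2 * s)) * kern s z"
  using assms by (simp only: kern_def norm_scaleR abs_of_pos powr_mult powr_minus divide_inverse inverse_mult_distrib mult_1)

lemma energy_affine_finite:
  fixes u :: "real ^ 'n \<Rightarrow> real"
  assumes [measurable]: "u \<in> borel_measurable borel" and c: "c > 0" and fin: "energy s u < \<infinity>"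
  shows "energy s (\<lambda>x. u (t + c *\<^sub>R x)) < \<infinity>"
proof -
  let ?T = "\<lambda>x. t + c *\<^sub>R x"
  define k where "k = c powr (- (real CARD('n) + 2 * s))"
  have e: "energy s v = (\<integral>\<^sup>+y. \<integral>\<^sup>+x. ennreal (\<bar>v x - v y\<bar>\<^sup>2 * kern s (x - y)) \<partial>lborel \<partial>lborel)" for v :: "real ^ 'n \<Rightarrow> real"
    by (simp add: energy_def kern_def)
  have kk: "kern s (?T x - ?T y) = k * kern s (x - y)" for x y
    using kern_scaleR[OF c, of s "x - y"] by (simp add: scaleR_diff_right k_def)
  have "energy s u = ennreal (c ^ CARD('n)) * (\<integral>\<^sup>+y. \<integral>\<^sup>+x. ennreal (\<bar>u x - u (?T y)\<bar>\<^sup>2 * kern s (x - ?T y)) \<partial>lborel \<partial>lborel)"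
    unfolding e using c by (subst nn_integral_lborel_affine[of _ c t]) auto
  also have "\<dots> = ennreal (c ^ CARD('n)) * (\<integral>\<^sup>+y. ennreal (c ^ CARD('n)) * (\<integral>\<^sup>+x. ennreal (\<bar>u (?T x) - u (?T y)\<bar>\<^sup>2 * kern s (?T x - ?T y)) \<partial>lborel) \<partial>lborel)"
    using c by (subst nn_integral_lborel_affine[of "\<lambda>x. ennreal (\<bar>u x - u (?T y)\<bar>\<^sup>2 * kern s (x - ?T y))" c t for y]) auto
  also have "\<dots> = ennreal (c ^ CARD('n)) * (\<integral>\<^sup>+y. ennreal (c ^ CARD('n)) * (\<integral>\<^sup>+x. ennreal k * ennreal (\<bar>u (?T x) - u (?T y)\<bar>\<^sup>2 * kern s (x - y)) \<partial>lborel) \<partial>lborel)"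
    unfolding kk by (simp add: ennreal_mult'[symmetric] k_def mult_ac)
  also have "\<dots> = ennreal (c ^ CARD('n)) * (ennreal (c ^ CARD('n)) * (ennreal k * energy s (\<lambda>x. u (?T x))))"
    unfolding e by (simp add: nn_integral_cmult)
  finally show ?thesis using fin c by (auto simp: ennreal_mult_less_top k_def)
qed

lemma Hdot_form_affine:
  fixes v \<phi> :: "real ^ 'n \<Rightarrow> real"
  assumes [measurable]: "v \<in> borel_measurable borel" "\<phi> \<in> borel_measurable borel" and c: "c > 0"
  shows "(\<integral>y. \<integral>x. (v x - v y) * (\<phi> x - \<phi> y) * kern s (x - y) \<partial>lborel \<partial>lborel) =
    c powr (real CARD('n) - 2 * s) *
    (\<integral>y. \<integral>x. (v (t + c *\<^sub>R x) - v (t + c *\<^sub>R y)) * (\<phi> (t + c *\<^sub>R x) - \<phi> (t + c *\<^sub>R y)) * kern s (x - y) \<partial>lborel \<partial>lborel)"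
proof -
  let ?T = "\<lambda>x. t + c *\<^sub>R x"
  let ?N = "real CARD('n)"
  define k where "k = c powr (- (?N + 2 * s))"
  have kk: "kern s (?T x - ?T y) = k * kern s (x - y)" for x y
    using kern_scaleR[OF c, of s "x - y"] by (simp add: scaleR_diff_right k_def)
  have "(\<integral>y. \<integral>x. (v x - v y) * (\<phi> x - \<phi> y) * kern s (x - y) \<partial>lborel \<partial>lborel) =
    c ^ CARD('n) * (\<integral>y. (\<integral>x. (v x - v (?T y)) * (\<phi> x - \<phi> (?T y)) * kern s (x - ?T y) \<partial>lborel) \<partial>lborel)"
    by (subst integral_lborel_affine[OF _ c, of _ t]) auto
  also have "(\<lambda>y. \<integral>x. (v x - v (?T y)) * (\<phi> x - \<phi> (?T y)) * kern s (x - ?T y) \<partial>lborel) =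
     (\<lambda>y. c ^ CARD('n) * (k * (\<integral>x. (v (?T x) - v (?T y)) * (\<phi> (?T x) - \<phi> (?T y)) * kern s (x - y) \<partial>lborel)))"
  proof (rule ext)
    fix y
    have "(\<integral>x. (v x - v (?T y)) * (\<phi> x - \<phi> (?T y)) * kern s (x - ?T y) \<partial>lborel) =
       c ^ CARD('n) * (\<integral>x. (v (?T x) - v (?T y)) * (\<phi> (?T x) - \<phi> (?T y)) * kern s (?T x - ?T y) \<partial>lborel)"
      by (subst integral_lborel_affine[OF _ c, of _ t]) auto
    also have "(\<integral>x. (v (?T x) - v (?T y)) * (\<phi> (?T x) - \<phi> (?T y)) * kern s (?T x - ?T y) \<partial>lborel) =
       (\<integral>x. k * ((v (?T x) - v (?T y)) * (\<phi> (?T x) - \<phi> (?T y)) * kern s (x - y)) \<partial>lborel)"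
      unfolding kk by (simp add: mult_ac)
    finally show "(\<integral>x. (v x - v (?T y)) * (\<phi> x - \<phi> (?T y)) * kern s (x - ?T y) \<partial>lborel) =
       c ^ CARD('n) * (k * (\<integral>x. (v (?T x) - v (?T y)) * (\<phi> (?T x) - \<phi> (?T y)) * kern s (x - y) \<partial>lborel))" by simp
  qed
  also have "c ^ CARD('n) * (\<integral>y. c ^ CARD('n) * (k * (\<integral>x. (v (?T x) - v (?T y)) * (\<phi> (?T x) - \<phi> (?T y)) * kern s (x - y) \<partial>lborel)) \<partial>lborel) =
     (c ^ CARD('n) * c ^ CARD('n) * k) * (\<integral>y. \<integral>x. (v (?T x) - v (?T y)) * (\<phi> (?T x) - \<phi> (?T y)) * kern s (x - y) \<partial>lborel \<partial>lborel)"
    by simp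
  also have "c ^ CARD('n) * c ^ CARD('n) * k = c powr (?N - 2 * s)"
  proof -
    have "?N + ?N + - (?N + 2 * s) = ?N - 2 * s" by simp
    moreover have "c ^ CARD('n) = c powr ?N" using c by (simp add: powr_realpow)
    ultimately show ?thesis by (simp only: k_def powr_add[symmetric])
  qed
  finally show ?thesis .
qed

lemma smooth_bubble_affine:
  fixes a :: "real ^ 'n"
  shows "smooth (\<lambda>x. bubble s ((1 / c) *\<^sub>R (x - a)))"
proof -
  define m where "m = (real CARD('n) - 2 * s) / 2"
  \<comment> \<open>The j-th derivative of t^-m, evaluated only at points t >= 1.\<close>
  define G where "G j t = (\<Prod>i<j. - m - real i) * t powr (- m - real j)" for j t
  let ?f = "\<lambda>x. 1 + (1 / c)\<^sup>2 * (norm (x - a))\<^sup>2"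
  have "smooth (\<lambda>x. G 0 (?f x))"
  proof (rule smooth_compose[where G=G and f="?f" and j=0])
    show "smooth ?f" by (intro smooth_add smooth_mult smooth_const smooth_norm_square)
    fix j and x :: "real ^ 'n"
    have "0 < ?f x" by (simp add: add_pos_nonneg)
    then have "((\<lambda>t. t powr (- m - real j)) has_real_derivative (- m - real j) * ?f x powr (- m - real j - 1)) (at (?f x))"
      by (rule has_real_derivative_powr)
    then have "(G j has_real_derivative (\<Prod>i<j. - m - real i) * ((- m - real j) * ?f x powr (- m - real j - 1))) (at (?f x))"
      unfolding G_def[abs_def] by (rule DERIV_cmult)
    moreover have "- m - real j - 1 = - m - real (Suc j)" by simp
    ultimately show "(G j has_real_derivative G (Suc j) (?f x)) (at (?f x))"
      by (simp add: G_def mult.assoc)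
  qed
  moreover have "G 0 (?f x) = bubble s ((1 / c) *\<^sub>R (x - a))" for x
    by (simp add: G_def bubble_def m_def power_divide)
  ultimately show ?thesis by simp
qed

lemma bubble_affine_Hdot:
  fixes a :: "real ^ 'n"
  assumes s: "0 < s" "s < 1" "2 * s < real CARD('n)" and c: "c > 0"
  shows "(\<lambda>x. bubble s ((1 / c) *\<^sub>R (x - a))) \<in> Hdot s"
proof (rule Hdot_I_dominating[OF s smooth_bubble_affine])
  let ?A = "real CARD('n) - 2 * s"
  have A: "?A > 0" using s by simp
  have eq: "(\<lambda>x. bubble s ((1 / c) *\<^sub>R (x - a))) = (\<lambda>x. bubble s (- ((1 / c) *\<^sub>R a) + (1 / c) *\<^sub>R x))"
    by (simp add: scaleR_diff_right)
  show "energy s (\<lambda>x. bubble s ((1 / c) *\<^sub>R (x - a))) < \<infinity>"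
    unfolding eq using c s by (intro energy_affine_finite energy_bubble_finite bubble_mass_finite) auto
  show "Lp_mass (crit_exp CARD('n) s) (\<lambda>x. bubble s ((1 / c) *\<^sub>R (x - a))) < \<infinity>"
    unfolding eq using c s by (intro Lp_mass_affine_finite bubble_mass_finite) auto
  show "\<exists>R. \<forall>x. \<epsilon> \<le> bubble s ((1 / c) *\<^sub>R (x - a)) \<longrightarrow> norm x \<le> R" if "\<epsilon> > 0" for \<epsilon>
  proof (intro exI allI impI)
    fix x assume *: "\<epsilon> \<le> bubble s ((1 / c) *\<^sub>R (x - a))"
    define y where "y = (1 / c) *\<^sub>R (x - a)"
    have "norm y \<le> \<epsilon> powr (- 1 / ?A)"
    proof (cases "y = 0")
      case False
      have "\<epsilon> \<le> norm y powr (- ?A)" using * bubble_le_powr[OF s(3) False] by (simp add: y_def)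
      then have "(norm y powr (- ?A)) powr (- 1 / ?A) \<le> \<epsilon> powr (- 1 / ?A)"
        using that A by (intro powr_mono2') auto
      moreover have "- B * (- 1 / B) = 1" if "B > 0" for B :: real using that by simp
      from this[OF A] have "- ?A * (- 1 / ?A) = 1" .
      ultimately show ?thesis using False by (simp only: powr_powr powr_one norm_ge_zero)
    qed (use that in auto)
    moreover have "norm (x - a) = c * norm y" using c by (simp add: y_def)
    ultimately have "norm (x - a) \<le> c * \<epsilon> powr (- 1 / ?A)" using c by simp
    then show "norm x \<le> norm a + c * \<epsilon> powr (- 1 / ?A)" using norm_triangle_sub[of x a] by simp
  qed
qed (simp add: bubble_pos)

lemma Hdot_mass_finite:
  fixes u :: "real ^ 'n \<Rightarrow> real"
  assumes s: "0 < s" "s < 1" "2 * s < real CARD('n)" and u: "u \<in> Hdot s"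
  shows "Lp_mass (crit_exp CARD('n) s) u < \<infinity>"
proof -
  define r where "r = crit_exp CARD('n) s"
  have r: "r > 0" unfolding r_def using s by (intro crit_exp_pos) auto
  obtain v where [measurable]: "v \<in> borel_measurable borel" and uv: "AE x in lborel. u x = v x"
    using lebesgue_AE_eq_borel[of u] u Hdot_iff[OF s] by blast
  have "v \<in> Hdot s" using Hdot_borel[OF s u _ uv] by (simp add: borel_measurable_lebesgueI)
  then obtain f where f: "\<And>k::nat. f k \<in> test_functions" "(\<lambda>k. Lp_mass r (\<lambda>x. f k x - v x)) \<longlonglongrightarrow> 0"
    using Hdot_iff[OF s] unfolding r_def by blast
  have "eventually (\<lambda>k. Lp_mass r (\<lambda>x. f k x - v x) < \<infinity>) sequentially"
    using f(2) by (rule order_tendstoD) simp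
  then obtain k where k: "Lp_mass r (\<lambda>x. f k x - v x) < \<infinity>" by (auto simp: eventually_sequentially)
  obtain L M R where LM: "L \<ge> 0" "M \<ge> 0" "R > 0" "\<And>x y. \<bar>f k x - f k y\<bar> \<le> L * norm (x - y)" "\<And>x. \<bar>f k x\<bar> \<le> M"
    "\<And>x. x \<notin> ball 0 R \<Longrightarrow> f k x = 0" and [measurable]: "f k \<in> borel_measurable borel"
    by (rule test_function_bounds[OF f(1)[of k]]) (rule that)
  have [measurable]: "ball (0::real^'n) R \<in> sets borel" by simp
  have "Lp_mass r v \<le> (\<integral>\<^sup>+x. ennreal (2 powr r) * (ennreal (\<bar>f k x - v x\<bar> powr r) + ennreal (M powr r) * indicator (ball 0 R) x) \<partial>lborel)"
    unfolding Lp_mass_def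
  proof (intro nn_integral_mono)
    fix x
    have "\<bar>v x\<bar> powr r \<le> 2 powr r * (\<bar>f k x - v x\<bar> powr r + \<bar>f k x\<bar> powr r)"
    proof -
      have "\<bar>v x\<bar> \<le> \<bar>f k x - v x\<bar> + \<bar>f k x\<bar>" by linarith
      also have "\<dots> \<le> 2 * max \<bar>f k x - v x\<bar> \<bar>f k x\<bar>" by (simp add: max_def)
      finally have "\<bar>v x\<bar> \<le> 2 * max \<bar>f k x - v x\<bar> \<bar>f k x\<bar>" .
      then have "\<bar>v x\<bar> powr r \<le> (2 * max \<bar>f k x - v x\<bar> \<bar>f k x\<bar>) powr r" using r by (intro powr_mono2) auto
      also have "\<dots> = 2 powr r * (max \<bar>f k x - v x\<bar> \<bar>f k x\<bar>) powr r" by (rule powr_mult)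
      also have "\<dots> \<le> 2 powr r * (\<bar>f k x - v x\<bar> powr r + \<bar>f k x\<bar> powr r)"
        by (intro mult_left_mono) (auto simp: max_def)
      finally show ?thesis .
    qed
    then have "ennreal (\<bar>v x\<bar> powr r) \<le> ennreal (2 powr r) * (ennreal (\<bar>f k x - v x\<bar> powr r) + ennreal (\<bar>f k x\<bar> powr r))"
      by (simp add: ennreal_plus[symmetric] ennreal_mult[symmetric] ennreal_leI del: ennreal_plus)
    also have "ennreal (\<bar>f k x\<bar> powr r) \<le> ennreal (M powr r) * indicator (ball 0 R) x"
      using LM(5,6)[of x] r by (cases "x \<in> ball 0 R") (auto intro!: ennreal_leI powr_mono2)
    finally show "ennreal (\<bar>v x\<bar> powr r) \<le> ennreal (2 powr r) * (ennreal (\<bar>f k x - v x\<bar> powr r) + ennreal (M powr r) * indicator (ball 0 R) x)"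
      by (auto simp: mult_left_mono add_left_mono)
  qed
  also have "\<dots> = ennreal (2 powr r) * (Lp_mass r (\<lambda>x. f k x - v x) + ennreal (M powr r) * emeasure lborel (ball (0::real^'n) R))"
    unfolding Lp_mass_def by (simp add: nn_integral_cmult nn_integral_add nn_integral_cmult_indicator)
  also have "\<dots> < \<infinity>" using k LM(3) by (simp add: ennreal_mult_less_top emeasure_ball)
  finally show ?thesis using Lp_mass_cong_AE[OF uv] by (simp add: r_def)
qed

text \<open>The weak identity tested with the bubble of centre a and width c, with the form
  transported to the unit bubble by x -> a + c x. The representative \<open>v\<close> takes values
  in [0,1] everywhere, so v^p - v^q is nonnegative and nonnegative integrals suffice. The factor
  c^(N-2s) is c^(2N) from the two integrals times c^-(N+2s) from the kernel.\<close>

lemma weak_solution_bubble_identity: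
  fixes u v :: "real ^ 'n \<Rightarrow> real"
  assumes s: "0 < s" "s < 1" "2 * s < real CARD('n)" and pq: "p \<le> q"
    and sol: "weak_solution_space s p q u"
    and [measurable]: "v \<in> borel_measurable borel" and v: "\<And>x. 0 \<le> v x" "\<And>x. v x \<le> 1"
    and uv: "AE x in lborel. u x = v x" and c: "c > 0"
  shows "(\<integral>\<^sup>+x. ennreal ((v x powr p - v x powr q) * bubble s ((1 / c) *\<^sub>R (x - a))) \<partial>lborel) =
     ennreal (frac_const CARD('n) s * c powr (real CARD('n) - 2 * s)) * (\<integral>\<^sup>+x. ennreal (v (a + c *\<^sub>R x)) * frac_bubble s x \<partial>lborel)"
proof -
  let ?A = "real CARD('n) - 2 * s" and ?\<kappa> = "frac_const CARD('n) s"
  define \<phi> where "\<phi> = (\<lambda>x. bubble s ((1 / c) *\<^sub>R (x - a)))"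
  have [measurable]: "\<phi> \<in> borel_measurable borel" unfolding \<phi>_def by measurable
  have \<phi>0: "0 \<le> \<phi> x" for x by (simp add: \<phi>_def less_imp_le bubble_pos)
  have uH: "u \<in> Hdot s" using sol by (simp add: weak_solution_space_def)
  have "weak_identity s p q u \<phi>"
    using sol bubble_affine_Hdot[OF s c, of a] by (simp add: weak_solution_space_def \<phi>_def)
  then have int: "integrable lebesgue (\<lambda>x. u x powr p * \<phi> x)" "integrable lebesgue (\<lambda>x. u x powr q * \<phi> x)"
    and form: "Hdot_form s u \<phi> = (\<integral>x. u x powr p * \<phi> x \<partial>lebesgue) - (\<integral>x. u x powr q * \<phi> x \<partial>lebesgue)"
    by (auto simp: weak_identity_def)
  have conv: "integrable lborel (\<lambda>x. v x powr e * \<phi> x) \<and> (\<integral>x. u x powr e * \<phi> x \<partial>lebesgue) = (\<integral>x. v x powr e * \<phi> x \<partial>lborel)"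
    if i: "integrable lebesgue (\<lambda>x. u x powr e * \<phi> x)" for e
  proof
    have eq: "AE x in lborel. u x powr e * \<phi> x = v x powr e * \<phi> x" using uv by eventually_elim simp
    show "(\<integral>x. u x powr e * \<phi> x \<partial>lebesgue) = (\<integral>x. v x powr e * \<phi> x \<partial>lborel)"
      by (rule integral_lebesgue_cong_AE[OF _ eq]) measurable
    have m: "(\<lambda>x. v x powr e * \<phi> x) \<in> borel_measurable lborel" by measurable
    have "integrable lebesgue (\<lambda>x. v x powr e * \<phi> x)"
      by (rule integrable_cong_AE_imp[OF i]) (use AE_completion[OF eq] in \<open>auto intro!: borel_measurable_lebesgueI elim!: eventually_mono\<close>)
    then show "integrable lborel (\<lambda>x. v x powr e * \<phi> x)" using integrable_completion[OF m] by simp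
  qed
  define F where "F = (\<lambda>x. (v x powr p - v x powr q) * \<phi> x)"
  have F0: "0 \<le> F x" for x
    using powr_mono'[OF pq v(1) v(2), of x] \<phi>0[of x] by (simp add: F_def)
  have iF: "integrable lborel F" "integral\<^sup>L lborel F = Hdot_form s u \<phi>"
    unfolding F_def left_diff_distrib form using conv[OF int(1)] conv[OF int(2)] by auto
  define V where "V = (\<lambda>x. v (a + c *\<^sub>R x))"
  have [measurable]: "V \<in> borel_measurable borel" unfolding V_def by measurable
  have V: "0 \<le> V x" "V x \<le> 1" for x using v by (auto simp: V_def)
  have mV: "Lp_mass (crit_exp CARD('n) s) V < \<infinity>"
    unfolding V_def using Hdot_mass_finite[OF s uH] Lp_mass_cong_AE[OF uv] c by (intro Lp_mass_affine_finite) auto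
  have eV: "energy s V < \<infinity>"
    unfolding V_def using Hdot_energy_finite[OF s uH] energy_cong_AE[OF uv] c by (intro energy_affine_finite) auto
  note pair = bubble_pairing[OF s _ V mV eV]
  have "(\<integral>\<^sup>+x. ennreal (V x) * frac_bubble s x \<partial>lborel) \<le> (\<integral>\<^sup>+x. 1 * frac_bubble s (x::real^'n) \<partial>lborel)"
    using V by (intro nn_integral_mono mult_right_mono) auto
  then have fin: "(\<integral>\<^sup>+x. ennreal (V x) * frac_bubble s x \<partial>lborel) < \<infinity>"
    using frac_bubble_integral_finite[OF s] by (simp add: order_le_less_trans)
  have \<phi>T: "\<phi> (a + c *\<^sub>R x) = bubble s x" for x using c by (simp add: \<phi>_def)
  have "Hdot_form s u \<phi> = ?\<kappa> / 2 * (\<integral>y. \<integral>x. (v x - v y) * (\<phi> x - \<phi> y) * kern s (x - y) \<partial>lborel \<partial>lborel)"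
    by (rule Hdot_form_borel[OF _ _ uv]) measurable
  also have "(\<integral>y. \<integral>x. (v x - v y) * (\<phi> x - \<phi> y) * kern s (x - y) \<partial>lborel \<partial>lborel) =
     c powr ?A * (\<integral>y. \<integral>x. (V x - V y) * (bubble s x - bubble s y) * kern s (x - y) \<partial>lborel \<partial>lborel)"
    unfolding V_def \<phi>T[symmetric] by (rule Hdot_form_affine[OF _ _ c]) measurable
  also have "(\<integral>y. \<integral>x. (V x - V y) * (bubble s x - bubble s y) * kern s (x - y) \<partial>lborel \<partial>lborel) =
      integral\<^sup>L (lborel \<Otimes>\<^sub>M lborel) (\<lambda>(x, y). (V x - V y) * (bubble s x - bubble s y) * kern s (x - y))"
    by (rule lborel_pair.integral_snd) (rule pair(1), measurable)
  also have "\<dots> = 2 * enn2real (\<integral>\<^sup>+x. ennreal (V x) * frac_bubble s x \<partial>lborel)" by (rule pair(2)) measurable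
  finally have form2: "Hdot_form s u \<phi> = ?\<kappa> * c powr ?A * enn2real (\<integral>\<^sup>+x. ennreal (V x) * frac_bubble s x \<partial>lborel)" by simp
  have "(\<integral>\<^sup>+x. ennreal (F x) \<partial>lborel) = ennreal (integral\<^sup>L lborel F)"
    using iF(1) F0 by (intro nn_integral_eq_integral) auto
  also have "\<dots> = ennreal (?\<kappa> * c powr ?A) * ennreal (enn2real (\<integral>\<^sup>+x. ennreal (V x) * frac_bubble s x \<partial>lborel))"
    unfolding iF(2) form2 using frac_const_pos[OF s(1,2), of "CARD('n)"] by (intro ennreal_mult) auto
  also have "ennreal (enn2real (\<integral>\<^sup>+x. ennreal (V x) * frac_bubble s x \<partial>lborel)) = (\<integral>\<^sup>+x. ennreal (V x) * frac_bubble s x \<partial>lborel)"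
    using fin by simp
  finally show ?thesis by (simp add: F_def V_def \<phi>_def)
qed

text \<open>Boxes form an intersection-stable generator of the Borel sets. Comparing integrals over
  boxes takes the place of Lebesgue's differentiation theorem in the representation below.\<close>

lemma density_eq_on_boxes_imp_AE_eq:
  fixes f g :: "'a::euclidean_space \<Rightarrow> ennreal"
  assumes [measurable]: "f \<in> borel_measurable borel" "g \<in> borel_measurable borel"
    and eq: "\<And>a b. (\<integral>\<^sup>+x. indicator (box a b) x * f x \<partial>lborel) = (\<integral>\<^sup>+x. indicator (box a b) x * g x \<partial>lborel)"
    and fin: "\<And>a b. (\<integral>\<^sup>+x. indicator (box a b) x * g x \<partial>lborel) < \<infinity>"
  shows "AE x in lborel. f x = g x"
proof -
  have em: "emeasure (density lborel h) (box a b) = (\<integral>\<^sup>+x. indicator (box a b) x * h x \<partial>lborel)"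
    if "h \<in> borel_measurable borel" for h :: "'a \<Rightarrow> ennreal" and a b
    using that by (subst emeasure_density) (auto simp: mult.commute)
  have "density lborel f = density lborel g"
  proof (rule measure_eqI_generator_eq)
    let ?E = "range (\<lambda>(a, b). box a b::'a set)"
    show "Int_stable ?E" by (auto simp: Int_stable_def box_Int_box)
    show "?E \<subseteq> Pow UNIV" "sets (density lborel f) = sigma_sets UNIV ?E" "sets (density lborel g) = sigma_sets UNIV ?E"
      by (simp_all add: borel_eq_box)
    let ?A = "\<lambda>n::nat. box (- (real n *\<^sub>R One)) (real n *\<^sub>R One) :: 'a set"
    show "range ?A \<subseteq> ?E" "(\<Union>i. ?A i) = UNIV" unfolding UN_box_eq_UNIV by auto
    show "emeasure (density lborel f) (?A i) \<noteq> \<infinity>" for i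
      using fin by (simp add: em eq less_top[symmetric])
    show "emeasure (density lborel f) X = emeasure (density lborel g) X" if "X \<in> ?E" for X
      using that by (auto simp: em eq)
  qed
  then show ?thesis by (intro sigma_finite_measure.density_unique[OF sigma_finite_lborel]) auto
qed

text \<open>Moving the shift from \<open>v\<close> to the indicator makes the convergence
  elementary: the indicator of a box is continuous off the boundary, a null set, while
  \<open>v\<close> is only measurable.\<close>

lemma nn_integral_box_translate_tendsto:
  fixes v :: "'a::euclidean_space \<Rightarrow> real"
  assumes [measurable]: "v \<in> borel_measurable borel" and v: "\<And>x. 0 \<le> v x" "\<And>x. v x \<le> 1"
    and c: "c \<longlonglongrightarrow> 0" "\<And>n. 0 < c n" "\<And>n. c n \<le> 1"
  shows "(\<lambda>n. \<integral>\<^sup>+y. indicator (box a b) y * ennreal (v (y + c n *\<^sub>R x)) \<partial>lborel) \<longlonglongrightarrow> (\<integral>\<^sup>+y. indicator (box a b) y * ennreal (v y) \<partial>lborel)"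
proof -
  let ?B = "box a b"
  obtain R where R: "?B \<subseteq> ball 0 R" using bounded_box bounded_subset_ballD by blast
  have eq: "(\<integral>\<^sup>+y. indicator ?B y * ennreal (v (y + c n *\<^sub>R x)) \<partial>lborel) = (\<integral>\<^sup>+y. indicator ?B (y - c n *\<^sub>R x) * ennreal (v y) \<partial>lborel)" for n
    using nn_integral_lborel_translation[of "\<lambda>y. indicator ?B y * ennreal (v (y + c n *\<^sub>R x))" "- (c n *\<^sub>R x)"] by simp
  have "(\<lambda>n. \<integral>\<^sup>+y. indicator ?B (y - c n *\<^sub>R x) * ennreal (v y) \<partial>lborel) \<longlonglongrightarrow> (\<integral>\<^sup>+y. indicator ?B y * ennreal (v y) \<partial>lborel)"
  proof (rule nn_integral_dominated_convergence[where w="indicator (ball 0 (R + norm x))"])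
    show "AE y in lborel. indicator ?B (y - c n *\<^sub>R x) * ennreal (v y) \<le> indicator (ball 0 (R + norm x)) y" for n
    proof (rule AE_I2)
      fix y
      have "norm y < R + norm x" if "y - c n *\<^sub>R x \<in> ?B"
      proof -
        have "norm (y - c n *\<^sub>R x) < R" using that R by auto
        moreover have "norm (c n *\<^sub>R x) \<le> norm x" using c(2,3)[of n] by (simp add: mult_left_le_one_le)
        ultimately show ?thesis using norm_triangle_sub[of y "c n *\<^sub>R x"] by linarith
      qed
      then show "indicator ?B (y - c n *\<^sub>R x) * ennreal (v y) \<le> indicator (ball 0 (R + norm x)) y"
        using v[of y] by (auto simp: indicator_def)
    qed
    have "negligible (frontier ?B)" by (intro negligible_convex_frontier convex_box)
    then have "AE y in lborel. y \<notin> frontier ?B"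
      by (intro AE_not_in) (auto simp: negligible_iff_null_sets null_sets_completion_iff)
    then show "AE y in lborel. (\<lambda>n. indicator ?B (y - c n *\<^sub>R x) * ennreal (v y)) \<longlonglongrightarrow> indicator ?B y * ennreal (v y)"
    proof eventually_elim
      case (elim y)
      have lim: "(\<lambda>n. y - c n *\<^sub>R x) \<longlonglongrightarrow> y"
        using tendsto_diff[OF tendsto_const tendsto_scaleR[OF c(1) tendsto_const], of y x] by simp
      have "eventually (\<lambda>n. y - c n *\<^sub>R x \<in> ?B \<longleftrightarrow> y \<in> ?B) sequentially"
      proof (cases "y \<in> ?B")
        case True
        then show ?thesis using topological_tendstoD[OF lim open_box] by (auto elim: eventually_mono)
      next
        case False
        then have "y \<in> - closure ?B" using elim interior_subset[of ?B] by (auto simp: frontier_def)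
        then have "eventually (\<lambda>n. y - c n *\<^sub>R x \<in> - closure ?B) sequentially"
          using topological_tendstoD[OF lim, of "- closure ?B"] by auto
        then show ?thesis using False closure_subset[of ?B] by (auto elim!: eventually_mono)
      qed
      then have "eventually (\<lambda>n. indicator ?B (y - c n *\<^sub>R x) * ennreal (v y) = indicator ?B y * ennreal (v y)) sequentially"
        by eventually_elim (simp add: indicator_def)
      then show ?case by (rule tendsto_eventually)
    qed
  qed (use emeasure_bounded_finite[OF bounded_ball, of "0::'a" "R + norm x"] in \<open>auto intro!: borel_measurable_indicator\<close>)
  then show ?thesis unfolding eq .
qed

text \<open>Multiplied by c^-(N-2s), the test bubble becomes (c^2 + |x - a|^2)^(-(N-2s)/2), which
  increases to the Riesz kernel as c decreases to 0. On the other side stands an average of v(a + c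
  x) with weight \<open>frac_bubble\<close>, an approximate identity up to its total mass
  \<open>H\<close>; so K is \<open>frac_const\<close> times \<open>H\<close>.\<close>

lemma weak_solution_representation:
  fixes u v :: "real ^ 'n \<Rightarrow> real"
  assumes s: "0 < s" "s < 1" "2 * s < real CARD('n)" and pq: "p \<le> q"
    and sol: "weak_solution_space s p q u"
    and [measurable]: "v \<in> borel_measurable borel" and v: "\<And>x. 0 \<le> v x" "\<And>x. v x \<le> 1"
    and uv: "AE x in lborel. u x = v x"
  obtains K where "K \<ge> 0" "AE a in lborel.
     (\<integral>\<^sup>+x. ennreal ((v x powr p - v x powr q) * norm (x - a) powr (- (real CARD('n) - 2 * s))) \<partial>lborel) = ennreal (K * v a)"
proof -
  let ?A = "real CARD('n) - 2 * s" and ?\<kappa> = "frac_const CARD('n) s"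
  have A: "?A > 0" using s by simp
  define c where "c n = 1 / real (Suc n)" for n
  have c: "c \<longlonglongrightarrow> 0" "0 < c n" "c n \<le> 1" "decseq c" for n
    unfolding c_def by (real_asymp, auto simp: decseq_def field_simps)
  define f where "f x = v x powr p - v x powr q" for x
  have [measurable]: "f \<in> borel_measurable borel" unfolding f_def by measurable
  have f: "0 \<le> f x" for x using powr_mono'[OF pq v(1) v(2), of x] by (simp add: f_def)
  \<comment> \<open>The value 0 at the origin matches \<open>0 powr (- A) = 0\<close>, so that
    monotonicity and the limit hold at every point.\<close>
  define g where "g n z = (if z = 0 then 0 else ((c n)\<^sup>2 + (norm z)\<^sup>2) powr (- (?A / 2)))" for n and z :: "real^'n"
  have [measurable]: "g n \<in> borel_measurable borel" for n unfolding g_def by measurable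
  have gb: "c n powr (- ?A) * bubble s ((1 / c n) *\<^sub>R z) = g n z" if "z \<noteq> 0" for n z
  proof -
    have "(c n)\<^sup>2 + (norm z)\<^sup>2 = (c n)\<^sup>2 * (1 + (norm ((1 / c n) *\<^sub>R z))\<^sup>2)"
      using c(2)[of n] by (simp add: field_simps power_divide)
    then have "g n z = ((c n)\<^sup>2) powr (- (?A / 2)) * bubble s ((1 / c n) *\<^sub>R z)"
      using that by (simp only: g_def powr_mult bubble_def if_False)
    also have "((c n)\<^sup>2) powr (- (?A / 2)) = c n powr (- ?A)"
    proof -
      have "(c n)\<^sup>2 = c n powr 2" using c(2)[of n] by simp
      moreover have "2 * (- (?A / 2)) = - ?A" by (simp add: field_simps)
      ultimately show ?thesis by (simp only: powr_powr)
    qed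
    finally show ?thesis by simp
  qed
  let ?h = "\<lambda>x::real^'n. frac_bubble s x"
  define I where "I a = (\<integral>\<^sup>+x. ennreal (f x * norm (x - a) powr (- ?A)) \<partial>lborel)" for a
  have [measurable]: "I \<in> borel_measurable borel" unfolding I_def by measurable
  have approx: "(\<integral>\<^sup>+x. ennreal (f x * g n (x - a)) \<partial>lborel) = ennreal ?\<kappa> * (\<integral>\<^sup>+x. ennreal (v (a + c n *\<^sub>R x)) * ?h x \<partial>lborel)" for n a
  proof -
    have "(\<integral>\<^sup>+x. ennreal (f x * g n (x - a)) \<partial>lborel) = (\<integral>\<^sup>+x. ennreal (c n powr (- ?A)) * ennreal (f x * bubble s ((1 / c n) *\<^sub>R (x - a))) \<partial>lborel)"
      by (rule nn_integral_cong_AE, use AE_lborel_singleton[of a] in eventually_elim)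
         (simp add: gb[symmetric] ennreal_mult[symmetric] f less_imp_le[OF bubble_pos] mult_ac)
    also have "\<dots> = ennreal (c n powr (- ?A)) * (\<integral>\<^sup>+x. ennreal (f x * bubble s ((1 / c n) *\<^sub>R (x - a))) \<partial>lborel)"
      by (rule nn_integral_cmult) measurable
    also have "(\<integral>\<^sup>+x. ennreal (f x * bubble s ((1 / c n) *\<^sub>R (x - a))) \<partial>lborel) =
       ennreal (?\<kappa> * c n powr ?A) * (\<integral>\<^sup>+x. ennreal (v (a + c n *\<^sub>R x)) * ?h x \<partial>lborel)"
      unfolding f_def by (rule weak_solution_bubble_identity[OF s pq sol _ v uv c(2)]) measurable
    also have "ennreal (c n powr (- ?A)) * (ennreal (?\<kappa> * c n powr ?A) * X) = ennreal ?\<kappa> * X" for X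
    proof -
      have "c n powr (- ?A) * (?\<kappa> * c n powr ?A) = ?\<kappa>"
      proof -
        have "c n powr (- ?A) * c n powr ?A = 1"
          using c(2)[of n] by (subst powr_add[symmetric]) simp
        then show ?thesis by (metis mult.left_commute mult.right_neutral)
      qed
      note E = this
      have "ennreal (c n powr (- ?A)) * ennreal (?\<kappa> * c n powr ?A) = ennreal (c n powr (- ?A) * (?\<kappa> * c n powr ?A))"
        using frac_const_pos[OF s(1,2), of "CARD('n)"] by (intro ennreal_mult[symmetric]) auto
      also have "\<dots> = ennreal ?\<kappa>" by (simp only: E)
      finally show ?thesis by (simp only: mult.assoc[symmetric])
    qed
    finally show ?thesis .
  qed
  have lim_I: "(\<lambda>n. \<integral>\<^sup>+x. ennreal (f x * g n (x - a)) \<partial>lborel) \<longlonglongrightarrow> I a" and mono_I: "incseq (\<lambda>n. \<integral>\<^sup>+x. ennreal (f x * g n (x - a)) \<partial>lborel)" for a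
  proof -
    have g_mono: "g m z \<le> g n z" if "m \<le> n" for m n z
      unfolding g_def using decseqD[OF c(4) that] c(2)[of n] A
      by (auto intro!: powr_mono2' add_mono power_mono add_pos_nonneg)
    have inc: "incseq (\<lambda>n x. ennreal (f x * g n (x - a)))"
      using g_mono f by (auto simp: incseq_def le_fun_def intro!: ennreal_leI mult_left_mono)
    show "incseq (\<lambda>n. \<integral>\<^sup>+x. ennreal (f x * g n (x - a)) \<partial>lborel)"
      by (rule incseq_nn_integral[OF inc])
    have g_lim: "(\<lambda>n. g n z) \<longlonglongrightarrow> norm z powr (- ?A)" for z
    proof (cases "z = 0")
      case False
      have "(\<lambda>n. ((c n)\<^sup>2 + (norm z)\<^sup>2) powr (- (?A / 2))) \<longlonglongrightarrow> (0\<^sup>2 + (norm z)\<^sup>2) powr (- (?A / 2))"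
        using False by (intro tendsto_powr tendsto_intros c) auto
      also have "(0\<^sup>2 + (norm z)\<^sup>2) powr (- (?A / 2)) = norm z powr (- ?A)"
      proof -
        have "0\<^sup>2 + (norm z)\<^sup>2 = norm z powr 2" by simp
        moreover have "2 * (- (?A / 2)) = - ?A" by (simp add: field_simps)
        ultimately show ?thesis by (simp only: powr_powr)
      qed
      finally show ?thesis using False by (simp add: g_def)
    qed (simp add: g_def)
    show "(\<lambda>n. \<integral>\<^sup>+x. ennreal (f x * g n (x - a)) \<partial>lborel) \<longlonglongrightarrow> I a"
      unfolding I_def
      by (rule nn_integral_LIMSEQ[OF inc]) (measurable, intro tendsto_ennrealI tendsto_mult tendsto_const g_lim)
  qed
  define H where "H = (\<integral>\<^sup>+x. ?h x \<partial>lborel)"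
  have H: "H < \<infinity>" unfolding H_def by (rule frac_bubble_integral_finite[OF s])
  have v_fin: "(\<integral>\<^sup>+y. indicator (box a b) y * ennreal (v y) \<partial>lborel) < \<infinity>" for a b
  proof -
    have "(\<integral>\<^sup>+y. indicator (box a b) y * ennreal (v y) \<partial>lborel) \<le> (\<integral>\<^sup>+y. indicator (box a b) y \<partial>lborel)"
      using v by (intro nn_integral_mono) (auto simp: indicator_def)
    also have "\<dots> < \<infinity>" using emeasure_bounded_finite[OF bounded_box, of a b] by simp
    finally show ?thesis .
  qed
  \<comment> \<open>Both limits are taken after averaging a over a box, because at a single a the
    values v(a + c x) need not tend to v(a).\<close>
  have box_eq: "(\<integral>\<^sup>+y. indicator (box a b) y * I y \<partial>lborel) = (\<integral>\<^sup>+y. indicator (box a b) y * (ennreal ?\<kappa> * H * ennreal (v y)) \<partial>lborel)" for a b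
  proof (rule LIMSEQ_unique)
    let ?B = "box a b"
    let ?J = "\<lambda>n. \<integral>\<^sup>+y. indicator ?B y * (\<integral>\<^sup>+x. ennreal (f x * g n (x - y)) \<partial>lborel) \<partial>lborel"
    show "?J \<longlonglongrightarrow> (\<integral>\<^sup>+y. indicator ?B y * I y \<partial>lborel)"
    proof (rule nn_integral_LIMSEQ)
      show "incseq (\<lambda>n y. indicator ?B y * (\<integral>\<^sup>+x. ennreal (f x * g n (x - y)) \<partial>lborel))"
        using mono_I by (auto simp: incseq_def le_fun_def intro!: mult_left_mono)
      show "(\<lambda>n. indicator ?B y * (\<integral>\<^sup>+x. ennreal (f x * g n (x - y)) \<partial>lborel)) \<longlonglongrightarrow> indicator ?B y * I y" for y
        using lim_I[of y] by (intro ennreal_tendsto_cmult) (auto simp: indicator_def)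
    qed measurable
    have "?J n = ennreal ?\<kappa> * (\<integral>\<^sup>+x. ?h x * (\<integral>\<^sup>+y. indicator ?B y * ennreal (v (y + c n *\<^sub>R x)) \<partial>lborel) \<partial>lborel)" for n
    proof -
      have "?J n = (\<integral>\<^sup>+y. \<integral>\<^sup>+x. ennreal ?\<kappa> * (?h x * (indicator ?B y * ennreal (v (y + c n *\<^sub>R x)))) \<partial>lborel \<partial>lborel)"
        unfolding approx
      proof (rule nn_integral_cong)
        fix y
        have "(\<integral>\<^sup>+x. ennreal ?\<kappa> * (?h x * (indicator ?B y * ennreal (v (y + c n *\<^sub>R x)))) \<partial>lborel) =
            (\<integral>\<^sup>+x. (indicator ?B y * ennreal ?\<kappa>) * (ennreal (v (y + c n *\<^sub>R x)) * ?h x) \<partial>lborel)"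
          by (simp only: mult_ac)
        also have "\<dots> = (indicator ?B y * ennreal ?\<kappa>) * (\<integral>\<^sup>+x. ennreal (v (y + c n *\<^sub>R x)) * ?h x \<partial>lborel)"
          by (rule nn_integral_cmult) measurable
        finally show "indicator ?B y * (ennreal ?\<kappa> * (\<integral>\<^sup>+x. ennreal (v (y + c n *\<^sub>R x)) * ?h x \<partial>lborel)) =
            (\<integral>\<^sup>+x. ennreal ?\<kappa> * (?h x * (indicator ?B y * ennreal (v (y + c n *\<^sub>R x)))) \<partial>lborel)"
          by (simp only: mult.assoc)
      qed
      also have "\<dots> = (\<integral>\<^sup>+x. \<integral>\<^sup>+y. ennreal ?\<kappa> * (?h x * (indicator ?B y * ennreal (v (y + c n *\<^sub>R x)))) \<partial>lborel \<partial>lborel)"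
        by (rule lborel_pair.Fubini') measurable
      finally show ?thesis by (simp add: nn_integral_cmult)
    qed
    moreover have "(\<lambda>n. \<integral>\<^sup>+x. ?h x * (\<integral>\<^sup>+y. indicator ?B y * ennreal (v (y + c n *\<^sub>R x)) \<partial>lborel) \<partial>lborel) \<longlonglongrightarrow>
        (\<integral>\<^sup>+x. ?h x * (\<integral>\<^sup>+y. indicator ?B y * ennreal (v y) \<partial>lborel) \<partial>lborel)"
    proof (rule nn_integral_dominated_convergence[where w="\<lambda>x. ?h x * emeasure lborel ?B"])
      show "AE x in lborel. ?h x * (\<integral>\<^sup>+y. indicator ?B y * ennreal (v (y + c n *\<^sub>R x)) \<partial>lborel) \<le> ?h x * emeasure lborel ?B" for n
      proof (intro AE_I2 mult_left_mono)
        fix x :: "real^'n"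
        have "(\<integral>\<^sup>+y. indicator ?B y * ennreal (v (y + c n *\<^sub>R x)) \<partial>lborel) \<le> (\<integral>\<^sup>+y. indicator ?B y \<partial>lborel)"
          using v by (intro nn_integral_mono) (auto simp: indicator_def)
        then show "(\<integral>\<^sup>+y. indicator ?B y * ennreal (v (y + c n *\<^sub>R x)) \<partial>lborel) \<le> emeasure lborel ?B" by simp
      qed simp
      have "(\<integral>\<^sup>+x. ?h x * emeasure lborel ?B \<partial>lborel) = H * emeasure lborel ?B"
        unfolding H_def by (rule nn_integral_multc) measurable
      also have "\<dots> < \<infinity>" using H emeasure_bounded_finite[OF bounded_box, of a b] by (simp add: ennreal_mult_less_top)
      finally show "(\<integral>\<^sup>+x. ?h x * emeasure lborel ?B \<partial>lborel) < \<infinity>" .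
      \<comment> \<open>In the extended half-line a limit may be multiplied by a constant if that
        constant is finite.\<close>
      have "AE x in lborel. ?h x \<noteq> \<infinity>"
        using H unfolding H_def by (intro nn_integral_noteq_infinite) auto
      then show "AE x in lborel. (\<lambda>n. ?h x * (\<integral>\<^sup>+y. indicator ?B y * ennreal (v (y + c n *\<^sub>R x)) \<partial>lborel)) \<longlonglongrightarrow>
          ?h x * (\<integral>\<^sup>+y. indicator ?B y * ennreal (v y) \<partial>lborel)"
      proof eventually_elim
        case (elim x)
        then show ?case using nn_integral_box_translate_tendsto[where v=v and a=a and b=b and x=x, OF _ v c(1-3)]
          by (intro ennreal_tendsto_cmult) (auto simp: less_top)
      qed
    qed measurable
    ultimately have "?J \<longlonglongrightarrow> ennreal ?\<kappa> * (\<integral>\<^sup>+x. ?h x * (\<integral>\<^sup>+y. indicator ?B y * ennreal (v y) \<partial>lborel) \<partial>lborel)"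
      by (simp add: ennreal_tendsto_cmult)
    also have "(\<integral>\<^sup>+x. ?h x * (\<integral>\<^sup>+y. indicator ?B y * ennreal (v y) \<partial>lborel) \<partial>lborel) = H * (\<integral>\<^sup>+y. indicator ?B y * ennreal (v y) \<partial>lborel)"
      unfolding H_def by (rule nn_integral_multc) measurable
    also have "ennreal ?\<kappa> * (H * (\<integral>\<^sup>+y. indicator ?B y * ennreal (v y) \<partial>lborel)) = (\<integral>\<^sup>+y. indicator ?B y * (ennreal ?\<kappa> * H * ennreal (v y)) \<partial>lborel)"
      unfolding mult.assoc[symmetric] by (subst nn_integral_cmult[symmetric]) (auto intro!: nn_integral_cong simp: mult_ac)
    finally show "?J \<longlonglongrightarrow> \<dots>" .
  qed
  obtain H' where H': "H = ennreal H'" "H' \<ge> 0" using H by (cases H) auto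
  have "AE a in lborel. I a = ennreal ?\<kappa> * H * ennreal (v a)"
  proof (rule density_eq_on_boxes_imp_AE_eq[OF _ _ box_eq])
    show "(\<integral>\<^sup>+y. indicator (box a b) y * (ennreal ?\<kappa> * H * ennreal (v y)) \<partial>lborel) < \<infinity>" for a b
    proof -
      have "(\<integral>\<^sup>+y. indicator (box a b) y * (ennreal ?\<kappa> * H * ennreal (v y)) \<partial>lborel) = ennreal ?\<kappa> * H * (\<integral>\<^sup>+y. indicator (box a b) y * ennreal (v y) \<partial>lborel)"
        by (subst nn_integral_cmult[symmetric]) (auto intro!: nn_integral_cong simp: mult_ac)
      also have "\<dots> < \<infinity>" using H v_fin by (simp add: ennreal_mult_less_top)
      finally show ?thesis .
    qed
  qed measurable
  then have "AE a in lborel. I a = ennreal (?\<kappa> * H' * v a)"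
    by eventually_elim (use H' v frac_const_pos[OF s(1,2), of "CARD('n)"] in \<open>simp add: ennreal_mult\<close>)
  then show ?thesis
    using H' frac_const_pos[OF s(1,2), of "CARD('n)"] by (intro that[of "?\<kappa> * H'"]) (auto simp: I_def f_def)
qed

subsection \<open>Decay of subsolutions\<close>

text \<open>Young's inequality with the weights 1/m and 1/n replaced by 1: the larger of the two
  powers already bounds the product.\<close>

lemma young_max:
  fixes x y m n :: real
  assumes "x \<ge> 0" "y \<ge> 0" "m > 0" "n > 0" "1 / m + 1 / n = 1"
  shows "x * y \<le> x powr m + y powr n"
proof (cases "y powr n \<le> x powr m")
  case True
  have "y = (y powr n) powr (1 / n)" using assms by (simp add: powr_powr)
  also have "\<dots> \<le> (x powr m) powr (1 / n)" using True assms by (intro powr_mono2) auto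
  also have "\<dots> = x powr (m / n)" by (simp add: powr_powr)
  finally have "x * y \<le> x * x powr (m / n)" using assms by (intro mult_left_mono) auto
  also have "\<dots> = x powr (1 + m / n)" using assms by (simp add: powr_mult_base)
  also have "1 + m / n = m * (1 / m + 1 / n)" using assms(3,4) by (simp add: field_simps)
  also have "\<dots> = m" unfolding assms(5) by simp
  finally show ?thesis by (simp add: add_increasing2)
next
  case False
  have "x = (x powr m) powr (1 / m)" using assms by (simp add: powr_powr)
  also have "\<dots> \<le> (y powr n) powr (1 / m)" using False assms by (intro powr_mono2) auto
  also have "\<dots> = y powr (n / m)" by (simp add: powr_powr)
  finally have "x * y \<le> y powr (n / m) * y" using assms by (intro mult_right_mono) auto
  also have "\<dots> = y powr (1 + n / m)" using assms by (simp add: powr_mult_base mult.commute)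
  also have "1 + n / m = n * (1 / m + 1 / n)" using assms(3,4) by (simp add: field_simps)
  also have "\<dots> = n" unfolding assms(5) by simp
  finally show ?thesis by (simp add: add_increasing)
qed

text \<open>The exponents A and 2s + \<open>\<alpha>\<close> add up to N + \<open>\<alpha>\<close>,
  hence the rate by scaling. Convergence at a, at 0 and at infinity needs A < N, 2s +
  \<open>\<alpha>\<close> < N and \<open>\<alpha>\<close> > 0; the three terms of the majorant
  belong to these places.\<close>

lemma riesz_potential_of_power:
  fixes A s \<alpha> :: real
  assumes s: "0 < s" and A: "A = real CARD('n) - 2 * s" and \<alpha>: "0 < \<alpha>" "\<alpha> < A"
  obtains D where "D > 0" "\<And>a::real^'n. a \<noteq> 0 \<Longrightarrow>
    (\<integral>\<^sup>+x. ennreal (norm (x - a) powr (- A) * norm x powr (- (2 * s + \<alpha>))) \<partial>lborel) \<le> ennreal (D * norm a powr (- \<alpha>))"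
proof -
  let ?N = "real CARD('n)"
  obtain C1 where C1: "C1 \<ge> 0" "\<And>r. r > 0 \<Longrightarrow>
    (\<integral>\<^sup>+y. pow_in (2 * s + \<alpha>) r (y::real^'n) \<partial>lborel) = ennreal (C1 * r powr (?N - (2 * s + \<alpha>)))"
    using nn_integral_norm_powr_ball[of "2 * s + \<alpha>", where 'a="real^'n"] A \<alpha> by auto
  obtain C2 where C2: "C2 \<ge> 0" "\<And>r. r > 0 \<Longrightarrow>
    (\<integral>\<^sup>+y. pow_in A r (y::real^'n) \<partial>lborel) = ennreal (C2 * r powr (?N - A))"
    using nn_integral_norm_powr_ball[of A, where 'a="real^'n"] A s by auto
  obtain C3 where C3: "C3 \<ge> 0" "\<And>r. r > 0 \<Longrightarrow>
    (\<integral>\<^sup>+y. pow_out (?N + \<alpha>) r (y::real^'n) \<partial>lborel) = ennreal (C3 * r powr (?N - (?N + \<alpha>)))"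
    using nn_integral_norm_powr_outside[of "?N + \<alpha>", where 'a="real^'n"] \<alpha> by auto
  define D where "D = 1 + C1 * (1 / 2) powr (- \<alpha>) + C2 * (1 / 2) powr (- \<alpha>) + 3 powr A * C3 * (1 / 4) powr (- \<alpha>)"
  show ?thesis
  proof (rule that[of D])
    show "D > 0" using C1 C2 C3 by (auto simp: D_def intro!: add_pos_nonneg)
    fix a :: "real^'n" assume a: "a \<noteq> 0"
    define r where "r = norm a"
    have r: "r > 0" using a by (simp add: r_def)
    define k1 where "k1 = (r / 2) powr (- A)"
    define k2 where "k2 = (r / 2) powr (- (2 * s + \<alpha>))"
    define k3 where "k3 = (3::real) powr A"
    let ?f1 = "\<lambda>x::real^'n. pow_in (2 * s + \<alpha>) (r / 2) x"
    let ?f2 = "\<lambda>x::real^'n. pow_in A (r / 2) x"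
    \<comment> \<open>The radius is r/4 and not r/2, because \<open>pow_out\<close> is strict while
      |x| = r/2 may occur.\<close>
    let ?f3 = "\<lambda>x::real^'n. pow_out (?N + \<alpha>) (r / 4) x"
    have "(\<integral>\<^sup>+x. ennreal (norm (x - a) powr (- A) * norm x powr (- (2 * s + \<alpha>))) \<partial>lborel) \<le>
        (\<integral>\<^sup>+x. ennreal k1 * ?f1 x + ennreal k2 * ?f2 (x - a) + ennreal k3 * ?f3 x \<partial>lborel)"
    proof (intro nn_integral_mono)
      fix x :: "real^'n"
      have tri: "r \<le> norm (x - a) + norm x" using norm_triangle_ineq4[of x "x - a"] by (simp add: r_def add.commute)
      show "ennreal (norm (x - a) powr (- A) * norm x powr (- (2 * s + \<alpha>))) \<le> ennreal k1 * ?f1 x + ennreal k2 * ?f2 (x - a) + ennreal k3 * ?f3 x"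
      proof (cases "norm x < r / 2")
        case True
        then have "norm (x - a) powr (- A) \<le> k1" unfolding k1_def using tri r \<alpha> by (intro powr_mono2') auto
        then have "ennreal (norm (x - a) powr (- A) * norm x powr (- (2 * s + \<alpha>))) \<le> ennreal (k1 * norm x powr (- (2 * s + \<alpha>)))"
          by (intro ennreal_leI mult_right_mono) auto
        also have "\<dots> = ennreal k1 * ?f1 x" using True by (simp only: ennreal_mult k1_def powr_ge_zero if_True)
        finally show ?thesis by (rule add_increasing2[OF zero_le add_increasing2[OF zero_le]])
      next
        case x: False
        show ?thesis
        proof (cases "norm (x - a) < r / 2")
          case True
          have "norm x powr (- (2 * s + \<alpha>)) \<le> k2" unfolding k2_def using x r s \<alpha> by (intro powr_mono2') auto
          then have "ennreal (norm (x - a) powr (- A) * norm x powr (- (2 * s + \<alpha>))) \<le> ennreal (k2 * norm (x - a) powr (- A))"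
            unfolding mult.commute[of k2] by (intro ennreal_leI mult_left_mono) auto
          also have "\<dots> = ennreal k2 * ?f2 (x - a)" using True by (simp only: ennreal_mult k2_def powr_ge_zero if_True)
          finally show ?thesis by (rule add_increasing2[OF zero_le add_increasing[OF zero_le]])
        next
          case xa: False
          \<comment> \<open>Away from a one has |a| = r <= 2 |x - a|.\<close>
          have "norm x \<le> 3 * norm (x - a)" using norm_triangle_ineq[of "x - a" a] xa r by (simp add: r_def)
          then have "norm x / 3 \<le> norm (x - a)" by simp
          moreover have nx: "norm x > 0" using x r by linarith
          ultimately have "norm (x - a) powr (- A) \<le> (norm x / 3) powr (- A)" using \<alpha> by (intro powr_mono2') auto
          also have "\<dots> = k3 * norm x powr (- A)"
          proof -
            have "(norm x / 3) powr (- A) = norm x powr (- A) / 3 powr (- A)" by (rule powr_divide)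
            then show ?thesis by (simp only: k3_def powr_minus divide_inverse inverse_inverse_eq mult.commute)
          qed
          finally have "norm (x - a) powr (- A) * norm x powr (- (2 * s + \<alpha>)) \<le> k3 * norm x powr (- A) * norm x powr (- (2 * s + \<alpha>))"
            by (intro mult_right_mono) auto
          also have "\<dots> = k3 * norm x powr (- (?N + \<alpha>))"
          proof -
            have "- A + - (2 * s + \<alpha>) = - (?N + \<alpha>)" by (simp add: A)
            then show ?thesis by (simp only: mult.assoc powr_add[symmetric])
          qed
          finally have "ennreal (norm (x - a) powr (- A) * norm x powr (- (2 * s + \<alpha>))) \<le> ennreal (k3 * norm x powr (- (?N + \<alpha>)))"
            by (rule ennreal_leI)
          also have "\<dots> = ennreal k3 * ?f3 x" using x r by (simp add: ennreal_mult k3_def)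
          finally show ?thesis by (rule add_increasing[OF zero_le])
        qed
      qed
    qed
    also have "\<dots> = ennreal k1 * (\<integral>\<^sup>+x. ?f1 x \<partial>lborel) + ennreal k2 * (\<integral>\<^sup>+x. ?f2 (x - a) \<partial>lborel) + ennreal k3 * (\<integral>\<^sup>+x. ?f3 x \<partial>lborel)"
      by (simp add: nn_integral_add nn_integral_cmult)
    also have "(\<integral>\<^sup>+x. ?f2 (x - a) \<partial>lborel) = (\<integral>\<^sup>+x. ?f2 x \<partial>lborel)"
      using nn_integral_lborel_translation[of ?f2 "- a"] by (simp only: uminus_add_conv_diff) measurable
    also have "\<dots> = ennreal (C2 * (r / 2) powr (?N - A))" using r by (intro C2(2)) simp
    also have "(\<integral>\<^sup>+x. ?f1 x \<partial>lborel) = ennreal (C1 * (r / 2) powr (?N - (2 * s + \<alpha>)))" using r by (intro C1(2)) simp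
    also have "(\<integral>\<^sup>+x. ?f3 x \<partial>lborel) = ennreal (C3 * (r / 4) powr (?N - (?N + \<alpha>)))" using r by (intro C3(2)) simp
    also have "ennreal k1 * ennreal (C1 * (r / 2) powr (?N - (2 * s + \<alpha>))) + ennreal k2 * ennreal (C2 * (r / 2) powr (?N - A)) + ennreal k3 * ennreal (C3 * (r / 4) powr (?N - (?N + \<alpha>)))
       = ennreal (k1 * (C1 * (r / 2) powr (?N - (2 * s + \<alpha>))) + k2 * (C2 * (r / 2) powr (?N - A)) + k3 * (C3 * (r / 4) powr (?N - (?N + \<alpha>))))"
      using C1 C2 C3 by (simp add: k1_def k2_def k3_def ennreal_mult[symmetric] ennreal_plus[symmetric] del: ennreal_plus)
    also have "\<dots> \<le> ennreal (D * r powr (- \<alpha>))"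
    proof (rule ennreal_leI)
      have half: "(r / 2) powr (- \<alpha>) = (1 / 2) powr (- \<alpha>) * r powr (- \<alpha>)" and quarter: "(r / 4) powr (- \<alpha>) = (1 / 4) powr (- \<alpha>) * r powr (- \<alpha>)"
        using powr_mult[of "1 / 2" r "- \<alpha>"] powr_mult[of "1 / 4" r "- \<alpha>"] by simp_all
      have e1: "- A + (?N - (2 * s + \<alpha>)) = - \<alpha>" and e2: "- (2 * s + \<alpha>) + (?N - A) = - \<alpha>" and e3: "?N - (?N + \<alpha>) = - \<alpha>"
        by (simp_all add: A)
      have 1: "k1 * (C1 * (r / 2) powr (?N - (2 * s + \<alpha>))) = C1 * (r / 2) powr (- \<alpha>)"
        using e1 by (simp only: k1_def mult.left_commute[of _ C1] powr_add[symmetric])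
      have 2: "k2 * (C2 * (r / 2) powr (?N - A)) = C2 * (r / 2) powr (- \<alpha>)"
        using e2 by (simp only: k2_def mult.left_commute[of _ C2] powr_add[symmetric])
      show "k1 * (C1 * (r / 2) powr (?N - (2 * s + \<alpha>))) + k2 * (C2 * (r / 2) powr (?N - A)) + k3 * (C3 * (r / 4) powr (?N - (?N + \<alpha>))) \<le> D * r powr (- \<alpha>)"
        unfolding 1 2 e3 half quarter D_def k3_def by (simp add: algebra_simps)
    qed
    finally show "(\<integral>\<^sup>+x. ennreal (norm (x - a) powr (- A) * norm x powr (- (2 * s + \<alpha>))) \<partial>lborel) \<le> ennreal (D * norm a powr (- \<alpha>))"
      by (simp add: r_def)
  qed
qed

text \<open>Bounded subsolutions of the integral equation with critical power; \<open>p\<close> is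
  (N+2s)/(N-2s) here and not the exponent of the differential equation. The inequality is required
  at every point, because it is going to be evaluated at points selected by suprema.\<close>

locale potential_bound =
  fixes s A p r C M :: real and U :: "real ^ 'n \<Rightarrow> real"
  assumes s: "0 < s" "2 * s < real CARD('n)"
    and A: "A = real CARD('n) - 2 * s" and p: "p = (real CARD('n) + 2 * s) / A" and r: "r = crit_exp CARD('n) s"
    and U_meas[measurable]: "U \<in> borel_measurable borel"
    and U: "\<And>x. 0 \<le> U x" "\<And>x. U x \<le> M" and C: "0 < C"
    and mass: "Lp_mass r U < \<infinity>"
    and bound: "\<And>a. ennreal (U a) \<le> ennreal C * (\<integral>\<^sup>+x. ennreal (U x powr p * norm (x - a) powr (- A)) \<partial>lborel)"
begin

lemma A_pos: "A > 0" using s A by simp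
lemma p_gt_1: "p > 1" using s A A_pos by (simp add: p)
lemma r_eq: "r = p + 1" "A * r = 2 * real CARD('n)" "A * p = real CARD('n) + 2 * s" "r > 0"
proof -
  have r': "r = 2 * real CARD('n) / A" by (simp add: r crit_exp_def A)
  show "A * r = 2 * real CARD('n)" "A * p = real CARD('n) + 2 * s" using A_pos by (simp_all add: r' p)
  have "p + 1 = (real CARD('n) + 2 * s + A) / A" using A_pos by (simp add: p add_divide_distrib)
  also have "\<dots> = r" unfolding r' by (simp add: A)
  finally show "r = p + 1" by simp
  show "r > 0" using A_pos by (simp add: r')
qed
lemma p_diff: "p - 1 = 4 * s / A" using A_pos by (simp add: p field_simps) (simp add: A)

text \<open>Hoelder's inequality in the form of Young's: |z|^-A lies in L^r outside a ball since A r
  = 2N > N, with a norm that scales like \<open>\<rho>\<close>^(-A/2). The parameter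
  \<open>\<tau>\<close> distributes the weight between the mass of \<open>w\<close> and the
  kernel.\<close>

lemma far_field_bound:
  obtains D where "D > 0" "\<And>w a (\<rho>::real) (\<tau>::real). w \<in> borel_measurable borel \<Longrightarrow> (\<And>x. 0 \<le> w x) \<Longrightarrow> 0 < \<rho> \<Longrightarrow> 0 < \<tau> \<Longrightarrow>
     (\<integral>\<^sup>+x. (if norm (x - a) < \<rho> then 0 else ennreal (w x powr p * norm (x - a) powr (- A))) \<partial>lborel) \<le>
     ennreal (\<rho> powr (- (A / 2))) * (ennreal (\<tau> powr (- (r / p))) * Lp_mass r (w :: real^'n \<Rightarrow> real) + ennreal (D * \<tau> powr r))"
proof -
  obtain C2 where C2: "C2 \<ge> 0" "\<And>\<rho>. \<rho> > 0 \<Longrightarrow>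
    (\<integral>\<^sup>+y. pow_out (2 * real CARD('n)) \<rho> (y::real^'n) \<partial>lborel) = ennreal (C2 * \<rho> powr (real CARD('n) - 2 * real CARD('n)))"
    using nn_integral_norm_powr_outside[of "2 * real CARD('n)", where 'a="real^'n"] by auto
  define D where "D = 1 + C2 * 2 powr real CARD('n)"
  show ?thesis
  proof (rule that[of D])
    show "D > 0" using C2 by (auto simp: D_def intro!: add_pos_nonneg)
    fix w :: "real^'n \<Rightarrow> real" and a and \<rho> \<tau> :: real
    assume [measurable]: "w \<in> borel_measurable borel" and w: "\<And>x. 0 \<le> w x" and \<rho>: "0 < \<rho>" and \<tau>: "0 < \<tau>"
    let ?f = "\<lambda>z::real^'n. pow_out (2 * real CARD('n)) (\<rho> / 2) z"
    let ?t = "\<tau> powr (- (r / p))"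
    have "(\<integral>\<^sup>+x. (if norm (x - a) < \<rho> then 0 else ennreal (w x powr p * norm (x - a) powr (- A))) \<partial>lborel) \<le>
      (\<integral>\<^sup>+x. ennreal (\<rho> powr (- (A / 2))) * (ennreal ?t * ennreal (\<bar>w x\<bar> powr r) + ennreal (\<tau> powr r * \<rho> powr real CARD('n)) * ?f (x - a)) \<partial>lborel)"
    proof (intro nn_integral_mono)
      fix x
      show "(if norm (x - a) < \<rho> then 0 else ennreal (w x powr p * norm (x - a) powr (- A))) \<le>
        ennreal (\<rho> powr (- (A / 2))) * (ennreal ?t * ennreal (\<bar>w x\<bar> powr r) + ennreal (\<tau> powr r * \<rho> powr real CARD('n)) * ?f (x - a))"
      proof (cases "norm (x - a) < \<rho>")
        case False
        define n where "n = norm (x - a)"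
        have n: "n \<ge> \<rho>" using False by (simp add: n_def)
        \<comment> \<open>The conjugate exponents are r/p and r, as p + 1 = r. The power
          \<open>\<rho>\<close>^(A/2) in \<open>?Y\<close> makes the integral of the kernel term
          independent of \<open>\<rho>\<close>.\<close>
        let ?X = "w x powr p / \<tau>" and ?Y = "\<tau> * (\<rho> powr (A / 2) * n powr (- A))"
        have pr: "0 < r / p" "1 / (r / p) + 1 / r = 1" "p * (r / p) = r"
          using r_eq p_gt_1 by (auto simp: field_simps)
        have "?X * ?Y \<le> ?X powr (r / p) + ?Y powr r"
          using pr r_eq(4) w \<tau> by (intro young_max) auto
        also have "?X powr (r / p) = ?t * w x powr r"
        proof -
          have "?X powr (r / p) = (w x powr p) powr (r / p) / \<tau> powr (r / p)" by (rule powr_divide)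
          also have "\<dots> = w x powr r / \<tau> powr (r / p)" by (simp only: powr_powr pr(3))
          finally show ?thesis by (simp only: powr_minus divide_inverse mult.commute)
        qed
        also have "?Y powr r = \<tau> powr r * \<rho> powr real CARD('n) * n powr (- (2 * real CARD('n)))"
        proof -
          have "A / 2 * r = real CARD('n)" "- A * r = - (2 * real CARD('n))" using r_eq(2) by simp_all
          then show ?thesis by (simp only: powr_mult powr_powr mult.assoc)
        qed
        finally have "\<rho> powr (- (A / 2)) * (?X * ?Y) \<le> \<rho> powr (- (A / 2)) * (?t * w x powr r + \<tau> powr r * \<rho> powr real CARD('n) * n powr (- (2 * real CARD('n))))"
          by (intro mult_left_mono) auto
        moreover have "\<rho> powr (- (A / 2)) * (?X * ?Y) = w x powr p * n powr (- A)"
          using \<tau> \<rho> by (simp add: powr_minus field_simps)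
        ultimately have "ennreal (w x powr p * n powr (- A)) \<le> ennreal (\<rho> powr (- (A / 2)) * (?t * w x powr r + \<tau> powr r * \<rho> powr real CARD('n) * n powr (- (2 * real CARD('n)))))"
          by (intro ennreal_leI) simp
        also have "\<dots> = ennreal (\<rho> powr (- (A / 2))) * (ennreal ?t * ennreal (w x powr r) + ennreal (\<tau> powr r * \<rho> powr real CARD('n)) * ennreal (n powr (- (2 * real CARD('n)))))"
          by (simp only: ennreal_mult ennreal_plus powr_ge_zero mult_nonneg_nonneg add_nonneg_nonneg)
        finally show ?thesis using False n \<rho> w by (simp add: n_def)
      qed simp
    qed
    also have "\<dots> = ennreal (\<rho> powr (- (A / 2))) * (ennreal ?t * Lp_mass r w + ennreal (\<tau> powr r * \<rho> powr real CARD('n)) * (\<integral>\<^sup>+x. ?f (x - a) \<partial>lborel))"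
      unfolding Lp_mass_def by (simp add: nn_integral_add nn_integral_cmult)
    also have "(\<integral>\<^sup>+x. ?f (x - a) \<partial>lborel) = (\<integral>\<^sup>+x. ?f x \<partial>lborel)"
      using nn_integral_lborel_translation[of ?f "- a"] by (simp only: uminus_add_conv_diff) measurable
    also have "\<dots> = ennreal (C2 * (\<rho> / 2) powr (real CARD('n) - 2 * real CARD('n)))" using \<rho> by (intro C2(2)) simp
    also have "ennreal (\<tau> powr r * \<rho> powr real CARD('n)) * \<dots> = ennreal (C2 * 2 powr real CARD('n) * \<tau> powr r)"
    proof -
      have "(\<rho> / 2) powr (real CARD('n) - 2 * real CARD('n)) = \<rho> powr (- real CARD('n)) / 2 powr (- real CARD('n))" by (subst powr_divide) simp
      also have "\<dots> = \<rho> powr (- real CARD('n)) * 2 powr real CARD('n)" by (simp only: powr_minus divide_inverse inverse_inverse_eq)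
      finally have "\<rho> powr real CARD('n) * (\<rho> / 2) powr (real CARD('n) - 2 * real CARD('n)) = 2 powr real CARD('n)"
        using \<rho> by (simp add: powr_minus)
      then have "\<tau> powr r * \<rho> powr real CARD('n) * (C2 * (\<rho> / 2) powr (real CARD('n) - 2 * real CARD('n))) = C2 * 2 powr real CARD('n) * \<tau> powr r" by (simp add: mult_ac)
      then show ?thesis using C2(1) by (subst ennreal_mult[symmetric]) auto
    qed
    also have "ennreal (\<rho> powr (- (A / 2))) * (ennreal ?t * Lp_mass r w + ennreal (C2 * 2 powr real CARD('n) * \<tau> powr r)) \<le>
        ennreal (\<rho> powr (- (A / 2))) * (ennreal ?t * Lp_mass r w + ennreal (D * \<tau> powr r))"
      by (intro mult_left_mono add_left_mono ennreal_leI mult_right_mono) (auto simp: D_def)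
    finally show "(\<integral>\<^sup>+x. (if norm (x - a) < \<rho> then 0 else ennreal (w x powr p * norm (x - a) powr (- A))) \<partial>lborel) \<le>
      ennreal (\<rho> powr (- (A / 2))) * (ennreal ?t * Lp_mass r w + ennreal (D * \<tau> powr r))" .
  qed
qed

text \<open>The threshold \<open>\<delta>\<close> depends neither on the centre nor on the radius;
  this is the scale invariance of the critical power. First \<open>\<tau>\<close> makes the kernel
  term e/2, then \<open>\<delta>\<close> the mass term.\<close>

lemma far_field_small:
  assumes e: "e > 0"
  obtains \<delta> where "\<delta> > 0" "\<And>w a (\<rho>::real). w \<in> borel_measurable borel \<Longrightarrow> (\<And>x. 0 \<le> w x) \<Longrightarrow> 0 < \<rho> \<Longrightarrow> Lp_mass r (w :: real^'n \<Rightarrow> real) \<le> ennreal \<delta> \<Longrightarrow>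
     (\<integral>\<^sup>+x. (if norm (x - a) < \<rho> then 0 else ennreal (w x powr p * norm (x - a) powr (- A))) \<partial>lborel) \<le> ennreal (e * \<rho> powr (- (A / 2)))"
proof -
  obtain D where D: "D > 0" "\<And>w a (\<rho>::real) (\<tau>::real). w \<in> borel_measurable borel \<Longrightarrow> (\<And>x. 0 \<le> w x) \<Longrightarrow> 0 < \<rho> \<Longrightarrow> 0 < \<tau> \<Longrightarrow>
     (\<integral>\<^sup>+x. (if norm (x - a) < \<rho> then 0 else ennreal (w x powr p * norm (x - a) powr (- A))) \<partial>lborel) \<le>
     ennreal (\<rho> powr (- (A / 2))) * (ennreal (\<tau> powr (- (r / p))) * Lp_mass r (w :: real^'n \<Rightarrow> real) + ennreal (D * \<tau> powr r))"
    using far_field_bound by blast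
  define \<tau> where "\<tau> = (e / (2 * D)) powr (1 / r)"
  have \<tau>: "\<tau> > 0" "D * \<tau> powr r = e / 2" using e D(1) r_eq(4) by (auto simp: \<tau>_def powr_powr)
  define \<delta> where "\<delta> = \<tau> powr (r / p) * (e / 2)"
  have \<delta>: "\<delta> > 0" using \<tau> e by (simp add: \<delta>_def)
  show ?thesis
  proof (rule that[OF \<delta>])
    fix w :: "real^'n \<Rightarrow> real" and a and \<rho> :: real
    assume w: "w \<in> borel_measurable borel" "\<And>x. 0 \<le> w x" and \<rho>: "0 < \<rho>" and m: "Lp_mass r w \<le> ennreal \<delta>"
    have "ennreal (\<tau> powr (- (r / p))) * Lp_mass r w \<le> ennreal (\<tau> powr (- (r / p))) * ennreal \<delta>"
      using m by (rule mult_left_mono) simp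
    also have "\<dots> = ennreal (\<tau> powr (- (r / p)) * \<delta>)" using \<delta> by (intro ennreal_mult[symmetric]) auto
    also have "\<tau> powr (- (r / p)) * \<delta> = e / 2" using \<tau>(1) by (simp add: \<delta>_def powr_minus)
    finally have "ennreal (\<tau> powr (- (r / p))) * Lp_mass r w + ennreal (D * \<tau> powr r) \<le> ennreal (e / 2) + ennreal (e / 2)"
      unfolding \<tau>(2) by (rule add_right_mono)
    also have "\<dots> = ennreal e" using e by (simp add: ennreal_plus[symmetric] del: ennreal_plus)
    finally have "ennreal (\<rho> powr (- (A / 2))) * (ennreal (\<tau> powr (- (r / p))) * Lp_mass r w + ennreal (D * \<tau> powr r)) \<le> ennreal (\<rho> powr (- (A / 2))) * ennreal e"
      by (rule mult_left_mono) simp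
    also have "\<dots> = ennreal (e * \<rho> powr (- (A / 2)))" using e by (subst ennreal_mult[symmetric]) (auto simp: mult.commute)
    finally show "(\<integral>\<^sup>+x. (if norm (x - a) < \<rho> then 0 else ennreal (w x powr p * norm (x - a) powr (- A))) \<partial>lborel) \<le> ennreal (e * \<rho> powr (- (A / 2)))"
      using D(2)[OF w \<rho> \<tau>(1)] order_trans by blast
  qed
qed

lemma mass_tail:
  assumes "\<delta> > 0"
  obtains R where "R > 0" "Lp_mass r (\<lambda>x. if norm x < R then 0 else U x) \<le> ennreal \<delta>"
proof -
  have "(\<lambda>n. \<integral>\<^sup>+x. ennreal (\<bar>if norm x < real (Suc n) then 0 else U x\<bar> powr r) \<partial>lborel) \<longlonglongrightarrow> (\<integral>\<^sup>+x. 0 \<partial>(lborel :: (real^'n) measure))"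
  proof (rule nn_integral_dominated_convergence[where w="\<lambda>x. ennreal (\<bar>U x\<bar> powr r)"])
    show "AE x in lborel. (\<lambda>n. ennreal (\<bar>if norm x < real (Suc n) then 0 else U x\<bar> powr r)) \<longlonglongrightarrow> 0"
    proof (rule AE_I2)
      fix x :: "real^'n"
      have "eventually (\<lambda>n. norm x < real (Suc n)) sequentially" by real_asymp
      then have "eventually (\<lambda>n. ennreal (\<bar>if norm x < real (Suc n) then 0 else U x\<bar> powr r) = 0) sequentially"
        by eventually_elim simp
      then show "(\<lambda>n. ennreal (\<bar>if norm x < real (Suc n) then 0 else U x\<bar> powr r)) \<longlonglongrightarrow> 0" by (rule tendsto_eventually)
    qed
  qed (use mass in \<open>auto simp: Lp_mass_def\<close>)
  then have "(\<lambda>n. Lp_mass r (\<lambda>x. if norm x < real (Suc n) then 0 else U x)) \<longlonglongrightarrow> 0" by (simp add: Lp_mass_def)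
  then have "eventually (\<lambda>n. Lp_mass r (\<lambda>x. if norm x < real (Suc n) then 0 else U x) < ennreal \<delta>) sequentially"
    using assms by (intro order_tendstoD) auto
  then obtain n where "Lp_mass r (\<lambda>x. if norm x < real (Suc n) then 0 else U x) < ennreal \<delta>"
    by (auto simp: eventually_sequentially)
  then show ?thesis by (intro that[of "real (Suc n)"]) auto
qed

lemma local_mass:
  obtains B where "B \<ge> 0" "(\<integral>\<^sup>+x. (if norm x < R then ennreal (U x powr p) else 0) \<partial>lborel) \<le> ennreal B"
proof -
  have [measurable]: "ball (0::real^'n) R \<in> sets borel" by simp
  have "(\<integral>\<^sup>+x. (if norm x < R then ennreal (U x powr p) else 0) \<partial>lborel) \<le> (\<integral>\<^sup>+x. ennreal (M powr p) * indicator (ball (0::real^'n) R) x \<partial>lborel)"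
    using U p_gt_1 by (intro nn_integral_mono) (auto intro!: ennreal_leI powr_mono2)
  also have "\<dots> = ennreal (M powr p) * emeasure lborel (ball (0::real^'n) R)" by (simp add: nn_integral_cmult_indicator)
  also have "\<dots> = ennreal (M powr p * measure lborel (ball (0::real^'n) R))"
    using emeasure_bounded_finite[OF bounded_ball, of "0::real^'n" R] by (simp add: emeasure_eq_ennreal_measure ennreal_mult)
  finally show ?thesis by (intro that) auto
qed

end

context potential_bound
begin

lemma near_field:
  obtains D where "D \<ge> 0" "\<And>(a::real^'n) (\<rho>::real). \<rho> > 0 \<Longrightarrow>
    (\<integral>\<^sup>+x. pow_in A \<rho> (x - a) \<partial>lborel) = ennreal (D * \<rho> powr (2 * s))"
proof -
  obtain D where D: "D \<ge> 0" "\<And>\<rho>. \<rho> > 0 \<Longrightarrow>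
    (\<integral>\<^sup>+y. pow_in A \<rho> (y::real^'n) \<partial>lborel) = ennreal (D * \<rho> powr (real CARD('n) - A))"
    using nn_integral_norm_powr_ball[of A, where 'a="real^'n"] A s by auto
  have e: "real CARD('n) - A = 2 * s" by (simp add: A)
  show ?thesis
  proof (rule that[OF D(1)])
    fix a :: "real^'n" and \<rho> :: real assume "\<rho> > 0"
    then show "(\<integral>\<^sup>+x. pow_in A \<rho> (x - a) \<partial>lborel) = ennreal (D * \<rho> powr (2 * s))"
      using nn_integral_lborel_translation[of "\<lambda>y. pow_in A \<rho> (y::real^'n)" "- a"] D(2)[of \<rho>]
      by (simp only: uminus_add_conv_diff e) measurable
  qed
qed

lemma weighted_bound:
  assumes "\<rho> > 0" "L \<ge> 0" "\<And>x. norm (x - a) < \<rho> \<Longrightarrow> U x \<le> L"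
    and D: "\<And>(a::real^'n) (\<rho>::real). \<rho> > 0 \<Longrightarrow>
    (\<integral>\<^sup>+x. pow_in A \<rho> (x - a) \<partial>lborel) = ennreal (D * \<rho> powr (2 * s))" "D \<ge> 0"
  shows "(\<integral>\<^sup>+x. (if norm (x - a) < \<rho> then ennreal (U x powr p * norm (x - a) powr (- A)) else 0) \<partial>lborel) \<le> ennreal (L powr p * D * \<rho> powr (2 * s))"
proof -
  have "(\<integral>\<^sup>+x. (if norm (x - a) < \<rho> then ennreal (U x powr p * norm (x - a) powr (- A)) else 0) \<partial>lborel) \<le>
     (\<integral>\<^sup>+x. ennreal (L powr p) * pow_in A \<rho> (x - a) \<partial>lborel)"
  proof (intro nn_integral_mono)
    fix x
    show "(if norm (x - a) < \<rho> then ennreal (U x powr p * norm (x - a) powr (- A)) else 0) \<le>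
      ennreal (L powr p) * pow_in A \<rho> (x - a)"
    proof (cases "norm (x - a) < \<rho>")
      case True
      have "U x powr p \<le> L powr p" using assms(3)[OF True] U(1)[of x] p_gt_1 by (intro powr_mono2) auto
      then have "ennreal (U x powr p * norm (x - a) powr (- A)) \<le> ennreal (L powr p * norm (x - a) powr (- A))"
        by (intro ennreal_leI mult_right_mono) auto
      then show ?thesis using True by (simp add: ennreal_mult)
    qed simp
  qed
  also have "\<dots> = ennreal (L powr p) * ennreal (D * \<rho> powr (2 * s))"
    using assms(1) by (simp add: nn_integral_cmult D(1))
  also have "\<dots> = ennreal (L powr p * D * \<rho> powr (2 * s))" using D(2) by (simp add: ennreal_mult[symmetric] mult.assoc)
  finally show ?thesis .
qed

text \<open>The scale invariant rate. The function \<open>U(x) (d - |x - a|)\<^sup>A\<^sup>/\<^sup>2\<close> nearly attains its supremum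
  \<open>G\<close> over the ball of radius \<open>d = |a|/2\<close> at some point \<open>b\<close>; if \<open>G\<close> were not small, the
  potential bound at \<open>b\<close>, split at the intrinsic radius \<open>\<rho> \<sim> U(b)\<^sup>-\<^sup>2\<^sup>/\<^sup>A\<close>, would contradict the choice of \<open>b\<close>.\<close>

lemma decay_critical:
  assumes \<eta>: "\<eta> > 0"
  obtains R where "R > 0" "\<And>a. norm a \<ge> R \<Longrightarrow> U a \<le> \<eta> * norm a powr (- (A / 2))"
proof -
  define h where "h = A / 2"
  have h: "h > 0" "A = 2 * h" using A_pos by (simp_all add: h_def)
  obtain D where D: "D \<ge> 0" "\<And>(a::real^'n) (\<rho>::real). \<rho> > 0 \<Longrightarrow>
    (\<integral>\<^sup>+x. pow_in A \<rho> (x - a) \<partial>lborel) = ennreal (D * \<rho> powr (2 * s))"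
    using near_field by blast
  define \<kappa> where "\<kappa> = C * ((2 powr h) powr p * D) + 1"
  have \<kappa>: "\<kappa> > 0" using C D(1) by (simp add: \<kappa>_def add_nonneg_pos)
  \<comment> \<open>The supremum is taken over a ball of radius d = |a|/2, and passing from d^-h to
    |a|^-h costs 2^h.\<close>
  define \<eta>' where "\<eta>' = \<eta> * 2 powr (- h)"
  have \<eta>': "\<eta>' > 0" using \<eta> by (simp add: \<eta>'_def)
  \<comment> \<open>The first entry keeps the intrinsic radius \<open>\<rho>\<close> below half the
    distance \<open>t\<close> to the boundary of the ball, the second makes the contribution of the
    intrinsic ball at most \<open>\<Lambda>\<close>/8.\<close>
  define \<theta> where "\<theta> = min (\<eta>' powr (1 / h) / 2) ((1 / (8 * \<kappa>)) powr (1 / (2 * s)))"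
  have \<theta>: "\<theta> > 0" "\<theta> \<le> \<eta>' powr (1 / h) / 2" using \<eta>' \<kappa> by (auto simp: \<theta>_def)
  have \<theta>s: "\<kappa> * \<theta> powr (2 * s) \<le> 1 / 8"
  proof -
    have "\<theta> powr (2 * s) \<le> ((1 / (8 * \<kappa>)) powr (1 / (2 * s))) powr (2 * s)"
      using \<theta>(1) s by (intro powr_mono2) (auto simp: \<theta>_def)
    also have "\<dots> = 1 / (8 * \<kappa>)" using s \<kappa> by (simp add: powr_powr)
    finally show ?thesis using \<kappa> by (simp add: field_simps)
  qed
  \<comment> \<open>Chosen so that C e \<open>\<rho>\<close>^-h = \<open>\<Lambda>\<close>/16, once
    for the far part and once for the core |x| < \<open>R1\<close>.\<close>
  define e where "e = \<theta> powr h / (16 * C)"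
  have e: "e > 0" using \<theta>(1) C by (simp add: e_def)
  obtain \<delta> where \<delta>: "\<delta> > 0" "\<And>w a (\<rho>::real). w \<in> borel_measurable borel \<Longrightarrow> (\<And>x. 0 \<le> w x) \<Longrightarrow> 0 < \<rho> \<Longrightarrow> Lp_mass r (w::real^'n\<Rightarrow>real) \<le> ennreal \<delta> \<Longrightarrow>
     (\<integral>\<^sup>+x. (if norm (x - a) < \<rho> then 0 else ennreal (w x powr p * norm (x - a) powr (- A))) \<partial>lborel) \<le> ennreal (e * \<rho> powr (- (A / 2)))"
    using far_field_small[OF e] by blast
  obtain R1 where R1: "R1 > 0" "Lp_mass r (\<lambda>x. if norm x < R1 then 0 else U x) \<le> ennreal \<delta>"
    using mass_tail[OF \<delta>(1)] by blast
  define w where "w = (\<lambda>x. if norm x < R1 then 0 else U x)"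
  have w: "w \<in> borel_measurable borel" "\<And>x. 0 \<le> w x" unfolding w_def using U by (measurable, auto)
  obtain B where B: "B \<ge> 0" "(\<integral>\<^sup>+x. (if norm x < R1 then ennreal (U x powr p) else 0) \<partial>lborel) \<le> ennreal B"
    using local_mass by blast
  \<comment> \<open>|a| >= 4 \<open>R1\<close> keeps the core at distance at least d/2 from b; the
    second entry makes its contribution B (d/2)^-A at most e (d/2)^-h.\<close>
  define R where "R = max (4 * R1) (4 * (B / e) powr (1 / h))"
  show ?thesis
  proof (rule that[of R])
    show "R > 0" using R1 by (simp add: R_def less_max_iff_disj)
    fix a :: "real^'n" assume aR: "norm a \<ge> R"
    define d where "d = norm a / 2"
    have a: "norm a \<ge> 4 * R1" "norm a \<ge> 4 * (B / e) powr (1 / h)" using aR by (auto simp: R_def)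
    have d: "d > 0" using a(1) R1(1) unfolding d_def by linarith
    let ?S = "ball a d"
    define g where "g = (\<lambda>x. U x * (d - norm (x - a)) powr h)"
    have in_S: "norm (x - a) < d" if "x \<in> ?S" for x using that by (simp add: dist_norm norm_minus_commute)
    have g_le: "g x \<le> M * d powr h" if "x \<in> ?S" for x
      unfolding g_def using U[of x] in_S[OF that] h by (intro mult_mono powr_mono2) auto
    have bdd: "bdd_above (g ` ?S)" using g_le by (intro bdd_aboveI2)
    define G where "G = (SUP x\<in>?S. g x)"
    have gG: "g x \<le> G" if "x \<in> ?S" for x unfolding G_def using that bdd by (rule cSUP_upper)
    have G: "G \<le> \<eta>'"
    proof (rule ccontr)
      assume "\<not> G \<le> \<eta>'"
      then have G': "G > \<eta>'" "G > 0" using \<eta>' by auto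
      have "\<exists>b\<in>?S. G / 2 < g b"
        using less_cSUP_iff[OF _ bdd, of "G / 2"] G' d unfolding G_def[symmetric] by auto
      then obtain b where b: "b \<in> ?S" "G / 2 < g b" by blast
      define t where "t = d - norm (b - a)"
      have t: "t > 0" "t \<le> d" using in_S[OF b(1)] by (auto simp: t_def)
      \<comment> \<open>The size of U near b: near-maximality of b gives U(b) >
        \<open>\<Lambda>\<close>/2, and U <= 2^h \<open>\<Lambda>\<close> on the ball of radius
        \<open>\<rho>\<close> around b. The contradiction will be \<open>\<Lambda>\<close>/2 < U(b)
        <= \<open>\<Lambda>\<close>/8 + \<open>\<Lambda>\<close>/8.\<close>
      define \<Lambda> where "\<Lambda> = G * t powr (- h)"
      have \<Lambda>: "\<Lambda> > 0" using G' t by (simp add: \<Lambda>_def)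
      have Ub: "U b > \<Lambda> / 2"
      proof -
        have "G / 2 < U b * t powr h" using b(2) by (simp add: g_def t_def)
        then have "G / 2 * t powr (- h) < U b * t powr h * t powr (- h)" using t by (intro mult_strict_right_mono) auto
        also have "\<dots> = U b" using t by (simp add: powr_minus)
        finally show ?thesis by (simp add: \<Lambda>_def)
      qed
      \<comment> \<open>With this radius both \<open>\<Lambda>\<close>^p \<open>\<rho>\<close>^(2s)
        and \<open>\<rho>\<close>^-h are multiples of \<open>\<Lambda>\<close>, because p - 1 =
        2s/h.\<close>
      define \<rho> where "\<rho> = \<theta> * \<Lambda> powr (- (1 / h))"
      have \<rho>: "\<rho> > 0" using \<theta> \<Lambda> by (simp add: \<rho>_def)
      have \<Lambda>r: "\<Lambda> powr (- (1 / h)) = G powr (- (1 / h)) * t"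
        using h t by (simp add: \<Lambda>_def powr_mult powr_powr)
      have \<rho>t: "\<rho> \<le> t / 2"
      proof -
        have "G powr (- (1 / h)) \<le> \<eta>' powr (- (1 / h))" using G' \<eta>' h by (intro powr_mono2') auto
        then have "\<theta> * G powr (- (1 / h)) \<le> (\<eta>' powr (1 / h) / 2) * \<eta>' powr (- (1 / h))" using \<theta> by (intro mult_mono) auto
        also have "\<dots> = 1 / 2" using \<eta>' by (simp add: powr_minus)
        finally have "\<theta> * G powr (- (1 / h)) * t \<le> 1 / 2 * t" using t by (intro mult_right_mono) auto
        then show ?thesis by (simp add: \<rho>_def \<Lambda>r mult.assoc)
      qed
      have near_le: "U x \<le> 2 powr h * \<Lambda>" if "norm (x - b) < \<rho>" for x
      proof -
        have "norm (x - a) \<le> norm (x - b) + norm (b - a)" using norm_triangle_ineq[of "x - b" "b - a"] by simp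
        then have x: "t / 2 \<le> d - norm (x - a)" using that \<rho>t by (simp add: t_def)
        then have "x \<in> ?S" using t by (simp add: dist_norm norm_minus_commute)
        then have "U x * (d - norm (x - a)) powr h \<le> G" using gG by (simp add: g_def)
        moreover have "U x * (t / 2) powr h \<le> U x * (d - norm (x - a)) powr h"
          using x t h U by (intro mult_left_mono powr_mono2) auto
        ultimately have "U x * (t / 2) powr h \<le> G" by linarith
        then have "U x * (t / 2) powr h * (t / 2) powr (- h) \<le> G * (t / 2) powr (- h)" by (intro mult_right_mono) auto
        moreover have "U x * (t / 2) powr h * (t / 2) powr (- h) = U x" using t by (simp add: powr_minus)
        moreover have "(t / 2) powr (- h) = 2 powr h * t powr (- h)"
        proof -
          have "(t / 2) powr (- h) = t powr (- h) / 2 powr (- h)" by (rule powr_divide)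
          then show ?thesis by (simp only: powr_minus divide_inverse inverse_inverse_eq mult.commute)
        qed
        ultimately have "U x \<le> G * (2 powr h * t powr (- h))" by (simp only:)
        then show ?thesis by (simp add: \<Lambda>_def mult_ac)
      qed
      have \<rho>s: "\<Lambda> powr p * \<rho> powr (2 * s) = \<theta> powr (2 * s) * \<Lambda>"
      proof -
        have "- (1 / h) * (2 * s) = 1 - p" using p_diff A_pos by (simp add: h_def field_simps)
        then have "\<rho> powr (2 * s) = \<theta> powr (2 * s) * \<Lambda> powr (1 - p)" by (simp only: \<rho>_def powr_mult powr_powr)
        moreover have "\<Lambda> powr p * \<Lambda> powr (1 - p) = \<Lambda>" using \<Lambda> by (simp add: powr_add[symmetric])
        ultimately show ?thesis by (simp add: mult.left_commute)
      qed
      have \<rho>h: "\<rho> powr (- h) = \<theta> powr (- h) * \<Lambda>"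
      proof -
        have "- (1 / h) * (- h) = 1" using h by simp
        then show ?thesis using \<Lambda> by (simp only: \<rho>_def powr_mult powr_powr powr_one less_imp_le)
      qed
      let ?near = "\<lambda>x. if norm (x - b) < \<rho> then ennreal (U x powr p * norm (x - b) powr (- A)) else 0"
      let ?far = "\<lambda>x. if norm (x - b) < \<rho> then 0 else ennreal (w x powr p * norm (x - b) powr (- A))"
      \<comment> \<open>On the bounded core the mass of U is not small; its distance from b controls
        it instead.\<close>
      let ?core = "\<lambda>x. ennreal ((d / 2) powr (- A)) * (if norm x < R1 then ennreal (U x powr p) else 0)"
      have I1: "(\<integral>\<^sup>+x. ?near x \<partial>lborel) \<le> ennreal ((2 powr h * \<Lambda>) powr p * D * \<rho> powr (2 * s))"
        using \<rho> \<Lambda> near_le by (intro weighted_bound D) auto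
      have I2: "(\<integral>\<^sup>+x. ?far x \<partial>lborel) \<le> ennreal (e * \<rho> powr (- h))"
        using \<delta>(2)[OF w \<rho>] R1(2) unfolding w_def[symmetric] h_def by blast
      have I3: "(\<integral>\<^sup>+x. ?core x \<partial>lborel) \<le> ennreal (e * \<rho> powr (- h))"
      proof -
        have "(B / e) powr (1 / h) \<le> d / 2" using a(2) by (simp add: d_def)
        then have "((B / e) powr (1 / h)) powr h \<le> (d / 2) powr h" using h by (intro powr_mono2) auto
        then have "B / e \<le> (d / 2) powr h" using h B(1) e by (simp add: powr_powr)
        then have Be: "B \<le> e * (d / 2) powr h" using e by (simp add: field_simps)
        have "(\<integral>\<^sup>+x. ?core x \<partial>lborel) = ennreal ((d / 2) powr (- A)) * (\<integral>\<^sup>+x. (if norm x < R1 then ennreal (U x powr p) else 0) \<partial>lborel)"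
          by (rule nn_integral_cmult) measurable
        also have "\<dots> \<le> ennreal ((d / 2) powr (- A)) * ennreal B" by (intro mult_left_mono B(2)) simp
        also have "\<dots> = ennreal ((d / 2) powr (- A) * B)" using B(1) by (simp add: ennreal_mult)
        also have "\<dots> \<le> ennreal ((d / 2) powr (- A) * (e * (d / 2) powr h))" by (intro ennreal_leI mult_left_mono Be) simp
        also have "(d / 2) powr (- A) * (e * (d / 2) powr h) = e * (d / 2) powr (- h)"
        proof -
          have "- A + h = - h" by (simp add: h(2))
          then have "(d / 2) powr (- A) * (d / 2) powr h = (d / 2) powr (- h)" by (simp only: powr_add[symmetric])
          then show ?thesis by (simp add: mult.left_commute)
        qed
        also have "ennreal (e * (d / 2) powr (- h)) \<le> ennreal (e * \<rho> powr (- h))"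
          using \<rho>t t \<rho> e h by (intro ennreal_leI mult_left_mono powr_mono2') auto
        finally show ?thesis .
      qed
      have "(\<integral>\<^sup>+x. ennreal (U x powr p * norm (x - b) powr (- A)) \<partial>lborel) \<le> (\<integral>\<^sup>+x. ?near x + (?far x + ?core x) \<partial>lborel)"
      proof (intro nn_integral_mono)
        fix x :: "real^'n"
        show "ennreal (U x powr p * norm (x - b) powr (- A)) \<le> ?near x + (?far x + ?core x)"
        proof (cases "norm (x - b) < \<rho>")
          case False
          show ?thesis
          proof (cases "norm x < R1")
            case True
            have "norm a - norm (b - a) \<le> norm b" using norm_triangle_ineq2[of a "a - b"] by (simp add: norm_minus_commute)
            then have "d \<le> norm b" using in_S[OF b(1)] by (simp add: d_def)
            moreover have "norm x \<le> d / 2" using True a(1) by (simp add: d_def)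
            ultimately have "d / 2 \<le> norm (x - b)" using norm_triangle_ineq2[of b x] by (simp add: norm_minus_commute)
            then have "norm (x - b) powr (- A) \<le> (d / 2) powr (- A)" using d A_pos by (intro powr_mono2') auto
            then have "ennreal (U x powr p * norm (x - b) powr (- A)) \<le> ennreal (U x powr p * (d / 2) powr (- A))"
              by (intro ennreal_leI mult_left_mono) auto
            also have "\<dots> = ?core x" using True by (simp add: ennreal_mult mult.commute)
            finally show ?thesis by (rule add_increasing[OF zero_le add_increasing[OF zero_le]])
          next
            case nx: False
            then show ?thesis using False by (simp add: w_def)
          qed
        qed simp
      qed
      also have "\<dots> = (\<integral>\<^sup>+x. ?near x \<partial>lborel) + ((\<integral>\<^sup>+x. ?far x \<partial>lborel) + (\<integral>\<^sup>+x. ?core x \<partial>lborel))"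
        using w(1) by (simp add: nn_integral_add)
      also have "\<dots> \<le> ennreal ((2 powr h * \<Lambda>) powr p * D * \<rho> powr (2 * s)) + (ennreal (e * \<rho> powr (- h)) + ennreal (e * \<rho> powr (- h)))"
        by (intro add_mono I1 I2 I3)
      also have "\<dots> = ennreal ((2 powr h * \<Lambda>) powr p * D * \<rho> powr (2 * s) + (e * \<rho> powr (- h) + e * \<rho> powr (- h)))"
        using e D(1) by (simp add: ennreal_plus[symmetric] del: ennreal_plus)
      finally have "ennreal (U b) \<le> ennreal C * ennreal ((2 powr h * \<Lambda>) powr p * D * \<rho> powr (2 * s) + (e * \<rho> powr (- h) + e * \<rho> powr (- h)))"
        using bound[of b] by (meson mult_left_mono order_trans zero_le)
      also have "\<dots> = ennreal (C * ((2 powr h * \<Lambda>) powr p * D * \<rho> powr (2 * s) + (e * \<rho> powr (- h) + e * \<rho> powr (- h))))"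
        using C e D(1) by (simp add: ennreal_mult)
      finally have "U b \<le> C * ((2 powr h * \<Lambda>) powr p * D * \<rho> powr (2 * s) + (e * \<rho> powr (- h) + e * \<rho> powr (- h)))"
        using C e D(1) by (subst (asm) ennreal_le_iff) auto
      also have "\<dots> = C * ((2 powr h) powr p * D) * (\<Lambda> powr p * \<rho> powr (2 * s)) + C * 2 * e * \<rho> powr (- h)"
        by (simp add: powr_mult algebra_simps)
      also have "\<dots> = C * ((2 powr h) powr p * D) * \<theta> powr (2 * s) * \<Lambda> + C * 2 * e * \<theta> powr (- h) * \<Lambda>"
        by (simp add: \<rho>s \<rho>h)
      also have "C * 2 * e * \<theta> powr (- h) = 1 / 8" using C \<theta>(1) by (simp add: e_def powr_minus)
      also have "C * ((2 powr h) powr p * D) * \<theta> powr (2 * s) * \<Lambda> + 1 / 8 * \<Lambda> \<le> 1 / 8 * \<Lambda> + 1 / 8 * \<Lambda>"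
      proof -
        have "C * ((2 powr h) powr p * D) * \<theta> powr (2 * s) \<le> \<kappa> * \<theta> powr (2 * s)" by (intro mult_right_mono) (auto simp: \<kappa>_def)
        then have "C * ((2 powr h) powr p * D) * \<theta> powr (2 * s) \<le> 1 / 8" using \<theta>s by linarith
        then have "C * ((2 powr h) powr p * D) * \<theta> powr (2 * s) * \<Lambda> \<le> 1 / 8 * \<Lambda>" using \<Lambda> by (intro mult_right_mono) auto
        then show ?thesis by simp
      qed
      finally show False using Ub \<Lambda> by linarith
    qed
    have "U a * d powr h \<le> \<eta>'" using gG[of a] G d by (simp add: g_def)
    then have "U a * d powr h * d powr (- h) \<le> \<eta>' * d powr (- h)" by (intro mult_right_mono) auto
    moreover have "U a * d powr h * d powr (- h) = U a" using d by (simp add: powr_minus)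
    moreover have "\<eta>' * d powr (- h) = \<eta> * norm a powr (- h)"
    proof -
      have "d powr (- h) = norm a powr (- h) / 2 powr (- h)" unfolding d_def by (rule powr_divide)
      then show ?thesis by (simp add: \<eta>'_def)
    qed
    ultimately have "U a \<le> \<eta> * norm a powr (- h)" by (simp only:)
    then show "U a \<le> \<eta> * norm a powr (- (A / 2))" by (simp only: h_def)
  qed
qed

text \<open>For |x| >= R the power is linearised to U^p <= \<open>\<epsilon>\<close> |x|^(-2s) U,
  with small \<open>\<epsilon>\<close> by \<open>decay_critical\<close>. The Riesz potential of
  |x|^(-2s) times either term of the weight is bounded by a multiple of that term, so the supremum K
  of U over the weight satisfies K <= const + K/2. The second term of the weight makes K finite
  beforehand, so that K/2 can be subtracted.\<close>

lemma decay_subcritical: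
  assumes \<alpha>: "0 < \<alpha>" "\<alpha> < A"
  obtains K R where "K > 0" "R > 0" "\<And>a. norm a \<ge> R \<Longrightarrow> U a \<le> K * norm a powr (- \<alpha>)"
proof -
  define h where "h = A / 2"
  have h: "0 < h" "h < A" using A_pos by (simp_all add: h_def)
  obtain D1 where D1: "D1 > 0" "\<And>a::real^'n. a \<noteq> 0 \<Longrightarrow>
    (\<integral>\<^sup>+x. ennreal (norm (x - a) powr (- A) * norm x powr (- (2 * s + \<alpha>))) \<partial>lborel) \<le> ennreal (D1 * norm a powr (- \<alpha>))"
    using riesz_potential_of_power[OF s(1) A \<alpha>] by blast
  obtain D2 where D2: "D2 > 0" "\<And>a::real^'n. a \<noteq> 0 \<Longrightarrow>
    (\<integral>\<^sup>+x. ennreal (norm (x - a) powr (- A) * norm x powr (- (2 * s + h))) \<partial>lborel) \<le> ennreal (D2 * norm a powr (- h))"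
    using riesz_potential_of_power[OF s(1) A h] by blast
  define \<epsilon> where "\<epsilon> = 1 / (2 * C * (D1 + D2))"
  have \<epsilon>: "\<epsilon> > 0" "C * \<epsilon> * (D1 + D2) = 1 / 2" using C D1(1) D2(1) by (simp_all add: \<epsilon>_def add_pos_pos)
  define \<eta> where "\<eta> = \<epsilon> powr (1 / (p - 1))"
  have \<eta>: "\<eta> > 0" "\<eta> powr (p - 1) = \<epsilon>" using \<epsilon> p_gt_1 by (simp_all add: \<eta>_def powr_powr)
  obtain R where R: "R > 0" "\<And>a. norm a \<ge> R \<Longrightarrow> U a \<le> \<eta> * norm a powr (- h)"
    using decay_critical[OF \<eta>(1)] unfolding h_def by blast
  obtain B where B: "B \<ge> 0" "(\<integral>\<^sup>+x. (if norm x < R then ennreal (U x powr p) else 0) \<partial>lborel) \<le> ennreal B"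
    using local_mass by blast
  \<comment> \<open>\<open>E1\<close> covers the contribution of |y| < \<open>R\<close> at points
    |x| >= 2 \<open>R\<close>; \<open>E2\<close> covers the points with \<open>R\<close> <= |x| < 2
    \<open>R\<close>, where only U <= M is used.\<close>
  define E1 where "E1 = C * 2 powr A * B * R powr (\<alpha> - A)"
  define E2 where "E2 = M * (2 * R) powr \<alpha>"
  have M0: "M \<ge> 0" using U[of 0] by linarith
  have E: "E1 \<ge> 0" "E2 \<ge> 0" using B C M0 by (auto simp: E1_def E2_def)
  have outer: "U x powr p \<le> \<epsilon> * norm x powr (- (2 * s)) * U x" if "norm x \<ge> R" for x
  proof -
    have "U x powr (p - 1) \<le> (\<eta> * norm x powr (- h)) powr (p - 1)"
      using R(2)[OF that] U(1)[of x] p_gt_1 by (intro powr_mono2) auto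
    also have "\<dots> = \<epsilon> * norm x powr (- (2 * s))"
    proof -
      have "- h * (p - 1) = - (2 * s)" using A_pos by (simp add: p_diff h_def)
      then show ?thesis by (simp only: powr_mult powr_powr \<eta>(2))
    qed
    finally have "U x * U x powr (p - 1) \<le> U x * (\<epsilon> * norm x powr (- (2 * s)))" using U by (intro mult_left_mono) auto
    then show ?thesis using powr_mult_base[OF U(1)[of x], of "p - 1"] by (simp add: mult_ac)
  qed
  have key: "U a \<le> 2 * (E1 + E2) * (norm a powr (- \<alpha>) + m * norm a powr (- h))"
    if m: "0 < m" and a: "norm a \<ge> R" for m a
  proof -
    define \<omega> where "\<omega> = (\<lambda>x::real^'n. norm x powr (- \<alpha>) + m * norm x powr (- h))"
    have \<omega>: "\<omega> x > 0" if "x \<noteq> 0" for x using that m by (simp add: \<omega>_def add_pos_nonneg)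
    let ?S = "{x::real^'n. norm x \<ge> R}"
    have nz: "x \<noteq> 0" if "x \<in> ?S" for x using that R(1) by auto
    have le1: "U x / \<omega> x \<le> \<eta> / m" if "x \<in> ?S" for x
    proof -
      have "m * U x \<le> m * (\<eta> * norm x powr (- h))" using R(2)[of x] that m by (intro mult_left_mono) auto
      also have "\<dots> \<le> \<eta> * \<omega> x" using \<eta> by (simp add: \<omega>_def algebra_simps)
      finally show ?thesis using m \<omega>[OF nz[OF that]] by (simp add: field_simps)
    qed
    then have bdd: "bdd_above ((\<lambda>x. U x / \<omega> x) ` ?S)" by (intro bdd_aboveI2)
    define K where "K = (SUP x\<in>?S. U x / \<omega> x)"
    have UK: "U x \<le> K * \<omega> x" if "x \<in> ?S" for x
    proof -
      have "U x / \<omega> x \<le> K" unfolding K_def using that bdd by (rule cSUP_upper)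
      then show ?thesis using \<omega>[OF nz[OF that]] by (simp add: field_simps)
    qed
    have aS: "a \<in> ?S" using a by simp
    have K0: "K \<ge> 0"
    proof -
      have "0 \<le> U a / \<omega> a" using U \<omega>[OF nz[OF aS]] by (simp add: less_imp_le)
      also have "\<dots> \<le> K" unfolding K_def using aS bdd by (rule cSUP_upper)
      finally show ?thesis .
    qed
    have step: "U x / \<omega> x \<le> E1 + E2 + K / 2" if x: "x \<in> ?S" for x
    proof (cases "norm x < 2 * R")
      case True
      have "E2 * norm x powr (- \<alpha>) \<ge> M"
      proof -
        have "norm x powr \<alpha> \<le> (2 * R) powr \<alpha>" using True \<alpha> by (intro powr_mono2) auto
        then have "norm x powr \<alpha> * norm x powr (- \<alpha>) \<le> (2 * R) powr \<alpha> * norm x powr (- \<alpha>)" by (intro mult_right_mono) auto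
        then have "1 \<le> (2 * R) powr \<alpha> * norm x powr (- \<alpha>)" using nz[OF x] by (simp add: powr_minus)
        from mult_left_mono[OF this M0] show ?thesis by (simp add: E2_def mult_ac)
      qed
      then have "U x \<le> E2 * norm x powr (- \<alpha>)" using U(2)[of x] by linarith
      also have "\<dots> \<le> E2 * \<omega> x" using E m by (intro mult_left_mono) (auto simp: \<omega>_def)
      finally have "U x / \<omega> x \<le> E2" using \<omega>[OF nz[OF x]] by (simp add: field_simps)
      then show ?thesis using E K0 by linarith
    next
      case far: False
      have xp: "norm x > 0" using nz[OF x] by simp
      let ?q1 = "\<lambda>y::real^'n. ennreal ((norm x / 2) powr (- A)) * (if norm y < R then ennreal (U y powr p) else 0)"
      let ?q2 = "\<lambda>y. ennreal (norm (y - x) powr (- A) * norm y powr (- (2 * s + \<alpha>)))"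
      let ?q3 = "\<lambda>y. ennreal (norm (y - x) powr (- A) * norm y powr (- (2 * s + h)))"
      have "(\<integral>\<^sup>+y. ennreal (U y powr p * norm (y - x) powr (- A)) \<partial>lborel) \<le>
         (\<integral>\<^sup>+y. ?q1 y + (ennreal (\<epsilon> * K) * ?q2 y + ennreal (\<epsilon> * K * m) * ?q3 y) \<partial>lborel)"
      proof (intro nn_integral_mono)
        fix y :: "real^'n"
        show "ennreal (U y powr p * norm (y - x) powr (- A)) \<le> ?q1 y + (ennreal (\<epsilon> * K) * ?q2 y + ennreal (\<epsilon> * K * m) * ?q3 y)"
        proof (cases "norm y < R")
          case True
          have "norm x / 2 \<le> norm (y - x)" using norm_triangle_ineq2[of x y] True far by (simp add: norm_minus_commute)
          then have "norm (y - x) powr (- A) \<le> (norm x / 2) powr (- A)" using xp A_pos by (intro powr_mono2') auto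
          then have "ennreal (U y powr p * norm (y - x) powr (- A)) \<le> ennreal (U y powr p * (norm x / 2) powr (- A))"
            by (intro ennreal_leI mult_left_mono) auto
          also have "\<dots> = ?q1 y" using True by (simp add: ennreal_mult mult.commute)
          finally show ?thesis by (rule add_increasing2[OF zero_le])
        next
          case False
          have "U y powr p \<le> \<epsilon> * norm y powr (- (2 * s)) * U y" using outer[of y] False by simp
          also have "\<dots> \<le> \<epsilon> * norm y powr (- (2 * s)) * (K * \<omega> y)"
            using UK[of y] False \<epsilon> by (intro mult_left_mono) auto
          also have "\<dots> = \<epsilon> * K * (norm y powr (- (2 * s)) * norm y powr (- \<alpha>)) + \<epsilon> * K * m * (norm y powr (- (2 * s)) * norm y powr (- h))"
            by (simp add: \<omega>_def algebra_simps)
          also have "\<dots> = \<epsilon> * K * norm y powr (- (2 * s + \<alpha>)) + \<epsilon> * K * m * norm y powr (- (2 * s + h))"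
            by (simp only: powr_add[symmetric] minus_add_distrib)
          finally have "U y powr p * norm (y - x) powr (- A) \<le>
             (\<epsilon> * K * norm y powr (- (2 * s + \<alpha>)) + \<epsilon> * K * m * norm y powr (- (2 * s + h))) * norm (y - x) powr (- A)"
            by (rule mult_right_mono) simp
          also have "\<dots> = \<epsilon> * K * (norm (y - x) powr (- A) * norm y powr (- (2 * s + \<alpha>))) + \<epsilon> * K * m * (norm (y - x) powr (- A) * norm y powr (- (2 * s + h)))"
            by (simp only: algebra_simps)
          finally have "ennreal (U y powr p * norm (y - x) powr (- A)) \<le>
             ennreal (\<epsilon> * K * (norm (y - x) powr (- A) * norm y powr (- (2 * s + \<alpha>))) + \<epsilon> * K * m * (norm (y - x) powr (- A) * norm y powr (- (2 * s + h))))"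
            by (rule ennreal_leI)
          also have "\<dots> = ennreal (\<epsilon> * K) * ?q2 y + ennreal (\<epsilon> * K * m) * ?q3 y"
            using \<epsilon>(1) K0 m by (simp only: ennreal_plus ennreal_mult mult_nonneg_nonneg powr_ge_zero less_imp_le)
          finally show ?thesis by (rule add_increasing[OF zero_le])
        qed
      qed
      also have "\<dots> = ennreal ((norm x / 2) powr (- A)) * (\<integral>\<^sup>+y. (if norm y < R then ennreal (U y powr p) else 0) \<partial>lborel) +
         (ennreal (\<epsilon> * K) * (\<integral>\<^sup>+y. ?q2 y \<partial>lborel) + ennreal (\<epsilon> * K * m) * (\<integral>\<^sup>+y. ?q3 y \<partial>lborel))"
        by (simp add: nn_integral_add nn_integral_cmult)
      also have "\<dots> \<le> ennreal ((norm x / 2) powr (- A)) * ennreal B +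
         (ennreal (\<epsilon> * K) * ennreal (D1 * norm x powr (- \<alpha>)) + ennreal (\<epsilon> * K * m) * ennreal (D2 * norm x powr (- h)))"
        by (intro add_mono mult_left_mono B(2) D1(2) D2(2) nz[OF x]) auto
      also have "\<dots> = ennreal ((norm x / 2) powr (- A) * B + (\<epsilon> * K * (D1 * norm x powr (- \<alpha>)) + \<epsilon> * K * m * (D2 * norm x powr (- h))))"
        using B(1) \<epsilon>(1) K0 D1(1) D2(1) m
        by (simp only: ennreal_plus ennreal_mult mult_nonneg_nonneg powr_ge_zero less_imp_le add_nonneg_nonneg)
      finally have "ennreal (U x) \<le> ennreal C * ennreal ((norm x / 2) powr (- A) * B + (\<epsilon> * K * (D1 * norm x powr (- \<alpha>)) + \<epsilon> * K * m * (D2 * norm x powr (- h))))"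
        using bound[of x] by (meson mult_left_mono order_trans zero_le)
      also have "\<dots> = ennreal (C * ((norm x / 2) powr (- A) * B + (\<epsilon> * K * (D1 * norm x powr (- \<alpha>)) + \<epsilon> * K * m * (D2 * norm x powr (- h)))))"
        using C B(1) \<epsilon>(1) K0 D1(1) D2(1) m by (intro ennreal_mult[symmetric]) (auto intro!: add_nonneg_nonneg mult_nonneg_nonneg)
      finally have "U x \<le> C * ((norm x / 2) powr (- A) * B + (\<epsilon> * K * (D1 * norm x powr (- \<alpha>)) + \<epsilon> * K * m * (D2 * norm x powr (- h))))"
        using C B(1) \<epsilon>(1) K0 D1(1) D2(1) m by (subst (asm) ennreal_le_iff) (auto intro!: add_nonneg_nonneg mult_nonneg_nonneg)
      also have "\<dots> \<le> C * ((norm x / 2) powr (- A) * B + (\<epsilon> * K * ((D1 + D2) * norm x powr (- \<alpha>)) + \<epsilon> * K * m * ((D1 + D2) * norm x powr (- h))))"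
        using C \<epsilon>(1) K0 D1(1) D2(1) m by (intro mult_left_mono add_mono mult_right_mono) auto
      also have "\<dots> = C * B * (norm x / 2) powr (- A) + (C * \<epsilon> * (D1 + D2)) * K * \<omega> x"
        by (simp add: \<omega>_def algebra_simps)
      also have "\<dots> = C * B * (norm x / 2) powr (- A) + K / 2 * \<omega> x" unfolding \<epsilon>(2) by simp
      also have "C * B * (norm x / 2) powr (- A) \<le> E1 * \<omega> x"
      proof -
        have "(norm x / 2) powr (- A) = norm x powr (- A) / 2 powr (- A)" by (rule powr_divide)
        then have q: "(norm x / 2) powr (- A) = 2 powr A * norm x powr (- A)"
          by (simp only: powr_minus divide_inverse inverse_inverse_eq mult.commute)
        have "- A = (\<alpha> - A) + - \<alpha>" by simp
        then have "norm x powr (- A) = norm x powr (\<alpha> - A) * norm x powr (- \<alpha>)" by (metis powr_add)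
        also have "\<dots> \<le> R powr (\<alpha> - A) * norm x powr (- \<alpha>)"
          using x R(1) \<alpha> by (intro mult_right_mono powr_mono2') auto
        finally have "2 powr A * norm x powr (- A) \<le> 2 powr A * (R powr (\<alpha> - A) * norm x powr (- \<alpha>))" by (intro mult_left_mono) auto
        then have "C * B * (norm x / 2) powr (- A) \<le> C * B * (2 powr A * (R powr (\<alpha> - A) * norm x powr (- \<alpha>)))"
          unfolding q using C B(1) by (intro mult_left_mono) auto
        also have "\<dots> = E1 * norm x powr (- \<alpha>)" by (simp add: E1_def mult_ac)
        also have "\<dots> \<le> E1 * \<omega> x" using E m by (intro mult_left_mono) (auto simp: \<omega>_def)
        finally show ?thesis .
      qed
      finally have "U x \<le> (E1 + K / 2) * \<omega> x" by (simp add: algebra_simps)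
      then have "U x / \<omega> x \<le> E1 + K / 2" using \<omega>[OF nz[OF x]] by (simp add: pos_divide_le_eq)
      then show ?thesis using E by linarith
    qed
    have "K \<le> E1 + E2 + K / 2"
      unfolding K_def using aS by (intro cSUP_least) (auto intro: step[unfolded K_def])
    then have "K \<le> 2 * (E1 + E2)" by simp
    then have "K * \<omega> a \<le> 2 * (E1 + E2) * \<omega> a" using \<omega>[OF nz[OF aS]] by (intro mult_right_mono) auto
    then show ?thesis using UK[OF aS] by (simp add: \<omega>_def)
  qed
  define K where "K = 2 * (E1 + E2) + 1"
  show ?thesis
  proof (rule that[of K R])
    show "K > 0" "R > 0" using E R(1) by (auto simp: K_def)
    fix a :: "real^'n" assume a: "norm a \<ge> R"
    then have na: "norm a > 0" using R(1) by linarith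
    \<comment> \<open>The bound \<open>key\<close> is uniform in \<open>m\<close>, which may
      therefore depend on \<open>a\<close>: here the second term of the weight, multiplied by 2 (E1
      + E2), is at most |a|^-\<open>\<alpha>\<close>.\<close>
    define m where "m = norm a powr (- \<alpha>) / (norm a powr (- h) * (2 * (E1 + E2) + 1))"
    have m: "m > 0" using na E by (simp add: m_def)
    have "2 * (E1 + E2) * (m * norm a powr (- h)) = norm a powr (- \<alpha>) * (2 * (E1 + E2) / (2 * (E1 + E2) + 1))"
      using na by (simp add: m_def)
    also have "\<dots> \<le> norm a powr (- \<alpha>) * 1" using E by (intro mult_left_mono) auto
    finally have "2 * (E1 + E2) * (norm a powr (- \<alpha>) + m * norm a powr (- h)) \<le> K * norm a powr (- \<alpha>)"
      by (simp add: K_def algebra_simps)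
    then show "U a \<le> K * norm a powr (- \<alpha>)" using key[OF m a] by linarith
  qed
qed

text \<open>At a rate \<open>\<alpha>\<close> between N/p and A, an interval that is nonempty since
  A p = N + 2s > N, the power U^p is integrable. The part of the potential away from a then decays
  like the kernel, and the part near a is of order |a|^(2s - \<open>\<alpha>\<close> p), which is at
  most |a|^-A because \<open>\<alpha>\<close> p > N = A + 2s.\<close>

lemma decay:
  obtains K R where "K > 0" "R > 0" "\<And>a. norm a \<ge> R \<Longrightarrow> U a \<le> K * norm a powr (- A)"
proof -
  define c where "c = real CARD('n) / p"
  define \<alpha> where "\<alpha> = (A + c) / 2"
  have "real CARD('n) < A * p" using r_eq(3) s by simp
  then have "c < A" using p_gt_1 by (simp add: c_def field_simps)
  then have \<alpha>: "\<alpha> < A" "c < \<alpha>" by (simp_all add: \<alpha>_def)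
  have "0 < c" using p_gt_1 by (simp add: c_def)
  then have \<alpha>0: "0 < \<alpha>" using \<alpha> by linarith
  define \<beta> where "\<beta> = \<alpha> * p"
  have \<beta>: "\<beta> > real CARD('n)" using \<alpha>(2) p_gt_1 by (simp add: \<beta>_def c_def field_simps)
  obtain K R0 where K: "K > 0" "R0 > 0" "\<And>a. norm a \<ge> R0 \<Longrightarrow> U a \<le> K * norm a powr (- \<alpha>)"
    using decay_subcritical[OF \<alpha>0 \<alpha>(1)] by blast
  define R where "R = max R0 1"
  have R: "R \<ge> 1" "R \<ge> R0" by (simp_all add: R_def)
  have tail: "U x powr p \<le> K powr p * norm x powr (- \<beta>)" if "norm x \<ge> R" for x
  proof -
    have "U x powr p \<le> (K * norm x powr (- \<alpha>)) powr p"
      using K(3)[of x] that R U(1)[of x] p_gt_1 by (intro powr_mono2) auto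
    also have "\<dots> = K powr p * norm x powr (- \<beta>)" by (simp only: powr_mult powr_powr \<beta>_def mult_minus_left)
    finally show ?thesis .
  qed
  obtain B where B: "B \<ge> 0" "(\<integral>\<^sup>+x. (if norm x < 2 * R then ennreal (U x powr p) else 0) \<partial>lborel) \<le> ennreal B"
    using local_mass by blast
  obtain D3 where D3: "D3 \<ge> 0" "\<And>r. r > 0 \<Longrightarrow>
    (\<integral>\<^sup>+y. pow_out \<beta> r (y::real^'n) \<partial>lborel) = ennreal (D3 * r powr (real CARD('n) - \<beta>))"
    using nn_integral_norm_powr_outside[of \<beta>, where 'a="real^'n"] \<beta> by auto
  obtain D where D: "D \<ge> 0" "\<And>(a::real^'n) (\<rho>::real). \<rho> > 0 \<Longrightarrow>
    (\<integral>\<^sup>+x. pow_in A \<rho> (x - a) \<partial>lborel) = ennreal (D * \<rho> powr (2 * s))"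
    using near_field by blast
  define T where "T = B + K powr p * (D3 * R powr (real CARD('n) - \<beta>))"
  have T0: "T \<ge> 0" using B D3 by (simp add: T_def)
  have total: "(\<integral>\<^sup>+x. ennreal (U x powr p) \<partial>lborel) \<le> ennreal T"
  proof -
    have "(\<integral>\<^sup>+x. ennreal (U x powr p) \<partial>lborel) \<le> (\<integral>\<^sup>+x. (if norm x < 2 * R then ennreal (U x powr p) else 0) +
       ennreal (K powr p) * pow_out \<beta> R x \<partial>lborel)"
    proof (intro nn_integral_mono)
      fix x :: "real^'n"
      show "ennreal (U x powr p) \<le> (if norm x < 2 * R then ennreal (U x powr p) else 0) +
       ennreal (K powr p) * pow_out \<beta> R x"
      proof (cases "norm x < 2 * R")
        case False
        then have "norm x > R" using R by linarith
        then show ?thesis using tail[of x] False by (simp add: ennreal_mult[symmetric] ennreal_leI)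
      qed simp
    qed
    also have "\<dots> = (\<integral>\<^sup>+x. (if norm x < 2 * R then ennreal (U x powr p) else 0) \<partial>lborel) +
       ennreal (K powr p) * (\<integral>\<^sup>+x. pow_out \<beta> R (x::real^'n) \<partial>lborel)"
      by (simp add: nn_integral_add nn_integral_cmult)
    also have "(\<integral>\<^sup>+x. pow_out \<beta> R (x::real^'n) \<partial>lborel) = ennreal (D3 * R powr (real CARD('n) - \<beta>))"
      using R by (intro D3(2)) simp
    also have "(\<integral>\<^sup>+x. (if norm x < 2 * R then ennreal (U x powr p) else 0) \<partial>lborel) + ennreal (K powr p) * ennreal (D3 * R powr (real CARD('n) - \<beta>)) \<le>
       ennreal B + ennreal (K powr p) * ennreal (D3 * R powr (real CARD('n) - \<beta>))"
      by (intro add_right_mono B(2))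
    also have "\<dots> = ennreal T" using B(1) D3(1) by (simp add: T_def ennreal_mult)
    finally show ?thesis .
  qed
  define K' where "K' = C * 2 powr A * (T + K powr p * D) + 1"
  show ?thesis
  proof (rule that[of K' "2 * R"])
    show "K' > 0" "2 * R > 0" using C T0 D(1) R by (auto simp: K'_def intro!: add_nonneg_pos mult_nonneg_nonneg add_nonneg_nonneg)
    fix a :: "real^'n" assume a: "norm a \<ge> 2 * R"
    define \<rho> where "\<rho> = norm a / 2"
    have \<rho>: "\<rho> \<ge> R" "\<rho> \<ge> 1" "\<rho> > 0" using a R by (auto simp: \<rho>_def)
    let ?near = "\<lambda>x. if norm (x - a) < \<rho> then ennreal (U x powr p * norm (x - a) powr (- A)) else 0"
    have near: "(\<integral>\<^sup>+x. ?near x \<partial>lborel) \<le> ennreal (K powr p * D * \<rho> powr (- A))"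
    proof -
      have "(\<integral>\<^sup>+x. ?near x \<partial>lborel) \<le> ennreal ((K * \<rho> powr (- \<alpha>)) powr p * D * \<rho> powr (2 * s))"
      proof (rule weighted_bound[OF \<rho>(3) _ _ D(2,1)])
        fix x assume "norm (x - a) < \<rho>"
        then have "\<rho> \<le> norm x" using norm_triangle_ineq2[of a x] by (simp add: \<rho>_def norm_minus_commute)
        then have "U x \<le> K * norm x powr (- \<alpha>)" using \<rho>(1) R by (intro K(3)) linarith
        also have "\<dots> \<le> K * \<rho> powr (- \<alpha>)" using \<open>\<rho> \<le> norm x\<close> \<rho>(3) \<alpha>0 K(1) by (intro mult_left_mono powr_mono2') auto
        finally show "U x \<le> K * \<rho> powr (- \<alpha>)" .
      qed (use K(1) in auto)
      also have "(K * \<rho> powr (- \<alpha>)) powr p * D * \<rho> powr (2 * s) = K powr p * D * \<rho> powr (2 * s - \<beta>)"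
      proof -
        have "(K * \<rho> powr (- \<alpha>)) powr p = K powr p * \<rho> powr (- \<beta>)" by (simp only: powr_mult powr_powr \<beta>_def mult_minus_left)
        moreover have "- \<beta> + 2 * s = 2 * s - \<beta>" by simp
        then have "\<rho> powr (- \<beta>) * \<rho> powr (2 * s) = \<rho> powr (2 * s - \<beta>)" by (simp only: powr_add[symmetric])
        ultimately show ?thesis by (simp add: mult_ac)
      qed
      also have "\<dots> \<le> K powr p * D * \<rho> powr (- A)"
        using \<beta> \<rho>(2) D(1) by (intro mult_left_mono powr_mono) (auto simp: A)
      finally show ?thesis by (simp add: ennreal_leI)
    qed
    have "(\<integral>\<^sup>+x. ennreal (U x powr p * norm (x - a) powr (- A)) \<partial>lborel) \<le> (\<integral>\<^sup>+x. ?near x + ennreal (\<rho> powr (- A)) * ennreal (U x powr p) \<partial>lborel)"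
    proof (intro nn_integral_mono)
      fix x
      show "ennreal (U x powr p * norm (x - a) powr (- A)) \<le> ?near x + ennreal (\<rho> powr (- A)) * ennreal (U x powr p)"
      proof (cases "norm (x - a) < \<rho>")
        case False
        then have "norm (x - a) powr (- A) \<le> \<rho> powr (- A)" using \<rho> A_pos by (intro powr_mono2') auto
        then have "U x powr p * norm (x - a) powr (- A) \<le> \<rho> powr (- A) * U x powr p"
          by (subst mult.commute) (intro mult_right_mono, auto)
        then show ?thesis using False by (simp add: ennreal_mult[symmetric] ennreal_leI)
      qed simp
    qed
    also have "\<dots> = (\<integral>\<^sup>+x. ?near x \<partial>lborel) + ennreal (\<rho> powr (- A)) * (\<integral>\<^sup>+x. ennreal (U x powr p) \<partial>lborel)"
      by (simp add: nn_integral_add nn_integral_cmult)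
    also have "\<dots> \<le> ennreal (K powr p * D * \<rho> powr (- A)) + ennreal (\<rho> powr (- A)) * ennreal T"
      by (intro add_mono near mult_left_mono total) simp
    also have "\<dots> = ennreal (\<rho> powr (- A) * (T + K powr p * D))"
      using D(1) T0 by (simp add: ennreal_mult[symmetric] ennreal_plus[symmetric] algebra_simps del: ennreal_plus)
    finally have "ennreal (U a) \<le> ennreal C * ennreal (\<rho> powr (- A) * (T + K powr p * D))"
      using bound[of a] by (meson mult_left_mono order_trans zero_le)
    also have "\<dots> = ennreal (C * (\<rho> powr (- A) * (T + K powr p * D)))"
      using C T0 D(1) by (intro ennreal_mult[symmetric]) auto
    finally have "U a \<le> C * (\<rho> powr (- A) * (T + K powr p * D))"
      using C T0 D(1) by (subst (asm) ennreal_le_iff) auto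
    also have "\<rho> powr (- A) = 2 powr A * norm a powr (- A)"
    proof -
      have "\<rho> powr (- A) = norm a powr (- A) / 2 powr (- A)" unfolding \<rho>_def by (rule powr_divide)
      then show ?thesis by (simp only: powr_minus divide_inverse inverse_inverse_eq mult.commute)
    qed
    also have "C * (2 powr A * norm a powr (- A) * (T + K powr p * D)) \<le> K' * norm a powr (- A)"
      by (simp add: K'_def algebra_simps)
    finally show "U a \<le> K' * norm a powr (- A)" .
  qed
qed

end

subsection \<open>Weak solutions\<close>

text \<open>(p-1) N/(2s) splits into (p-1) + (p-1)(N-2s)/(2s), and the last term is at least 2 since
  p - 1 >= 4s/(N-2s).\<close>

lemma exponents_less:
  fixes s p q N :: real
  assumes s: "0 < s" and N: "2 * s < N" and p: "p \<ge> 2 * N / (N - 2 * s) - 1" and q: "q > (p - 1) * (N / (2 * s)) - 1"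
  shows "p < q"
proof -
  have "2 * N / (N - 2 * s) - 2 = 4 * s / (N - 2 * s)" using N by (simp add: field_simps)
  then have "4 * s / (N - 2 * s) \<le> p - 1" using p by linarith
  then have "4 * s / (N - 2 * s) * ((N - 2 * s) / (2 * s)) \<le> (p - 1) * ((N - 2 * s) / (2 * s))"
    using s N by (intro mult_right_mono) auto
  moreover have "4 * s / (N - 2 * s) * ((N - 2 * s) / (2 * s)) = 2" using s N by simp
  moreover have "(p - 1) * ((N - 2 * s) / (2 * s)) = (p - 1) * (N / (2 * s)) - (p - 1)"
    using s by (simp add: field_simps)
  ultimately show ?thesis using q by linarith
qed

text \<open>Membership in \<open>X0\<close> is finiteness of norms together with vanishing outside
  the domain, so the Lipschitz bound and the value 0 of \<open>cutoff\<close> at 0 suffice, with no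
  approximation by test functions.\<close>

lemma X0_cutoff:
  fixes u :: "real ^ 'n \<Rightarrow> real"
  assumes s: "0 < s" "s < 1" and u: "u \<in> X0 s \<Omega>"
  shows "(\<lambda>x. cutoff (u x)) \<in> X0 s \<Omega>"
proof -
  have cm[measurable]: "cutoff \<in> borel_measurable borel"
    using smooth_continuous_on[OF smooth_cutoff[OF smooth_inner[of "1::real"]]]
    by (intro borel_measurable_continuous_onI) simp
  have um[measurable]: "u \<in> borel_measurable lebesgue" and int: "integrable lebesgue (\<lambda>x. \<bar>u x\<bar> powr 2)"
    and en: "Hdot_norm s u < \<infinity>" and zero: "AE x in lebesgue. x \<notin> \<Omega> \<longrightarrow> u x = 0"
    using u by (auto simp: X0_def Hs_def Lp_def lebesgue_on_UNIV_eq)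
  have c: "frac_const CARD('n) s / 2 > 0" using frac_const_pos[OF s] by simp
  have fin: "Hdot_norm s w < \<infinity> \<longleftrightarrow> energy s w < \<infinity>" for w :: "real ^ 'n \<Rightarrow> real"
    unfolding Hdot_norm_eq enn_powr_def using c by (auto simp: ennreal_mult_eq_top_iff less_top)
  have "energy s (\<lambda>x. cutoff (u x)) \<le> 4 * energy s u"
  proof -
    obtain v where [measurable]: "v \<in> borel_measurable borel" and uv: "AE x in lborel. u x = v x"
      using lebesgue_AE_eq_borel[OF um] .
    have "energy s (\<lambda>x. cutoff (v x)) \<le> (\<integral>\<^sup>+y. \<integral>\<^sup>+x. 4 * ennreal (\<bar>v x - v y\<bar>\<^sup>2 / norm (x - y) powr (real CARD('n) + 2 * s)) \<partial>lborel \<partial>lborel)"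
      unfolding energy_def
    proof (intro nn_integral_mono)
      fix x y
      have "\<bar>cutoff (v x) - cutoff (v y)\<bar>\<^sup>2 \<le> (2 * \<bar>v x - v y\<bar>)\<^sup>2" by (intro power_mono cutoff_lipschitz) simp
      then have "\<bar>cutoff (v x) - cutoff (v y)\<bar>\<^sup>2 / norm (x - y) powr (real CARD('n) + 2 * s) \<le>
         4 * \<bar>v x - v y\<bar>\<^sup>2 / norm (x - y) powr (real CARD('n) + 2 * s)"
        by (intro divide_right_mono) (auto simp: power_mult_distrib)
      then have "ennreal (\<bar>cutoff (v x) - cutoff (v y)\<bar>\<^sup>2 / norm (x - y) powr (real CARD('n) + 2 * s)) \<le>
         ennreal (4 * (\<bar>v x - v y\<bar>\<^sup>2 / norm (x - y) powr (real CARD('n) + 2 * s)))" by (intro ennreal_leI) simp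
      then show "ennreal (\<bar>cutoff (v x) - cutoff (v y)\<bar>\<^sup>2 / norm (x - y) powr (real CARD('n) + 2 * s)) \<le>
         4 * ennreal (\<bar>v x - v y\<bar>\<^sup>2 / norm (x - y) powr (real CARD('n) + 2 * s))" by (subst (asm) ennreal_mult) auto
    qed
    also have "\<dots> = 4 * energy s v" unfolding energy_def by (simp add: nn_integral_cmult)
    also have "energy s v = energy s u" using energy_cong_AE[OF uv] by simp
    also have "energy s (\<lambda>x. cutoff (v x)) = energy s (\<lambda>x. cutoff (u x))"
      by (rule energy_cong_AE) (use uv in eventually_elim, simp)
    finally show ?thesis .
  qed
  then have "Hdot_norm s (\<lambda>x. cutoff (u x)) < \<infinity>"
    using en unfolding fin by (auto simp: ennreal_mult_less_top elim!: order_le_less_trans)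
  moreover have "integrable lebesgue (\<lambda>x. \<bar>cutoff (u x)\<bar> powr 2)"
  proof (rule Bochner_Integration.integrable_bound[of _ "\<lambda>x. 4 * \<bar>u x\<bar> powr 2"])
    show "AE x in lebesgue. norm (\<bar>cutoff (u x)\<bar> powr 2) \<le> norm (4 * \<bar>u x\<bar> powr 2)"
    proof (rule AE_I2)
      fix x
      have "\<bar>cutoff (u x)\<bar> \<le> 2 * \<bar>u x\<bar>" using cutoff_lipschitz[of "u x" 0] cutoff_zero[of 0] by simp
      then have "\<bar>cutoff (u x)\<bar> powr 2 \<le> (2 * \<bar>u x\<bar>) powr 2" by (intro powr_mono2) auto
      then show "norm (\<bar>cutoff (u x)\<bar> powr 2) \<le> norm (4 * \<bar>u x\<bar> powr 2)" by (simp add: power_mult_distrib)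
    qed
  qed (use int in auto)
  moreover have "AE x in lebesgue. x \<notin> \<Omega> \<longrightarrow> cutoff (u x) = 0"
    using zero by eventually_elim (auto simp: cutoff_zero)
  ultimately show ?thesis by (simp add: X0_def Hs_def Lp_def lebesgue_on_UNIV_eq)
qed

lemma weak_solution_bounded:
  fixes u :: "real ^ 'n \<Rightarrow> real"
  assumes s: "0 < s" "s < 1" "2 * s < real CARD('n)" and pq: "p < q"
    and sol: "weak_solution_space s p q u \<or> weak_solution_domain s p q \<Omega> u"
  shows "u \<in> borel_measurable lebesgue" "AE x in lebesgue. 0 \<le> u x \<and> u x \<le> 1"
proof -
  show um: "u \<in> borel_measurable lebesgue"
    using sol Hdot_iff[OF s] by (auto simp: weak_solution_space_def weak_solution_domain_def X0_def Hs_def Lp_def lebesgue_on_UNIV_eq)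
  have "weak_identity s p q u (\<lambda>x. cutoff (u x))"
    using sol Hdot_cutoff[OF s] X0_cutoff[OF s(1,2)] by (auto simp: weak_solution_space_def weak_solution_domain_def)
  then have "AE x in lebesgue. u x \<le> 1" by (rule weak_identity_cutoff_bound[OF s(1,2) pq um])
  moreover have "AE x in lebesgue. 0 \<le> u x"
  proof -
    have "AE x in lebesgue. 0 \<le> u x" if "weak_solution_space s p q u"
    proof -
      have "AE x in lebesgue. 0 < u x" using that by (simp add: weak_solution_space_def)
      then show ?thesis by eventually_elim simp
    qed
    moreover have "AE x in lebesgue. 0 \<le> u x" if "weak_solution_domain s p q \<Omega> u"
    proof -
      have "AE x in lebesgue. x \<in> \<Omega> \<longrightarrow> 0 < u x" "AE x in lebesgue. x \<notin> \<Omega> \<longrightarrow> u x = 0"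
        using that by (auto simp: weak_solution_domain_def X0_def)
      then show ?thesis by eventually_elim force
    qed
    ultimately show ?thesis using sol by blast
  qed
  ultimately show "AE x in lebesgue. 0 \<le> u x \<and> u x \<le> 1" by eventually_elim simp
qed

lemma weak_solution_decay:
  fixes u :: "real ^ 'n \<Rightarrow> real"
  assumes s: "0 < s" "s < 1" "2 * s < real CARD('n)" and pq: "p < q" and p: "p \<ge> crit_exp CARD('n) s - 1"
    and sol: "weak_solution_space s p q u"
  obtains C1 C2 R where "C1 > 0" "C2 > 0" "R > 0"
    "AE x in lebesgue. norm x > R \<longrightarrow> C1 * norm x powr (- (real CARD('n) - 2 * s)) \<le> u x \<and> u x \<le> C2 * norm x powr (- (real CARD('n) - 2 * s))"
proof -
  define A where "A = real CARD('n) - 2 * s"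
  have A: "A > 0" using s by (simp add: A_def)
  define p0 where "p0 = (real CARD('n) + 2 * s) / A"
  have p0: "p0 \<le> p"
  proof -
    have "p0 = crit_exp CARD('n) s - 1" using A unfolding p0_def crit_exp_def A_def[symmetric] by (simp add: field_simps) (simp add: A_def)
    then show ?thesis using p by simp
  qed
  have uH: "u \<in> Hdot s" and uL: "integrable lebesgue (\<lambda>x. \<bar>u x\<bar> powr (q + 1))" and upos: "AE x in lebesgue. 0 < u x"
    using sol by (auto simp: weak_solution_space_def Lp_def lebesgue_on_UNIV_eq)
  note bd = weak_solution_bounded[OF s pq disjI1[OF sol]]
  obtain v0 where [measurable]: "v0 \<in> borel_measurable borel" and uv0: "AE x in lborel. u x = v0 x"
    using lebesgue_AE_eq_borel[OF bd(1)] .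
  \<comment> \<open>The exceptional values form a null set; 1/2 is a value for which positivity and
    the bound 1 hold at every point.\<close>
  define v where "v = (\<lambda>x. if 0 < v0 x \<and> v0 x \<le> 1 then v0 x else 1 / 2)"
  have [measurable]: "v \<in> borel_measurable borel" unfolding v_def by measurable
  have v: "0 < v x" "v x \<le> 1" "0 \<le> v x" for x by (auto simp: v_def)
  have uv: "AE x in lborel. u x = v x"
    using uv0 upos[unfolded AE_completion_iff] bd(2)[unfolded AE_completion_iff]
    by eventually_elim (auto simp: v_def)
  obtain K where K: "K \<ge> 0" and rep0: "AE a in lborel.
     (\<integral>\<^sup>+x. ennreal ((v x powr p - v x powr q) * norm (x - a) powr (- A)) \<partial>lborel) = ennreal (K * v a)"
    using weak_solution_representation[OF s less_imp_le[OF pq] sol _ v(3,2) uv] unfolding A_def by auto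
  define f where "f x = v x powr p - v x powr q" for x
  have [measurable]: "f \<in> borel_measurable borel" unfolding f_def by measurable
  have f0: "0 \<le> f x" for x using powr_mono'[OF less_imp_le[OF pq] v(3,2), of x] by (simp add: f_def)
  \<comment> \<open>Since v <= 1 and \<open>p0\<close> <= p, lowering the exponent enlarges the
    power: the nonlinearity is majorised by the critical one.\<close>
  have fp: "f x \<le> v x powr p0" for x using powr_mono'[OF p0 v(3,2), of x] powr_ge_zero[of "v x" q] unfolding f_def by linarith
  define I where "I a = (\<integral>\<^sup>+x. ennreal (f x * norm (x - a) powr (- A)) \<partial>lborel)" for a
  have [measurable]: "I \<in> borel_measurable borel" unfolding I_def by measurable
  have rep: "AE a in lborel. I a = ennreal (K * v a)" using rep0 by (simp add: I_def f_def)
  have inf: "emeasure lborel (UNIV :: (real^'n) set) = \<infinity>" by simp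
  \<comment> \<open>v^p = v^q forces v = 1, and the constant 1 is not in L^(q+1) of the whole
    space.\<close>
  have f_pos: "\<not> (AE x in lborel. f x = 0)"
  proof
    assume "AE x in lborel. f x = 0"
    then have "AE x in lborel. \<bar>u x\<bar> powr (q + 1) = 1"
      using uv
    proof eventually_elim
      case (elim x)
      have "v x = 1"
      proof (rule ccontr)
        assume "v x \<noteq> 1"
        then have "v x powr q < v x powr p" using v[of x] pq by (intro powr_less_mono') auto
        with elim show False by (simp add: f_def)
      qed
      with elim show ?case by simp
    qed
    then have "(\<integral>\<^sup>+x. ennreal (norm (\<bar>u x\<bar> powr (q + 1))) \<partial>lborel) = (\<integral>\<^sup>+x. 1 \<partial>(lborel :: (real^'n) measure))"
      by (intro nn_integral_cong_AE) (auto elim!: eventually_mono)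
    moreover have "(\<integral>\<^sup>+x. ennreal (norm (\<bar>u x\<bar> powr (q + 1))) \<partial>lborel) < \<infinity>"
      using uL by (simp add: integrable_iff_bounded nn_integral_completion)
    ultimately show False using inf by simp
  qed
  obtain R :: real where R: "R > 0" "(\<integral>\<^sup>+x. (if norm x < R then ennreal (f x) else 0) \<partial>lborel) > 0"
  proof -
    have "\<exists>n. (\<integral>\<^sup>+x. (if norm x < real (Suc n) then ennreal (f x) else 0) \<partial>lborel) > 0"
    proof (rule ccontr)
      assume "\<not> ?thesis"
      then have "(\<integral>\<^sup>+x. (if norm x < real (Suc n) then ennreal (f x) else 0) \<partial>lborel) = 0" for n
        by (metis not_gr_zero)
      then have "AE x in lborel. (if norm x < real (Suc n) then ennreal (f x) else 0) = 0" for n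
        by (subst (asm) nn_integral_0_iff_AE) auto
      then have "AE x in lborel. \<forall>n. (if norm x < real (Suc n) then ennreal (f x) else 0) = 0"
        by (subst AE_all_countable) blast
      then have "AE x in lborel. f x = 0"
      proof eventually_elim
        case (elim x)
        obtain n where "norm x < real n" using reals_Archimedean2 by blast
        then have "norm x < real (Suc n)" by simp
        then have "ennreal (f x) = 0" using elim by (metis (full_types))
        then show ?case using f0[of x] by (simp add: ennreal_eq_0_iff)
      qed
      then show False using f_pos by blast
    qed
    then show ?thesis by (auto intro: that[of "real (Suc _)"])
  qed
  \<comment> \<open>A finite positive number below the mass of f in a ball, a mass not known to be
    finite at this point.\<close>
  obtain J where J: "J > 0" "ennreal J \<le> (\<integral>\<^sup>+x. (if norm x < R then ennreal (f x) else 0) \<partial>lborel)"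
    using R(2) by (cases "\<integral>\<^sup>+x. (if norm x < R then ennreal (f x) else 0) \<partial>lborel") (auto intro: that[of 1])
  have lower: "ennreal (J * (2 * norm a) powr (- A)) \<le> I a" if a: "norm a > R" for a
  proof -
    have "ennreal (J * (2 * norm a) powr (- A)) = ennreal J * ennreal ((2 * norm a) powr (- A))" using J(1) by (simp add: ennreal_mult)
    also have "\<dots> \<le> (\<integral>\<^sup>+x. (if norm x < R then ennreal (f x) else 0) \<partial>lborel) * ennreal ((2 * norm a) powr (- A))"
      by (intro mult_right_mono J(2)) simp
    also have "\<dots> = (\<integral>\<^sup>+x. (if norm x < R then ennreal (f x) else 0) * ennreal ((2 * norm a) powr (- A)) \<partial>lborel)"
      by (rule nn_integral_multc[symmetric]) measurable
    also have "\<dots> \<le> I a"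
      unfolding I_def
    proof (intro nn_integral_mono)
      fix x
      show "(if norm x < R then ennreal (f x) else 0) * ennreal ((2 * norm a) powr (- A)) \<le> ennreal (f x * norm (x - a) powr (- A))"
      proof (cases "norm x < R")
        case True
        have "norm (x - a) \<le> 2 * norm a" using norm_triangle_ineq4[of x a] True a by linarith
        moreover have "0 < norm (x - a)" using True a by auto
        ultimately have "(2 * norm a) powr (- A) \<le> norm (x - a) powr (- A)" using A by (intro powr_mono2') auto
        then have "ennreal (f x * (2 * norm a) powr (- A)) \<le> ennreal (f x * norm (x - a) powr (- A))"
          using f0 by (intro ennreal_leI mult_left_mono) auto
        then show ?thesis using True f0[of x] by (simp add: ennreal_mult)
      qed simp
    qed
    finally show ?thesis .
  qed
  \<comment> \<open>K = 0 would make the potential vanish almost everywhere, against its positive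
    lower bound outside a ball of finite measure.\<close>
  have K0: "K > 0"
  proof (rule ccontr)
    assume "\<not> K > 0"
    then have "K = 0" using K by simp
    have "AE a in lborel. norm (a::real^'n) \<le> R"
      using rep
    proof eventually_elim
      case (elim a)
      show ?case
      proof (rule ccontr)
        assume *: "\<not> norm a \<le> R"
        then have "norm a > 0" using R(1) by linarith
        then have "0 < J * (2 * norm a) powr (- A)" using J(1) by simp
        then have "0 < ennreal (J * (2 * norm a) powr (- A))" by simp
        also have "\<dots> \<le> I a" using lower[of a] * by simp
        finally show False using elim \<open>K = 0\<close> by simp
      qed
    qed
    then have "emeasure lborel (UNIV :: (real^'n) set) \<le> emeasure lborel (cball (0::real^'n) R)"
      by (intro emeasure_mono_AE) (auto elim!: eventually_mono)
    then show False using inf emeasure_bounded_finite[OF bounded_cball, of "0::real^'n" R] by simp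
  qed
  \<comment> \<open>\<open>enn2real\<close> maps \<open>\<infinity>\<close> to \<open>0\<close>, so \<open>U \<le> I / K\<close> everywhere although \<open>K v = I\<close> only almost everywhere.\<close>
  define U where "U a = min (enn2real (I a) / K) 1" for a
  have [measurable]: "U \<in> borel_measurable borel" unfolding U_def by measurable
  have vU: "AE a in lborel. v a = U a"
    using rep
  proof eventually_elim
    case (elim a)
    then show ?case using K0 v[of a] by (simp add: U_def)
  qed
  have pb: "potential_bound s A p0 (crit_exp CARD('n) s) (1 / K) 1 U"
  proof
    show "0 < s" "2 * s < real CARD('n)" "A = real CARD('n) - 2 * s" "p0 = (real CARD('n) + 2 * s) / A" "crit_exp CARD('n) s = crit_exp CARD('n) s"
      using s by (simp_all add: A_def p0_def)
    show "U \<in> borel_measurable borel" by simp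
    show "0 \<le> U x" "U x \<le> 1" for x using K0 by (auto simp: U_def)
    show "0 < 1 / K" using K0 by simp
    show "Lp_mass (crit_exp CARD('n) s) U < \<infinity>"
      using Hdot_mass_finite[OF s uH] Lp_mass_cong_AE[OF uv] Lp_mass_cong_AE[OF vU] by metis
    fix a
    have "ennreal (U a) \<le> ennreal (1 / K) * I a"
    proof (cases "I a")
      case (real i)
      have "U a \<le> 1 / K * i" using real by (simp add: U_def)
      then show ?thesis using real K0 by (simp add: ennreal_mult[symmetric] ennreal_leI)
    next
      case top
      then show ?thesis using K0 by (simp add: ennreal_mult_top)
    qed
    also have "I a \<le> (\<integral>\<^sup>+x. ennreal (v x powr p0 * norm (x - a) powr (- A)) \<partial>lborel)"
      unfolding I_def by (intro nn_integral_mono ennreal_leI mult_right_mono fp) auto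
    also have "\<dots> = (\<integral>\<^sup>+x. ennreal (U x powr p0 * norm (x - a) powr (- A)) \<partial>lborel)"
      by (rule nn_integral_cong_AE) (use vU in eventually_elim, simp)
    finally show "ennreal (U a) \<le> ennreal (1 / K) * (\<integral>\<^sup>+x. ennreal (U x powr p0 * norm (x - a) powr (- A)) \<partial>lborel)"
      by (simp add: mult_left_mono)
  qed
  obtain C2 R2 where C2: "C2 > 0" "R2 > 0" "\<And>a. norm a \<ge> R2 \<Longrightarrow> U a \<le> C2 * norm a powr (- A)"
    using potential_bound.decay[OF pb] by blast
  show ?thesis
  proof (rule that[of "J * 2 powr (- A) / K" C2 "max R R2"])
    show "J * 2 powr (- A) / K > 0" "C2 > 0" "max R R2 > 0" using J(1) K0 C2 R(1) by auto
    have "AE x in lborel. norm x > max R R2 \<longrightarrow> J * 2 powr (- A) / K * norm x powr (- A) \<le> u x \<and> u x \<le> C2 * norm x powr (- A)"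
      using uv vU rep
    proof eventually_elim
      case (elim x)
      show ?case
      proof (intro impI conjI)
        assume x: "norm x > max R R2"
        have "ennreal (J * (2 * norm x) powr (- A)) \<le> ennreal (K * v x)" using lower[of x] x elim by simp
        then have "J * (2 * norm x) powr (- A) \<le> K * v x" using K0 v[of x] by (subst (asm) ennreal_le_iff) auto
        then show "J * 2 powr (- A) / K * norm x powr (- A) \<le> u x"
          using K0 elim by (simp add: powr_mult field_simps)
        show "u x \<le> C2 * norm x powr (- A)" using C2(3)[of x] x elim by simp
      qed
    qed
    then show "AE x in lebesgue. norm x > max R R2 \<longrightarrow>
       J * 2 powr (- A) / K * norm x powr (- (real CARD('n) - 2 * s)) \<le> u x \<and> u x \<le> C2 * norm x powr (- (real CARD('n) - 2 * s))"
      unfolding A_def[symmetric] by (rule AE_completion)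
  qed
qed

theorem theorem1p1:
  fixes s p q :: real
    and \<Omega> :: "(real ^ 'n) set"
    and u :: "real ^ 'n \<Rightarrow> real"
  assumes "0 < s" and "s < 1"
    and "real CARD('n) > 2 * s"
    and "p \<ge> crit_exp CARD('n) s - 1"
    and "q > (p - 1) * (real CARD('n) / (2 * s)) - 1"
    and "\<Omega> = UNIV \<and> weak_solution_space s p q u \<or>
         smooth_bounded_domain \<Omega> \<and> weak_solution_domain s p q \<Omega> u"
  shows "u \<in> Linf \<and>
    (\<Omega> = UNIV \<longrightarrow>
      (\<exists>C1>0. \<exists>C2>0. \<exists>R0>0. AE x in lebesgue. norm x > R0 \<longrightarrow>
         C1 * norm x powr (- (real CARD('n) - 2 * s)) \<le> u x \<and>
         u x \<le> C2 * norm x powr (- (real CARD('n) - 2 * s))))"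
proof -
  have s: "0 < s" "s < 1" "2 * s < real CARD('n)" using assms(1-3) by auto
  have pq: "p < q"
    using exponents_less[OF s(1,3) assms(4)[unfolded crit_exp_def] assms(5)] .
  have "weak_solution_space s p q u \<or> weak_solution_domain s p q \<Omega> u" using assms(6) by blast
  note bd = weak_solution_bounded[OF s pq this]
  have "AE x in lebesgue. \<bar>u x\<bar> \<le> 1" using bd(2) by eventually_elim auto
  then have "u \<in> Linf" using bd(1) by (auto simp: Linf_def)
  moreover have "\<exists>C1>0. \<exists>C2>0. \<exists>R0>0. AE x in lebesgue. norm x > R0 \<longrightarrow>
         C1 * norm x powr (- (real CARD('n) - 2 * s)) \<le> u x \<and>
         u x \<le> C2 * norm x powr (- (real CARD('n) - 2 * s))" if "\<Omega> = UNIV"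
  proof -
    \<comment> \<open>The whole space is unbounded, so the two alternatives exclude each
      other.\<close>
    have "\<not> smooth_bounded_domain \<Omega>" using that not_bounded_UNIV by (auto simp: smooth_bounded_domain_def)
    then have "weak_solution_space s p q u" using assms(6) by blast
    then obtain C1 C2 R0 where "C1 > 0" "C2 > 0" "R0 > 0" "AE x in lebesgue. norm x > R0 \<longrightarrow>
         C1 * norm x powr (- (real CARD('n) - 2 * s)) \<le> u x \<and> u x \<le> C2 * norm x powr (- (real CARD('n) - 2 * s))"
      by (rule weak_solution_decay[OF s pq assms(4)])
    then show ?thesis by blast
  qed
  ultimately show ?thesis by blast
qed

end
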